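(* Let $Z$ be the set of $n$ marked points of $\mathfrak{M}_{0,n}$, and let $\gamma$ be a set of boundary divisors of $\overline{\mathfrak{M}}_{0,n}$ which is either a set containing only one divisor $\{d_A\}$, a set of two divisors $\{d_A,d_B\}$, or a set of three divisors $\{d_A,d_B,d_{A\cup B}\}$. Then the partial compactification $\mathfrak{M}_{0,n}^\gamma$ is an affine variety.
   Context: $\overline{\mathfrak{M}}_{0,n}$ is the Deligne–Mumford compactification of the moduli space $\mathfrak{M}_{0,n}$ of genus $0$ curves with $n$ ordered distinct marked points. For a subset $A\subset Z$ with $2\le|A|\le n-2$, $d_A$ is the irreducible boundary divisor of $\overline{\mathfrak{M}}_{0,n}\setminus\mathfrak{M}_{0,n}$ corresponding to the partition $Z=A\sqcup(Z\setminus A)$; thus $d_A=d_{Z\setminus A}$. All subsets indexing divisors (in particular $A$, $B$, and $A\cup B$ in the third case) are assumed to have cardinality between $2$ and $n-2$. For a set $\gamma$ of boundary divisors, $\mathfrak{M}_{0,n}^\gamma$ is the complement in $\overline{\mathfrak{M}}_{0,n}$ of the union of all boundary divisors not in $\gamma$, so $\mathfrak{M}_{0,n}\subset\mathfrak{M}_{0,n}^\gamma\subset\overline{\mathfrak{M}}_{0,n}$. *)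

theory Defs
  imports "HOL-Library.FuncSet"
    "HOL-Computational_Algebra.Polynomial"
begin

section \<open>Subvarieties of products of projective lines\<close>

text \<open>
  The projective line over a field \<open>k\<close>; \<open>Fin a\<close> is \<open>[a : 1]\<close> and \<open>Infty\<close> is \<open>[1 : 0]\<close>.
\<close>

datatype 'k pline = Fin 'k | Infty

fun hcoords :: "'k::field pline \<Rightarrow> 'k \<times> 'k" where
  "hcoords (Fin a) = (a, 1)"
| "hcoords Infty = (1, 0)"

definition ratio :: "'k::field \<Rightarrow> 'k \<Rightarrow> 'k pline" where
  "ratio s t = (if t = 0 then Infty else Fin (s / t))"

text \<open>
  A point of the product of copies of the projective line indexed by a finite set \<open>I\<close> is an element
  of \<open>I \<rightarrow>\<^sub>E UNIV\<close>.  \<open>multiform I d F\<close>: \<open>F\<close> is (the function on homogeneous coordinates given by)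
  a multihomogeneous polynomial, of degree \<open>d i\<close> in the pair of coordinates of the \<open>i\<close>-th factor.
\<close>

inductive multiform ::
    "'i set \<Rightarrow> ('i \<Rightarrow> nat) \<Rightarrow> (('i \<Rightarrow> 'k::field \<times> 'k) \<Rightarrow> 'k) \<Rightarrow> bool" for I where
  scalar: "multiform I (\<lambda>_. 0) (\<lambda>_. c)"
| coord1: "i \<in> I \<Longrightarrow> multiform I ((\<lambda>_. 0)(i := 1)) (\<lambda>h. fst (h i))"
| coord2: "i \<in> I \<Longrightarrow> multiform I ((\<lambda>_. 0)(i := 1)) (\<lambda>h. snd (h i))"
| add: "multiform I d F \<Longrightarrow> multiform I d G \<Longrightarrow> multiform I d (\<lambda>h. F h + G h)"
| mult: "multiform I d F \<Longrightarrow> multiform I e G \<Longrightarrow> multiform I (\<lambda>i. d i + e i) (\<lambda>h. F h * G h)"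

text \<open>
  Morphisms from a subset \<open>X\<close> of a product of projective lines (with the induced Zariski topology
  and the induced regular functions) to the projective line: locally \<open>f = [F : G]\<close> with
  \<open>F\<close>, \<open>G\<close> forms of the same multidegree without common zero.  The neighbourhood of \<open>x\<close> is taken to
  be the whole open set where \<open>F\<close>, \<open>G\<close> do not both vanish; this is no restriction, since \<open>F\<close> and \<open>G\<close>
  may be multiplied by a form that is nonzero at \<open>x\<close> and vanishes outside a smaller neighbourhood.
\<close>

definition regular_map :: "'i set \<Rightarrow> ('i \<Rightarrow> 'k::field pline) set \<Rightarrow> (('i \<Rightarrow> 'k pline) \<Rightarrow> 'k pline) \<Rightarrow> bool"
  where
  "regular_map I X f \<longleftrightarrow>
     (\<forall>x\<in>X. \<exists>d F G. multiform I d F \<and> multiform I d G \<and>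
        (F (hcoords \<circ> x) \<noteq> 0 \<or> G (hcoords \<circ> x) \<noteq> 0) \<and>
        (\<forall>y\<in>X. F (hcoords \<circ> y) \<noteq> 0 \<or> G (hcoords \<circ> y) \<noteq> 0 \<longrightarrow>
           f y = ratio (F (hcoords \<circ> y)) (G (hcoords \<circ> y))))"

definition morphism_between ::
    "'i set \<Rightarrow> ('i \<Rightarrow> 'k::field pline) set \<Rightarrow> 'j set \<Rightarrow> ('j \<Rightarrow> 'k pline) set \<Rightarrow>
     (('i \<Rightarrow> 'k pline) \<Rightarrow> 'j \<Rightarrow> 'k pline) \<Rightarrow> bool" where
  "morphism_between I X J Y \<phi> \<longleftrightarrow> \<phi> \<in> X \<rightarrow> Y \<and> (\<forall>j\<in>J. regular_map I X (\<lambda>x. \<phi> x j))"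

definition isomorphic_varieties ::
    "'i set \<Rightarrow> ('i \<Rightarrow> 'k::field pline) set \<Rightarrow> 'j set \<Rightarrow> ('j \<Rightarrow> 'k pline) set \<Rightarrow> bool" where
  "isomorphic_varieties I X J Y \<longleftrightarrow>
     (\<exists>\<phi> \<psi>. morphism_between I X J Y \<phi> \<and> morphism_between J Y I X \<psi> \<and>
        (\<forall>x\<in>X. \<psi> (\<phi> x) = x) \<and> (\<forall>y\<in>Y. \<phi> (\<psi> y) = y))"


section \<open>Affine varieties\<close>

inductive_set polynomial_funs :: "nat \<Rightarrow> ((nat \<Rightarrow> 'k::field) \<Rightarrow> 'k) set" for N where
  scalar: "(\<lambda>_. c) \<in> polynomial_funs N"
| coord: "i < N \<Longrightarrow> (\<lambda>v. v i) \<in> polynomial_funs N"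
| add: "p \<in> polynomial_funs N \<Longrightarrow> q \<in> polynomial_funs N \<Longrightarrow> (\<lambda>v. p v + q v) \<in> polynomial_funs N"
| mult: "p \<in> polynomial_funs N \<Longrightarrow> q \<in> polynomial_funs N \<Longrightarrow> (\<lambda>v. p v * q v) \<in> polynomial_funs N"

definition zariski_closed :: "nat \<Rightarrow> (nat \<Rightarrow> 'k::field) set \<Rightarrow> bool" where
  "zariski_closed N V \<longleftrightarrow>
     (\<exists>P \<subseteq> polynomial_funs N. V = {v \<in> {..<N} \<rightarrow>\<^sub>E UNIV. \<forall>p\<in>P. p v = 0})"

definition irreducible_closed :: "nat \<Rightarrow> (nat \<Rightarrow> 'k::field) set \<Rightarrow> bool" where
  "irreducible_closed N V \<longleftrightarrow> zariski_closed N V \<and> V \<noteq> {} \<and>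
     (\<forall>V1 V2. zariski_closed N V1 \<longrightarrow> zariski_closed N V2 \<longrightarrow> V = V1 \<union> V2 \<longrightarrow> V = V1 \<or> V = V2)"

text \<open>Affine \<open>N\<close>-space as the open subset of a product of \<open>N\<close> projective lines.\<close>

definition affine_embed :: "nat \<Rightarrow> (nat \<Rightarrow> 'k::field) \<Rightarrow> nat \<Rightarrow> 'k pline" where
  "affine_embed N v = (\<lambda>i\<in>{..<N}. Fin (v i))"

definition affine_variety :: "'i set \<Rightarrow> ('i \<Rightarrow> 'k::field pline) set \<Rightarrow> bool" where
  "affine_variety I X \<longleftrightarrow>
     (\<exists>N V. irreducible_closed N V \<and> isomorphic_varieties I X {..<N} (affine_embed N ` V))"


section \<open>Stable pointed curves of genus 0\<close>

text \<open>
  A nodal curve with rational components, given by its normalization: a point of the normalization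
  is a pair \<open>(v, p)\<close> of a component \<open>v\<close> and a point \<open>p\<close> of the projective line, and a node
  is the unordered pair of the two points that are glued together.
\<close>

record ('z, 'k) pointed_curve =
  comps :: "nat set"
  nodes :: "(nat \<times> 'k pline) set set"
  mark :: "'z \<Rightarrow> nat \<times> 'k pline"

text \<open>
  \<open>joined M\<close> is adjacency of components in the dual graph whose edges are the nodes in \<open>M\<close>
  (every node being a two-element set).
\<close>

definition joined :: "(nat \<times> 'k pline) set set \<Rightarrow> (nat \<times> nat) set" where
  "joined M = {(v, w). \<exists>p q. {(v, p), (w, q)} \<in> M}"

definition special_points :: "'z set \<Rightarrow> ('z, 'k) pointed_curve \<Rightarrow> (nat \<times> 'k pline) set" where
  "special_points Z C = mark C ` Z \<union> \<Union> (nodes C)"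

text \<open>
  Since all components are rational, a connected curve has arithmetic genus
  \<open>card (nodes C) - card (comps C) + 1\<close>.
\<close>

definition stable_curve :: "'z set \<Rightarrow> ('z, 'k) pointed_curve \<Rightarrow> bool" where
  "stable_curve Z C \<longleftrightarrow>
     finite (comps C) \<and> comps C \<noteq> {} \<and> finite (nodes C) \<and>
     (\<forall>e\<in>nodes C. card e = 2 \<and> fst ` e \<subseteq> comps C) \<and>
     pairwise disjnt (nodes C) \<and>
     (\<forall>v\<in>comps C. \<forall>w\<in>comps C. (v, w) \<in> (joined (nodes C))\<^sup>*) \<and>
     card (comps C) = card (nodes C) + 1 \<and>
     inj_on (mark C) Z \<and> (\<forall>z\<in>Z. fst (mark C z) \<in> comps C \<and> mark C z \<notin> \<Union> (nodes C)) \<and>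
     (\<forall>v\<in>comps C. finite {p. (v, p) \<in> special_points Z C} \<and>
        card {p. (v, p) \<in> special_points Z C} \<ge> 3)"

text \<open>
  The image of the marked point \<open>z\<close> under the contraction of \<open>C\<close> onto its component \<open>v\<close>: the marked
  point itself if it lies on \<open>v\<close>, and otherwise the node on \<open>v\<close> beyond which \<open>z\<close> lies.
\<close>

definition projection :: "('z, 'k) pointed_curve \<Rightarrow> nat \<Rightarrow> 'z \<Rightarrow> 'k pline" where
  "projection C v z = (THE p. mark C z = (v, p) \<or>
     (\<exists>e\<in>nodes C. \<exists>w q. e = {(v, p), (w, q)} \<and>
        (w, fst (mark C z)) \<in> (joined (nodes C - {e}))\<^sup>*))"


section \<open>The compactified moduli space of pointed curves of genus 0\<close>

text \<open>
  The cross-ratio \<open>(a - c)(b - d) / ((a - d)(b - c))\<close>, with values in the projective line; it is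
  well defined as soon as three of the four points are distinct.
\<close>

definition bracket :: "'k::field pline \<Rightarrow> 'k pline \<Rightarrow> 'k" where
  "bracket p q = fst (hcoords p) * snd (hcoords q) - snd (hcoords p) * fst (hcoords q)"

definition cross_ratio :: "'k::field pline \<Rightarrow> 'k pline \<Rightarrow> 'k pline \<Rightarrow> 'k pline \<Rightarrow> 'k pline" where
  "cross_ratio a b c d = ratio (bracket a c * bracket b d) (bracket a d * bracket b c)"

definition quads :: "'z set \<Rightarrow> ('z \<times> 'z \<times> 'z \<times> 'z) set" where
  "quads Z = {(a, b, c, d). {a, b, c, d} \<subseteq> Z \<and> distinct [a, b, c, d]}"

text \<open>
  For \<open>(a, b, c, d) \<in> quads Z\<close>, forgetting all other marked points and contracting the unstable
  components maps \<open>C\<close> to a stable four-pointed curve, i.e. to a point of the projective line.  It is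
  computed on any component on which at least three of the four points have distinct projections;
  if there are two such components, both give the same one of the values \<open>0, 1, \<infinity>\<close>.
\<close>

definition moduli_point ::
    "'z set \<Rightarrow> ('z, 'k::field) pointed_curve \<Rightarrow> ('z \<times> 'z \<times> 'z \<times> 'z) \<Rightarrow> 'k pline" where
  "moduli_point Z C = (\<lambda>(a, b, c, d)\<in>quads Z. THE r. \<exists>v\<in>comps C.
     card (projection C v ` {a, b, c, d}) \<ge> 3 \<and>
     r = cross_ratio (projection C v a) (projection C v b) (projection C v c) (projection C v d))"

text \<open>
  The moduli space of stable \<open>Z\<close>-pointed curves of genus 0.  Two stable curves are isomorphic if and
  only if their cross-ratios agree, and the product of the forgetful maps to the four-pointed moduli
  spaces is a closed immersion (Gerritzen, Herrlich and van der Put, Stable n-pointed trees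
  of projective lines); so the isomorphism class of \<open>C\<close> is represented by \<open>moduli_point Z C\<close>, and
  the structure of a variety is the one induced by the product of projective lines over \<open>quads Z\<close>.
\<close>

definition Mbar :: "'z set \<Rightarrow> ('z \<times> 'z \<times> 'z \<times> 'z \<Rightarrow> 'k::field pline) set" where
  "Mbar Z = moduli_point Z ` {C. stable_curve Z C}"

text \<open>
  \<open>separates Z C e A\<close>: the node \<open>e\<close> disconnects \<open>C\<close> into two parts, the marked points on one of which
  are those in \<open>A\<close>.
\<close>

definition separates ::
    "'z set \<Rightarrow> ('z, 'k) pointed_curve \<Rightarrow> (nat \<times> 'k pline) set \<Rightarrow> 'z set \<Rightarrow> bool" where
  "separates Z C e A \<longleftrightarrow> (\<exists>v p w q. e = {(v, p), (w, q)} \<and>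
     A = {z \<in> Z. (v, fst (mark C z)) \<in> (joined (nodes C - {e}))\<^sup>*})"

definition indexes_divisor :: "'z set \<Rightarrow> 'z set \<Rightarrow> bool" where
  "indexes_divisor Z A \<longleftrightarrow> A \<subseteq> Z \<and> 2 \<le> card A \<and> card A + 2 \<le> card Z"

definition divisor :: "'z set \<Rightarrow> 'z set \<Rightarrow> ('z \<times> 'z \<times> 'z \<times> 'z \<Rightarrow> 'k::field pline) set" where
  "divisor Z A = moduli_point Z ` {C. stable_curve Z C \<and> (\<exists>e\<in>nodes C. separates Z C e A)}"

definition boundary_divisors :: "'z set \<Rightarrow> ('z \<times> 'z \<times> 'z \<times> 'z \<Rightarrow> 'k::field pline) set set" where
  "boundary_divisors Z = divisor Z ` {A. indexes_divisor Z A}"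

definition partial_compactification ::
    "'z set \<Rightarrow> ('z \<times> 'z \<times> 'z \<times> 'z \<Rightarrow> 'k::field pline) set set \<Rightarrow>
     ('z \<times> 'z \<times> 'z \<times> 'z \<Rightarrow> 'k pline) set" where
  "partial_compactification Z \<gamma> = Mbar Z - \<Union> (boundary_divisors Z - \<gamma>)"

end

theory Submission
  imports Defs
begin

text \<open>
  The proof is about the cross-ratios that have no pole on the partial compactification, called
  bounded here.  The cross-ratio of \<open>(a, b, c, d)\<close> has its pole along the boundary divisors that
  separate \<open>{a, d}\<close> from \<open>{b, c}\<close>.  The sets \<open>A\<close>, \<open>B\<close>, \<open>A \<union> B\<close> together induce at most two of the three
  splittings of four points into pairs (\<open>not_all_quartets_displayed\<close>), so at least one cross-ratio
  of any four points is bounded, and it determines the others by fractional linear functions.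
  Conversely, every other boundary divisor induces a splitting \<open>ab|cd\<close> that none of the given sets
  induces (\<open>undisplayed_quartet_exists\<close>); the bounded cross-ratio with its pole along that splitting
  keeps the divisor away.  So the partial compactification is the locus in the moduli space where
  the bounded cross-ratios are finite (\<open>partial_compactification_eq\<close>), and they embed it into affine
  space.

  That the image is closed and irreducible rests on a description of the moduli space by equations:
  it consists of all families of points of the projective line, indexed by quadruples, that have
  the symmetries and the multiplicativity of cross-ratios (\<open>cr_system\<close>, \<open>Mbar_eq\<close>).  The moduli point of
  a curve satisfies them because its dual graph is a tree (\<open>moduli_point_cr_system\<close>).  For the converse,
  a solution without the values \<open>0, 1, \<infinity>\<close> comes from distinct points of a line
  (\<open>nondegenerate_system_is_config\<close>).  In any other solution, some value 1 at \<open>(a, b, c, d)\<close> extends to a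
  splitting of all marked points (\<open>quartet_extends_to_split\<close>); the solution is determined by its
  restrictions to the two sides, each completed by one point of the other side (\<open>graft_of_split\<close>), and
  the curves that realise these are glued.  Along the way each boundary divisor is identified with
  the solutions that split accordingly (\<open>divisor_eq\<close>).

  The same induction shows that configurations of distinct points are dense among all solutions
  (\<open>cr_system_in_closure\<close>): a curve with a node is the limit of the configurations in which the points
  on one side of the node are contracted towards a point of the other side
  (\<open>graft_of_configs_in_closure\<close>).  Therefore the image is the closure of the image of the
  configurations: conversely, a point of that closure satisfies all equations of the moduli space,
  since these hold for configurations (\<open>unchart_closure\<close>).  It is irreducible because two
  configurations are joined by a line of configurations (\<open>open_part_irreducible\<close>).
\<close>

type_synonym 'z quad = "'z \<times> 'z \<times> 'z \<times> 'z"

section \<open>Forms in homogeneous coordinates\<close>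

lemma alg_closed_infinite: "infinite (UNIV :: 'k::alg_closed_field set)"
proof
  assume fin: "finite (UNIV :: 'k set)"
  define p :: "'k poly" where "p = (\<Prod>a\<in>UNIV. [:-a, 1:])"
  have "degree p = card (UNIV :: 'k set)"
    unfolding p_def by (subst degree_prod_eq_sum_degree) auto
  then have "degree (p + 1) > 0"
    using fin by (simp add: degree_add_eq_left card_gt_0_iff)
  then obtain z where "poly (p + 1) z = 0"
    using alg_closed_imp_poly_has_root by blast
  moreover have "poly p z = 0"
    using fin by (auto simp: p_def poly_prod intro!: prod_zero)
  ultimately show False
    by simp
qed

lemma hcoords_nonzero: "fst (hcoords p) \<noteq> 0 \<or> snd (hcoords p) \<noteq> 0"
  by (cases p) auto

lemma ratio_hcoords [simp]: "ratio (fst (hcoords p)) (snd (hcoords p)) = p"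
  by (cases p) (auto simp: ratio_def)

lemma hcoords_ratio:
  assumes "s \<noteq> 0 \<or> t \<noteq> 0"
  obtains c where "c \<noteq> 0" "hcoords (ratio s t) = (c * s, c * t)"
proof (cases "t = 0")
  case True
  then show ?thesis using that[of "1 / s"] assms by (auto simp: ratio_def)
next
  case False
  then show ?thesis using that[of "1 / t"] by (auto simp: ratio_def)
qed

lemma ratio_eq_iff:
  assumes "s \<noteq> 0 \<or> t \<noteq> 0" "s' \<noteq> 0 \<or> t' \<noteq> 0"
  shows "ratio s t = ratio s' t' \<longleftrightarrow> s * t' = t * s'"
  using assms by (auto simp: ratio_def field_simps)

lemma ratio_scale: "c \<noteq> 0 \<Longrightarrow> ratio (c * s) (c * t) = ratio s t"
  by (auto simp: ratio_def)

lemma multiform_cong_on: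
  assumes "multiform I d F" "\<And>i. i \<in> I \<Longrightarrow> h i = h' i"
  shows "F h = F h'"
  using assms by (induction) auto

lemma multiform_deg_cong: "multiform I d F \<Longrightarrow> d = e \<Longrightarrow> multiform I e F"
  by simp

lemma multiform_scale:
  assumes "multiform I d F" "finite I"
  shows "F (\<lambda>i. (c i * fst (h i), c i * snd (h i))) = (\<Prod>i\<in>I. c i ^ d i) * F h"
  using assms
proof (induction)
  case (coord1 i)
  then have "(\<Prod>j\<in>I. c j ^ ((\<lambda>_. 0)(i := 1)) j) = (\<Prod>j\<in>I. if i = j then c j else 1)"
    by (intro prod.cong) auto
  then show ?case using coord1 by simp
next
  case (coord2 i)
  then have "(\<Prod>j\<in>I. c j ^ ((\<lambda>_. 0)(i := 1)) j) = (\<Prod>j\<in>I. if i = j then c j else 1)"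
    by (intro prod.cong) auto
  then show ?case using coord2 by simp
qed (auto simp: algebra_simps power_add prod.distrib)

lemma multiform_zero_scale:
  assumes "multiform I d F" "finite I"
    and "\<And>i. i \<in> I \<Longrightarrow> c i \<noteq> 0" "\<And>i. i \<in> I \<Longrightarrow> g i = (c i * fst (h i), c i * snd (h i))"
  shows "F g = 0 \<longleftrightarrow> F h = 0"
proof -
  have "F g = F (\<lambda>i. (c i * fst (h i), c i * snd (h i)))"
    using multiform_cong_on[OF assms(1)] assms(4) by fastforce
  also have "\<dots> = (\<Prod>i\<in>I. c i ^ d i) * F h"
    by (rule multiform_scale[OF assms(1,2)])
  finally show ?thesis using assms(2,3) by auto
qed

text \<open>
  Normalized coordinates are inconvenient in families of points.  By homogeneity, the vanishing of
  a form can be tested on any representatives.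
\<close>

lemma multiform_zero_ratio:
  assumes "multiform I d F" "finite I"
    and "\<And>i. i \<in> I \<Longrightarrow> fst (H i) \<noteq> 0 \<or> snd (H i) \<noteq> 0"
    and "\<And>i. i \<in> I \<Longrightarrow> x i = ratio (fst (H i)) (snd (H i))"
  shows "F (hcoords \<circ> x) = 0 \<longleftrightarrow> F H = 0"
proof -
  have "\<exists>c. c \<noteq> 0 \<and> hcoords (x i) = (c * fst (H i), c * snd (H i))" if "i \<in> I" for i
    using assms(3,4)[OF that] hcoords_ratio by metis
  then obtain c where "\<And>i. i \<in> I \<Longrightarrow> c i \<noteq> 0"
      "\<And>i. i \<in> I \<Longrightarrow> hcoords (x i) = (c i * fst (H i), c i * snd (H i))"
    by metis
  then show ?thesis
    by (intro multiform_zero_scale[OF assms(1,2)]) auto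
qed

lemma multiform_compose:
  assumes "multiform I d F" "finite I"
    and "\<And>i. i \<in> I \<Longrightarrow> multiform J (e i) (\<lambda>h. fst (\<tau> i h))"
    and "\<And>i. i \<in> I \<Longrightarrow> multiform J (e i) (\<lambda>h. snd (\<tau> i h))"
  shows "multiform J (\<lambda>j. \<Sum>i\<in>I. d i * e i j) (\<lambda>h. F (\<lambda>i. \<tau> i h))"
  using assms
proof (induction)
  case (scalar c)
  then show ?case by (simp add: multiform.scalar)
next
  case (coord1 i)
  have "(\<Sum>j\<in>I. ((\<lambda>_. 0)(i := 1)) j * e j l) = (\<Sum>j\<in>I. if i = j then e j l else 0)" for l
    by (intro sum.cong) auto
  then show ?case using coord1 by simp
next
  case (coord2 i)
  have "(\<Sum>j\<in>I. ((\<lambda>_. 0)(i := 1)) j * e j l) = (\<Sum>j\<in>I. if i = j then e j l else 0)" for l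
    by (intro sum.cong) auto
  then show ?case using coord2 by simp
next
  case (add d F G)
  then show ?case by (auto intro: multiform.add)
next
  case (mult d F e' G)
  then have "multiform J (\<lambda>j. (\<Sum>i\<in>I. d i * e i j) + (\<Sum>i\<in>I. e' i * e i j))
      (\<lambda>h. F (\<lambda>i. \<tau> i h) * G (\<lambda>i. \<tau> i h))"
    by (auto intro: multiform.mult)
  then show ?case by (simp add: sum.distrib algebra_simps)
qed

lemma multiform_compose_polynomial_funs:
  assumes "multiform I d F"
    and "\<And>i. i \<in> I \<Longrightarrow> (\<lambda>v. fst (\<tau> i v)) \<in> polynomial_funs N"
    and "\<And>i. i \<in> I \<Longrightarrow> (\<lambda>v. snd (\<tau> i v)) \<in> polynomial_funs N"
  shows "(\<lambda>v. F (\<lambda>i. \<tau> i v)) \<in> polynomial_funs N"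
  using assms by (induction) (auto intro: polynomial_funs.intros)

lemma multiform_compose_poly:
  assumes "multiform I d F"
  obtains P where "\<And>t. F (\<lambda>i. (poly (\<sigma> i) t, poly (\<rho> i) t)) = poly P t"
  using assms
proof (induction arbitrary: thesis)
  case (scalar c)
  show ?case using scalar[of "[:c:]"] by simp
next
  case (add d F G)
  obtain P where "\<And>t. F (\<lambda>i. (poly (\<sigma> i) t, poly (\<rho> i) t)) = poly P t"
    using add.IH(1) by blast
  moreover obtain Q where "\<And>t. G (\<lambda>i. (poly (\<sigma> i) t, poly (\<rho> i) t)) = poly Q t"
    using add.IH(2) by blast
  ultimately show ?case using add.prems[of "P + Q"] by simp
next
  case (mult d F e G)
  obtain P where "\<And>t. F (\<lambda>i. (poly (\<sigma> i) t, poly (\<rho> i) t)) = poly P t"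
    using mult.IH(1) by blast
  moreover obtain Q where "\<And>t. G (\<lambda>i. (poly (\<sigma> i) t, poly (\<rho> i) t)) = poly Q t"
    using mult.IH(2) by blast
  ultimately show ?case using mult.prems[of "P * Q"] by simp
qed simp_all

lemma multiform_prod_snd:
  fixes I :: "'i set"
  assumes "finite J" "J \<subseteq> I"
  shows "multiform I (\<lambda>i. if i \<in> J then e i else 0) (\<lambda>h :: 'i \<Rightarrow> 'k::field \<times> 'k. \<Prod>j\<in>J. snd (h j) ^ e j)"
  using assms
proof (induction)
  case empty
  then show ?case using multiform.scalar[of I 1] by simp
next
  case (insert j J)
  then have jI: "j \<in> I" by simp
  have pow: "multiform I (\<lambda>i. if i = j then n else 0) (\<lambda>h :: 'i \<Rightarrow> 'k \<times> 'k. snd (h j) ^ n)" for n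
  proof (induction n)
    case 0
    then show ?case using multiform.scalar[of I 1] by (simp cong: if_cong)
  next
    case (Suc n)
    have "multiform I (\<lambda>i. if i = j then Suc n else 0) (\<lambda>h :: 'i \<Rightarrow> 'k \<times> 'k. snd (h j) * snd (h j) ^ n)"
      by (rule multiform_deg_cong[OF multiform.mult[OF multiform.coord2[OF jI] Suc.IH]])
        (auto simp: fun_eq_iff)
    then show ?case by simp
  qed
  have prev: "multiform I (\<lambda>i. if i \<in> J then e i else 0) (\<lambda>h :: 'i \<Rightarrow> 'k \<times> 'k. \<Prod>j\<in>J. snd (h j) ^ e j)"
    using insert by blast
  have "multiform I (\<lambda>i. if i \<in> insert j J then e i else 0)
      (\<lambda>h :: 'i \<Rightarrow> 'k \<times> 'k. snd (h j) ^ e j * (\<Prod>j\<in>J. snd (h j) ^ e j))"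
    by (rule multiform_deg_cong[OF multiform.mult[OF pow prev]]) (use insert.hyps in \<open>auto simp: fun_eq_iff\<close>)
  then show ?case using insert.hyps by simp
qed

text \<open>
  This is what allows Zariski closures in affine space to be compared with closures in a product
  of projective lines.
\<close>

lemma homogenization:
  fixes p :: "(nat \<Rightarrow> 'k::field) \<Rightarrow> 'k"
  assumes "p \<in> polynomial_funs N" "\<And>j. j < N \<Longrightarrow> q j \<in> I"
  obtains d F where "multiform I d F"
    "\<And>h. (\<And>j. j < N \<Longrightarrow> snd (h (q j)) = 1) \<Longrightarrow> F h = p (\<lambda>j. fst (h (q j)))"
proof -
  define J where "J = q ` {..<N}"
  have J: "finite J" "J \<subseteq> I" using assms(2) by (auto simp: J_def)
  define homog where "homog m p F \<longleftrightarrow> multiform I (\<lambda>i. if i \<in> J then m else 0) F \<and>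
    (\<forall>h. (\<forall>j\<in>J. snd (h j) = 1) \<longrightarrow> F h = p (\<lambda>j. fst (h (q j))))"
    for m F and p :: "(nat \<Rightarrow> 'k) \<Rightarrow> 'k"
  \<comment> \<open>The two summands of a sum need a common degree, hence the claim for all large degrees.\<close>
  have "\<exists>n. \<forall>m\<ge>n. \<exists>F. homog m p F"
    using assms(1)
  proof (induction)
    case (scalar c)
    have "homog m (\<lambda>_. c) (\<lambda>h. c * (\<Prod>j\<in>J. snd (h j) ^ m))" for m
      using multiform.mult[OF multiform.scalar[of I c] multiform_prod_snd[OF J, of "\<lambda>_. m"]]
      by (simp add: homog_def)
    then show ?case by blast
  next
    case (coord i)
    then have i: "q i \<in> J" "q i \<in> I" using assms(2) by (auto simp: J_def)
    have "\<exists>F. homog m (\<lambda>v. v i) F" if m: "m \<ge> 1" for m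
    proof -
      let ?e = "\<lambda>j. if j = q i then m - 1 else m"
      have "multiform I (\<lambda>i. if i \<in> J then m else 0) (\<lambda>h. fst (h (q i)) * (\<Prod>j\<in>J. snd (h j) ^ ?e j))"
        by (rule multiform_deg_cong[OF multiform.mult[OF multiform.coord1[OF i(2)] multiform_prod_snd[OF J]]])
          (use m i in \<open>auto simp: fun_eq_iff\<close>)
      then show ?thesis
        by (intro exI[of _ "\<lambda>h. fst (h (q i)) * (\<Prod>j\<in>J. snd (h j) ^ ?e j)"]) (simp add: homog_def)
    qed
    then show ?case by blast
  next
    case (add p p')
    then obtain n n' where n: "\<forall>m\<ge>n. \<exists>F. homog m p F" and n': "\<forall>m\<ge>n'. \<exists>F. homog m p' F"
      by blast
    show ?case
    proof (intro exI[of _ "max n n'"] allI impI)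
      fix m assume "max n n' \<le> m"
      then have m: "n \<le> m" "n' \<le> m" by auto
      obtain F where F: "homog m p F" using n m(1) by blast
      obtain F' where F': "homog m p' F'" using n' m(2) by blast
      show "\<exists>F. homog m (\<lambda>v. p v + p' v) F"
        using F F' by (intro exI[of _ "\<lambda>h. F h + F' h"]) (simp add: homog_def multiform.add)
    qed
  next
    case (mult p p')
    then obtain n n' where n: "\<forall>m\<ge>n. \<exists>F. homog m p F" and n': "\<forall>m\<ge>n'. \<exists>F. homog m p' F"
      by blast
    show ?case
    proof (intro exI[of _ "n + n'"] allI impI)
      fix m assume m: "n + n' \<le> m"
      obtain F where F: "homog n p F" using n by blast
      have "n' \<le> m - n" using m by simp
      then obtain F' where F': "homog (m - n) p' F'" using n' by blast
      have "multiform I (\<lambda>i. if i \<in> J then m else 0) (\<lambda>h. F h * F' h)"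
        by (rule multiform_deg_cong[OF multiform.mult])
          (use F F' m in \<open>auto simp: homog_def fun_eq_iff\<close>)
      then show "\<exists>F. homog m (\<lambda>v. p v * p' v) F"
        using F F' by (intro exI[of _ "\<lambda>h. F h * F' h"]) (simp add: homog_def)
    qed
  qed
  then obtain n F where "homog n p F" by blast
  then show ?thesis by (intro that[of _ F]) (auto simp: homog_def J_def)
qed

section \<open>Systems of cross-ratios\<close>

text \<open>
  Points of the projective line are represented by vectors in the plane: the determinants of
  vectors that move along polynomial curves are again polynomials.
\<close>

definition det2 :: "'k::field \<times> 'k \<Rightarrow> 'k \<times> 'k \<Rightarrow> 'k" where
  "det2 u v = fst u * snd v - snd u * fst v"

definition vcr :: "'k::field \<times> 'k \<Rightarrow> 'k \<times> 'k \<Rightarrow> 'k \<times> 'k \<Rightarrow> 'k \<times> 'k \<Rightarrow> 'k pline" where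
  "vcr u1 u2 u3 u4 = ratio (det2 u1 u3 * det2 u2 u4) (det2 u1 u4 * det2 u2 u3)"

lemma vcr_reverse: "vcr u2 u1 u4 u3 = vcr u1 u2 u3 u4"
  by (simp add: vcr_def mult.commute)

lemma vcr_sym: "vcr u3 u4 u1 u2 = vcr u1 u2 u3 u4"
proof -
  have "det2 u3 u1 * det2 u4 u2 = det2 u1 u3 * det2 u2 u4"
    "det2 u3 u2 * det2 u4 u1 = det2 u1 u4 * det2 u2 u3"
    by (simp_all add: det2_def algebra_simps)
  then show ?thesis by (simp add: vcr_def)
qed

lemma cross_ratio_vcr:
  "cross_ratio a b c d = vcr (hcoords a) (hcoords b) (hcoords c) (hcoords d)"
  by (simp add: cross_ratio_def vcr_def bracket_def det2_def)

lemma quads_iff: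
  "(a, b, c, d) \<in> quads Z \<longleftrightarrow> a \<in> Z \<and> b \<in> Z \<and> c \<in> Z \<and> d \<in> Z \<and>
     a \<noteq> b \<and> a \<noteq> c \<and> a \<noteq> d \<and> b \<noteq> c \<and> b \<noteq> d \<and> c \<noteq> d"
  by (auto simp: quads_def)

lemma finite_quads: "finite Z \<Longrightarrow> finite (quads Z)"
  by (rule finite_subset[of _ "Z \<times> Z \<times> Z \<times> Z"]) (auto simp: quads_def)

lemma quads_mono: "W \<subseteq> Z \<Longrightarrow> quads W \<subseteq> quads Z"
  by (auto simp: quads_def)

abbreviation numer :: "('i \<Rightarrow> 'k::field pline) \<Rightarrow> 'i \<Rightarrow> 'k" where
  "numer x q \<equiv> fst (hcoords (x q))"

abbreviation denom :: "('i \<Rightarrow> 'k::field pline) \<Rightarrow> 'i \<Rightarrow> 'k" where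
  "denom x q \<equiv> snd (hcoords (x q))"

text \<open>
  If \<open>p\<close> is the cross-ratio of \<open>(a, b, c, d)\<close>, the equations say that \<open>i = 1 / p\<close> and \<open>c = 1 - p\<close>, which
  are the cross-ratios after exchanging \<open>c\<close> with \<open>d\<close>, and \<open>b\<close> with \<open>c\<close>.
\<close>

definition s4_related :: "'k::field pline \<Rightarrow> 'k pline \<Rightarrow> 'k pline \<Rightarrow> bool" where
  "s4_related p i c \<longleftrightarrow>
     fst (hcoords p) * fst (hcoords i) = snd (hcoords p) * snd (hcoords i) \<and>
     snd (hcoords p) * fst (hcoords c) = snd (hcoords c) * (snd (hcoords p) - fst (hcoords p))"

text \<open>
  This is \<open>p1 * p2 = p3\<close> without denominators; nothing is demanded when the product is of the form
  \<open>0 * \<infinity>\<close>.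
\<close>

definition product_related :: "'k::field pline \<Rightarrow> 'k pline \<Rightarrow> 'k pline \<Rightarrow> bool" where
  "product_related p1 p2 p3 \<longleftrightarrow>
     fst (hcoords p1) * fst (hcoords p2) * snd (hcoords p3) =
     snd (hcoords p1) * snd (hcoords p2) * fst (hcoords p3)"

text \<open>
  The equations that cut the moduli space out of the product of projective lines.
\<close>

definition cr_system :: "'z set \<Rightarrow> ('z quad \<Rightarrow> 'k::field pline) \<Rightarrow> bool" where
  "cr_system Z x \<longleftrightarrow> x \<in> quads Z \<rightarrow>\<^sub>E UNIV \<and>
     (\<forall>a b c d. (a, b, c, d) \<in> quads Z \<longrightarrow> x (c, d, a, b) = x (a, b, c, d) \<and>
        s4_related (x (a, b, c, d)) (x (a, b, d, c)) (x (a, c, b, d))) \<and>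
     (\<forall>a b c d e. {a, b, c, d, e} \<subseteq> Z \<longrightarrow> distinct [a, b, c, d, e] \<longrightarrow>
        product_related (x (a, b, c, d)) (x (a, b, d, e)) (x (a, b, c, e)))"

text \<open>
  The values that the moduli point of a curve takes when a node separates the marked points in \<open>E\<close>
  from the others.
\<close>

definition splits :: "'z set \<Rightarrow> ('z quad \<Rightarrow> 'k::field pline) \<Rightarrow> 'z set \<Rightarrow> bool" where
  "splits Z x E \<longleftrightarrow>
     (\<forall>a\<in>E. \<forall>b\<in>E. \<forall>c\<in>Z - E. \<forall>d\<in>Z - E. a \<noteq> b \<longrightarrow> c \<noteq> d \<longrightarrow> x (a, b, c, d) = Fin 1)"

definition config :: "'z set \<Rightarrow> ('z \<Rightarrow> 'k::field \<times> 'k) \<Rightarrow> bool" where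
  "config Z u \<longleftrightarrow> (\<forall>i\<in>Z. \<forall>j\<in>Z. i \<noteq> j \<longrightarrow> det2 (u i) (u j) \<noteq> 0)"

definition cr_of :: "'z set \<Rightarrow> ('z \<Rightarrow> 'k::field \<times> 'k) \<Rightarrow> 'z quad \<Rightarrow> 'k pline" where
  "cr_of Z u = (\<lambda>(a, b, c, d)\<in>quads Z. vcr (u a) (u b) (u c) (u d))"

lemma numer_zero_iff: "fst (hcoords p) = 0 \<longleftrightarrow> p = Fin 0"
  by (cases p) auto

lemma hcoords_eqI:
  "fst (hcoords p) * snd (hcoords q) = snd (hcoords p) * fst (hcoords q) \<Longrightarrow> p = q"
  by (cases p; cases q) auto

context
  fixes Z :: "'z set" and x :: "'z quad \<Rightarrow> 'k::field pline"
  assumes sys: "cr_system Z x"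
begin

lemma cr_sym:
  assumes "(a, b, c, d) \<in> quads Z"
  shows "x (c, d, a, b) = x (a, b, c, d)"
  using sys assms by (simp add: cr_system_def)

lemma cr_inverse:
  assumes "(a, b, c, d) \<in> quads Z"
  shows "numer x (a, b, c, d) * numer x (a, b, d, c) = denom x (a, b, c, d) * denom x (a, b, d, c)"
  using sys assms by (simp add: cr_system_def s4_related_def)

lemma cr_complement:
  assumes "(a, b, c, d) \<in> quads Z"
  shows "denom x (a, b, c, d) * numer x (a, c, b, d) =
    denom x (a, c, b, d) * (denom x (a, b, c, d) - numer x (a, b, c, d))"
  using sys assms by (simp add: cr_system_def s4_related_def)

lemma cr_mult:
  assumes "{a, b, c, d, e} \<subseteq> Z" "distinct [a, b, c, d, e]"
  shows "numer x (a, b, c, d) * numer x (a, b, d, e) * denom x (a, b, c, e) =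
    denom x (a, b, c, d) * denom x (a, b, d, e) * numer x (a, b, c, e)"
  using sys assms unfolding cr_system_def product_related_def by blast

lemma cr_inverse_value:
  assumes "(a, b, c, d) \<in> quads Z" "x (a, b, c, d) = Fin r" "r \<noteq> 0"
  shows "x (a, b, d, c) = Fin (1 / r)"
  using cr_inverse[OF assms(1)] assms(2,3)
  by (cases "x (a, b, d, c)") (auto simp: field_simps)

lemma cr_complement_value:
  assumes "(a, b, c, d) \<in> quads Z" "x (a, b, c, d) = Fin r"
  shows "x (a, c, b, d) = Fin (1 - r)"
  using cr_complement[OF assms(1)] assms(2)
  by (cases "x (a, c, b, d)") (auto simp: field_simps)

lemma cr_mult_value:
  assumes "{a, b, c, d, e} \<subseteq> Z" "distinct [a, b, c, d, e]"
    and "x (a, b, c, d) = Fin r" "x (a, b, d, e) = Fin s"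
  shows "x (a, b, c, e) = Fin (r * s)"
  using cr_mult[OF assms(1,2)] assms(3,4)
  by (cases "x (a, b, c, e)") auto

lemma cr_zero_iff_one:
  assumes "(a, b, c, d) \<in> quads Z"
  shows "x (a, c, b, d) = Fin 0 \<longleftrightarrow> x (a, b, c, d) = Fin 1"
proof -
  have "(a, c, b, d) \<in> quads Z" using assms by (auto simp: quads_iff)
  then show ?thesis
    using cr_complement_value[OF assms, of 1] cr_complement_value[of a c b d 0] by auto
qed

lemma cr_infty_iff_zero:
  assumes "(a, b, c, d) \<in> quads Z"
  shows "x (a, b, c, d) = Infty \<longleftrightarrow> x (a, b, d, c) = Fin 0"
  using cr_inverse[OF assms] hcoords_nonzero[of "x (a, b, d, c)"]
  by (cases "x (a, b, c, d)"; cases "x (a, b, d, c)") auto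

lemma cr_infty_iff_one:
  assumes "(a, b, c, d) \<in> quads Z"
  shows "x (a, b, c, d) = Infty \<longleftrightarrow> x (a, d, b, c) = Fin 1"
  using cr_infty_iff_zero[OF assms] cr_zero_iff_one[of a d b c] assms by (auto simp: quads_iff)

lemma cr_one_swap:
  assumes "(a, b, c, d) \<in> quads Z" "x (a, b, c, d) = Fin 1"
  shows "x (a, b, d, c) = Fin 1" "x (b, a, c, d) = Fin 1" "x (c, d, a, b) = Fin 1"
proof -
  show 1: "x (a, b, d, c) = Fin 1" "x (c, d, a, b) = Fin 1"
    using cr_inverse_value[OF assms] cr_sym[OF assms(1)] assms(2) by auto
  have "(c, d, a, b) \<in> quads Z" "(c, d, b, a) \<in> quads Z" using assms by (auto simp: quads_iff)
  then show "x (b, a, c, d) = Fin 1"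
    using cr_inverse_value[of c d a b 1] 1 cr_sym[of c d b a] by auto
qed

lemma cr_reverse:
  assumes "(a, b, c, d) \<in> quads Z"
  shows "x (b, a, d, c) = x (a, b, c, d)"
proof -
  have inv: "numer x (b, a, d, c) * numer x (d, c, a, b) = denom x (b, a, d, c) * denom x (d, c, a, b)"
    using cr_inverse[of d c b a] cr_sym[of d c b a] assms by (auto simp: quads_iff)
  have "numer x (a, b, c, d) * numer x (a, b, d, c) = denom x (a, b, c, d) * denom x (a, b, d, c)"
    by (rule cr_inverse[OF assms])
  moreover have "x (d, c, a, b) = x (a, b, d, c)"
    using cr_sym[of a b d c] assms by (auto simp: quads_iff)
  ultimately show ?thesis using inv
    by (cases "x (b, a, d, c)"; cases "x (a, b, c, d)"; cases "x (a, b, d, c)")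
      (auto, metis mult_cancel_right mult_zero_right zero_neq_one)
qed

lemma cr_one_trans:
  assumes "{a, b, c, d, e} \<subseteq> Z" "distinct [a, b, c, d, e]"
    and "x (a, b, c, d) = Fin 1" "x (a, b, d, e) = Fin 1"
  shows "x (a, b, c, e) = Fin 1"
  using cr_mult_value[OF assms] by simp

text \<open>
  Read \<open>x (a, b, c, d) = 1\<close> as \<open>ab|cd\<close>.  The rule says that a fifth point \<open>e\<close> lies on the side of \<open>a, b\<close> or on
  that of \<open>c, d\<close>.  It follows from multiplicativity at \<open>(a, c, b, d)\<close>, where the quartet \<open>ab|cd\<close> is the
  value 0.
\<close>

lemma cr_quartet_fifth:
  assumes "{a, b, c, d, e} \<subseteq> Z" "distinct [a, b, c, d, e]"
    and "x (a, b, c, d) = Fin 1" "x (a, e, c, d) \<noteq> Fin 1"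
  shows "x (a, b, c, e) = Fin 1"
proof -
  have "x (a, c, b, d) = Fin 0"
    using cr_zero_iff_one[of a b c d] assms by (auto simp: quads_iff)
  moreover have "numer x (a, c, e, d) \<noteq> 0"
    using cr_zero_iff_one[of a e c d] assms by (auto simp: quads_iff numer_zero_iff)
  moreover have "numer x (a, c, b, e) * numer x (a, c, e, d) * denom x (a, c, b, d) =
      denom x (a, c, b, e) * denom x (a, c, e, d) * numer x (a, c, b, d)"
    using assms by (intro cr_mult) auto
  ultimately have "numer x (a, c, b, e) = 0" by auto
  then show ?thesis
    using cr_zero_iff_one[of a b c e] assms by (auto simp: quads_iff numer_zero_iff)
qed

text \<open>
  The side of \<open>a\<close> consists of the points that are not distinguished from \<open>a\<close> by \<open>c\<close> and \<open>d\<close>.  All other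
  quartets of the split follow by transitivity and the rule for a fifth point.
\<close>

lemma quartet_extends_to_split:
  assumes "(a, b, c, d) \<in> quads Z" "x (a, b, c, d) = Fin 1"
  obtains E where "E \<subseteq> Z" "a \<in> E" "b \<in> E" "c \<notin> E" "d \<notin> E" "splits Z x E"
proof -
  define E where "E = {z \<in> Z. z = a \<or> (z \<noteq> c \<and> z \<noteq> d \<and> x (a, z, c, d) = Fin 1)}"
  have q: "a \<in> Z" "b \<in> Z" "c \<in> Z" "d \<in> Z" "distinct [a, b, c, d]"
    using assms(1) by (auto simp: quads_iff)
  have pair: "x (a1, a2, c, d) = Fin 1" if "a1 \<in> E" "a2 \<in> E" "a1 \<noteq> a2" for a1 a2
  proof -
    consider "a1 = a" | "a2 = a" | "a1 \<noteq> a" "a2 \<noteq> a" by blast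
    then show ?thesis
    proof cases
      case 2
      then show ?thesis using that q cr_one_swap(2)[of a a1 c d] by (auto simp: E_def quads_iff)
    next
      case 3
      have "x (c, d, a1, a) = Fin 1" "x (c, d, a, a2) = Fin 1"
        using that 3 q cr_one_swap(2,3)[of a a1 c d] cr_one_swap(3)[of a a2 c d]
          cr_one_swap(3)[of a1 a c d]
        by (auto simp: E_def quads_iff)
      then have "x (c, d, a1, a2) = Fin 1"
        using that 3 q by (intro cr_one_trans[of c d a1 a a2]) (auto simp: E_def)
      then show ?thesis
        using that 3 q cr_one_swap(3)[of c d a1 a2] by (auto simp: E_def quads_iff)
    qed (use that in \<open>auto simp: E_def\<close>)
  qed
  have via_c: "x (a1, a2, c, c1) = Fin 1"
    if a: "a1 \<in> E" "a2 \<in> E" "a1 \<noteq> a2" and c1: "c1 \<in> Z - E" "c1 \<noteq> c" for a1 a2 c1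
  proof (cases "c1 = d")
    case True
    then show ?thesis using pair[OF a] by simp
  next
    case False
    have a1: "x (a1, c1, c, d) \<noteq> Fin 1"
    proof (cases "a1 = a")
      case True
      then show ?thesis using c1 False by (auto simp: E_def)
    next
      case aa: False
      show ?thesis
      proof
        assume "x (a1, c1, c, d) = Fin 1"
        then have "x (c, d, a1, c1) = Fin 1"
          using a aa c1 False q cr_one_swap(3)[of a1 c1 c d] by (auto simp: E_def quads_iff)
        moreover have "x (c, d, a, a1) = Fin 1"
          using a aa q cr_one_swap(3)[of a a1 c d] by (auto simp: E_def quads_iff)
        ultimately have "x (c, d, a, c1) = Fin 1"
          using a aa c1 False q by (intro cr_one_trans[of c d a a1 c1]) (auto simp: E_def)
        then have "x (a, c1, c, d) = Fin 1"
          using c1 False q cr_one_swap(3)[of c d a c1] by (auto simp: E_def quads_iff)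
        then show False using c1 False by (auto simp: E_def)
      qed
    qed
    show ?thesis
      using a c1 False q a1 pair[OF a]
      by (intro cr_quartet_fifth[of a1 a2 c d c1]) (auto simp: E_def)
  qed
  have "splits Z x E"
    unfolding splits_def
  proof (intro ballI impI)
    fix a1 a2 c1 c2
    assume a: "a1 \<in> E" "a2 \<in> E" "a1 \<noteq> a2" and c: "c1 \<in> Z - E" "c2 \<in> Z - E" "c1 \<noteq> c2"
    consider "c1 = c" | "c2 = c" | "c1 \<noteq> c" "c2 \<noteq> c" by blast
    then show "x (a1, a2, c1, c2) = Fin 1"
    proof cases
      case 1
      then show ?thesis using via_c[OF a] c by auto
    next
      case 2
      then show ?thesis using via_c[OF a, of c1] c a q cr_one_swap(1)[of a1 a2 c c1]
        by (auto simp: E_def quads_iff)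
    next
      case 3
      have "x (a1, a2, c1, c) = Fin 1"
        using via_c[OF a, of c1] c a q 3 cr_one_swap(1)[of a1 a2 c c1]
        by (auto simp: E_def quads_iff)
      then show ?thesis
        using via_c[OF a, of c2] c a q 3
        by (intro cr_one_trans[of a1 a2 c1 c c2]) (auto simp: E_def)
    qed
  qed
  then show ?thesis
    using assms q by (intro that[of E]) (auto simp: E_def)
qed

text \<open>
  Points of \<open>E\<close> see all points outside \<open>E\<close> at the same place: in the product relation for
  \<open>a, b, c, d, e\<close>, the factor at \<open>(a, b, d, e)\<close> is 1.
\<close>

lemma splits_replace:
  assumes "splits Z x E" "E \<subseteq> Z" "{a, b, c} \<subseteq> E" "distinct [a, b, c]" "{d, e} \<subseteq> Z - E"
  shows "x (a, b, c, d) = x (a, b, c, e)"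
proof (cases "d = e")
  case False
  have "x (a, b, d, e) = Fin 1"
    using assms False by (auto simp: splits_def)
  moreover have "numer x (a, b, c, d) * numer x (a, b, d, e) * denom x (a, b, c, e) =
    denom x (a, b, c, d) * denom x (a, b, d, e) * numer x (a, b, c, e)"
    using assms False by (intro cr_mult) auto
  ultimately show ?thesis by (intro hcoords_eqI) simp
qed simp

lemma splits_complement:
  assumes "splits Z x E" "E \<subseteq> Z"
  shows "splits Z x (Z - E)"
  unfolding splits_def
proof (intro ballI impI)
  fix a b c d
  assume "a \<in> Z - E" "b \<in> Z - E" "c \<in> Z - (Z - E)" "d \<in> Z - (Z - E)" "a \<noteq> b" "c \<noteq> d"
  then show "x (a, b, c, d) = Fin 1"
    using assms cr_one_swap(3)[of c d a b] by (auto simp: splits_def quads_iff)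
qed

end

text \<open>
  If no cross-ratio degenerates, the points themselves can be recovered: move \<open>a\<close> to infinity,
  \<open>b\<close> to 0 and \<open>c\<close> to 1, so that the coordinate of \<open>z\<close> is the cross-ratio at \<open>(a, b, c, z)\<close>.
\<close>

lemma nondegenerate_system_is_config:
  assumes sys: "cr_system Z x" and Z: "card Z \<ge> 3"
    and nondeg: "\<And>q. q \<in> quads Z \<Longrightarrow> x q \<noteq> Fin 1"
  obtains u where "config Z u" "x = cr_of Z u"
proof -
  obtain a b c where abc: "{a, b, c} \<subseteq> Z" "distinct [a, b, c]"
  proof -
    obtain T where "T \<subseteq> Z" "card T = 3" using Z by (meson obtain_subset_with_card_n)
    then show ?thesis using that by (auto simp: card_3_iff)
  qed
  have val: "\<exists>r. x (p, q, r', s) = Fin r \<and> r \<noteq> 0 \<and> r \<noteq> 1" if "(p, q, r', s) \<in> quads Z" for p q r' s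
    using that nondeg[of "(p, q, r', s)"] nondeg[of "(p, r', q, s)"] nondeg[of "(p, s, q, r')"]
      cr_zero_iff_one[OF sys, of p r' q s] cr_infty_iff_one[OF sys that]
    by (cases "x (p, q, r', s)") (auto simp: quads_iff)
  define \<mu> where "\<mu> z = (if z = b then 0 else if z = c then 1 else numer x (a, b, c, z))" for z
  have \<mu>_c: "x (a, b, c, z) = Fin (\<mu> z) \<and> \<mu> z \<noteq> 0 \<and> \<mu> z \<noteq> 1" if "z \<in> Z" "z \<notin> {a, b, c}" for z
  proof -
    have "(a, b, c, z) \<in> quads Z" using that abc by (auto simp: quads_iff)
    then obtain r where "x (a, b, c, z) = Fin r" "r \<noteq> 0" "r \<noteq> 1" using val by blast
    then show ?thesis using that by (auto simp: \<mu>_def)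
  qed
  have \<mu>0: "\<mu> z \<noteq> 0" if "z \<in> Z" "z \<notin> {a, b}" for z
    using \<mu>_c[of z] that abc by (cases "z = c") (auto simp: \<mu>_def)
  have \<mu>_ab: "x (a, b, r, s) = Fin (\<mu> s / \<mu> r)"
    if "r \<in> Z" "s \<in> Z" "r \<noteq> s" "r \<notin> {a, b}" "s \<notin> {a, b}" for r s
  proof -
    consider "r = c" | "s = c" "r \<noteq> c" | "r \<noteq> c" "s \<noteq> c" by blast
    then show ?thesis
    proof cases
      case 1
      then show ?thesis using \<mu>_c[of s] that abc by (auto simp: \<mu>_def)
    next
      case 2
      then show ?thesis
        using \<mu>_c[of r] that abc cr_inverse_value[OF sys, of a b c r "\<mu> r"]
        by (auto simp: \<mu>_def quads_iff)
    next
      case 3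
      have "(a, b, r, s) \<in> quads Z" using that abc by (auto simp: quads_iff)
      then obtain t where t: "x (a, b, r, s) = Fin t" using val by blast
      have "x (a, b, c, s) = Fin (\<mu> r * t)"
        using that abc 3 \<mu>_c[of r] t by (intro cr_mult_value[OF sys, of a b c r s]) auto
      then have "\<mu> s = \<mu> r * t" using \<mu>_c[of s] that abc 3 by auto
      then show ?thesis using t \<mu>0[of r] that by auto
    qed
  qed
  have \<mu>_ne: "\<mu> r \<noteq> \<mu> s" if "r \<in> Z" "s \<in> Z" "r \<noteq> s" "r \<noteq> a" "s \<noteq> a" for r s
  proof (cases "r = b \<or> s = b")
    case True
    then show ?thesis using that \<mu>0[of r] \<mu>0[of s] by (auto simp: \<mu>_def)
  next
    case False
    then show ?thesis
      using \<mu>_ab[of r s] that val[of a b r s] abc \<mu>0[of r] by (auto simp: quads_iff)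
  qed
  have \<mu>_a: "x (a, q, r, s) = Fin ((\<mu> q - \<mu> s) / (\<mu> q - \<mu> r))"
    if "(a, q, r, s) \<in> quads Z" for q r s
  proof -
    have Z': "a \<in> Z" "b \<in> Z" "q \<in> Z" "r \<in> Z" "s \<in> Z" "distinct [a, q, r, s]" "a \<noteq> b"
      using that abc by (auto simp: quads_iff)
    have mu_b: "\<mu> b = 0" by (simp add: \<mu>_def)
    have r_b: "x (a, q', b, s') = Fin (1 - \<mu> s' / \<mu> q')"
      if "q' \<in> Z" "s' \<in> Z" "q' \<noteq> s'" "q' \<notin> {a, b}" "s' \<notin> {a, b}" for q' s'
      using cr_complement_value[OF sys, of a b q' s'] \<mu>_ab[of q' s'] that Z' by (auto simp: quads_iff)
    have s_b: "x (a, q', r', b) = Fin (\<mu> q' / (\<mu> q' - \<mu> r'))"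
      if "q' \<in> Z" "r' \<in> Z" "q' \<noteq> r'" "q' \<notin> {a, b}" "r' \<notin> {a, b}" for q' r'
    proof -
      have "(a, q', b, r') \<in> quads Z" "1 - \<mu> r' / \<mu> q' \<noteq> 0"
        using that Z' \<mu>0[of q'] \<mu>_ne[of q' r'] by (auto simp: quads_iff)
      then have "x (a, q', r', b) = Fin (1 / (1 - \<mu> r' / \<mu> q'))"
        using r_b[of q' r'] that by (intro cr_inverse_value[OF sys]) auto
      moreover have "1 - \<mu> r' / \<mu> q' = (\<mu> q' - \<mu> r') / \<mu> q'"
        using \<mu>0[of q'] that by (simp add: diff_divide_distrib)
      ultimately show ?thesis by simp
    qed
    consider "q = b" | "r = b" | "s = b" | "b \<notin> {q, r, s}" by blast
    then show ?thesis
    proof cases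
      case 1
      then show ?thesis using \<mu>_ab[of r s] mu_b Z' by auto
    next
      case 2
      then have "x (a, q, r, s) = Fin (1 - \<mu> s / \<mu> q)" "\<mu> q \<noteq> 0"
        using r_b[of q s] Z' \<mu>0[of q] by auto
      then show ?thesis using 2 mu_b by (simp add: diff_divide_distrib)
    next
      case 3
      then show ?thesis using s_b[of q r] mu_b Z' by auto
    next
      case 4
      have "x (a, q, r, s) = Fin (\<mu> q / (\<mu> q - \<mu> r) * (1 - \<mu> s / \<mu> q))"
        using 4 Z' s_b[of q r] r_b[of q s] by (intro cr_mult_value[OF sys, of a q r b s]) auto
      moreover have "\<mu> q \<noteq> 0" using 4 Z' by (intro \<mu>0) auto
      moreover from this have "1 - \<mu> s / \<mu> q = (\<mu> q - \<mu> s) / \<mu> q"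
        by (simp add: diff_divide_distrib)
      ultimately show ?thesis by simp
    qed
  qed
  define u :: "'a \<Rightarrow> 'b \<times> 'b" where "u z = (if z = a then (1, 0) else (\<mu> z, 1))" for z
  have u: "config Z u"
    using \<mu>_ne by (auto simp: config_def u_def det2_def)
  have on_quads: "x (p, q, r, s) = vcr (u p) (u q) (u r) (u s)" if pqrs: "(p, q, r, s) \<in> quads Z" for p q r s
  proof -
    have Z': "a \<in> Z" "p \<in> Z" "q \<in> Z" "r \<in> Z" "s \<in> Z" "distinct [p, q, r, s]"
      using pqrs abc by (auto simp: quads_iff)
    have base: "x (a, q', r', s') = vcr (u a) (u q') (u r') (u s')"
      if "(a, q', r', s') \<in> quads Z" for q' r' s'
      using that \<mu>_a[OF that] \<mu>_ne[of q' r']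
      by (auto simp: u_def vcr_def det2_def ratio_def quads_iff)
    consider "p = a" | "q = a" | "r = a" | "s = a" | "a \<notin> {p, q, r, s}" by blast
    then show ?thesis
    proof cases
      case 1
      then show ?thesis using base pqrs by blast
    next
      case 2
      then have "(a, p, s, r) \<in> quads Z" using pqrs by (auto simp: quads_iff)
      then show ?thesis
        using cr_reverse[OF sys, of a p s r] base 2 vcr_reverse[of "u a" "u p" "u s" "u r"] by simp
    next
      case 3
      then have "(a, s, p, q) \<in> quads Z" using pqrs by (auto simp: quads_iff)
      then show ?thesis
        using cr_sym[OF sys, of a s p q] base 3 vcr_sym[of "u a" "u s" "u p" "u q"] by simp
    next
      case 4
      then have "(a, r, q, p) \<in> quads Z" "(r, a, p, q) \<in> quads Z" using pqrs by (auto simp: quads_iff)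
      then show ?thesis
        using cr_sym[OF sys, of r a p q] cr_reverse[OF sys, of a r q p] base 4
          vcr_sym[of "u r" "u a" "u p" "u q"] vcr_reverse[of "u a" "u r" "u q" "u p"] by simp
    next
      case 5
      have ne: "\<mu> p \<noteq> \<mu> s" "\<mu> q \<noteq> \<mu> r"
        by (rule \<mu>_ne; use Z' 5 in auto)+
      have q1: "(p, a, r, s) \<in> quads Z" "(a, p, s, r) \<in> quads Z" "(a, q, r, s) \<in> quads Z"
        using Z' 5 by (auto simp: quads_iff)
      have "x (r, s, p, a) = x (a, p, s, r)"
        using cr_sym[OF sys q1(1)] cr_reverse[OF sys q1(2)] by simp
      then have v1: "x (r, s, p, a) = Fin ((\<mu> p - \<mu> r) / (\<mu> p - \<mu> s))"
        using \<mu>_a[OF q1(2)] by simp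
      have v2: "x (r, s, a, q) = Fin ((\<mu> q - \<mu> s) / (\<mu> q - \<mu> r))"
        using cr_sym[OF sys q1(3)] \<mu>_a[OF q1(3)] by simp
      have d: "{r, s, p, a, q} \<subseteq> Z" "distinct [r, s, p, a, q]" using Z' 5 by auto
      have "x (r, s, p, q) =
          Fin ((\<mu> p - \<mu> r) / (\<mu> p - \<mu> s) * ((\<mu> q - \<mu> s) / (\<mu> q - \<mu> r)))"
        by (rule cr_mult_value[OF sys d v1 v2])
      then have xval: "x (p, q, r, s) =
          Fin ((\<mu> p - \<mu> r) / (\<mu> p - \<mu> s) * ((\<mu> q - \<mu> s) / (\<mu> q - \<mu> r)))"
        unfolding cr_sym[OF sys pqrs] .
      have "det2 (u i) (u j) = \<mu> i - \<mu> j" if "a \<noteq> i" "a \<noteq> j" for i j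
        using that by (auto simp: u_def det2_def)
      then have vcr: "vcr (u p) (u q) (u r) (u s) =
          ratio ((\<mu> p - \<mu> r) * (\<mu> q - \<mu> s)) ((\<mu> p - \<mu> s) * (\<mu> q - \<mu> r))"
        unfolding vcr_def using 5 by simp
      show ?thesis
        unfolding xval vcr using ne by (simp add: ratio_def)
    qed
  qed
  have "x = cr_of Z u"
  proof
    fix q :: "'a \<times> 'a \<times> 'a \<times> 'a"
    show "x q = cr_of Z u q"
    proof (cases "q \<in> quads Z")
      case True
      then show ?thesis using on_quads by (cases q) (simp add: cr_of_def)
    next
      case False
      have "x \<in> quads Z \<rightarrow>\<^sub>E UNIV" using sys unfolding cr_system_def by blast
      then show ?thesis using PiE_arb[OF _ False] False unfolding cr_of_def by fastforce
    qed
  qed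
  then show ?thesis using u that by blast
qed

section \<open>Closures and one-parameter families\<close>

lemma det2_pluecker:
  "det2 u1 u3 * det2 u2 u4 - det2 u1 u4 * det2 u2 u3 = det2 u1 u2 * det2 u3 u4"
  by (simp add: det2_def algebra_simps)

lemma det2_swap: "det2 u v = - det2 v u"
  by (simp add: det2_def)

text \<open>
  For nonzero vectors this fails exactly if three of the four points coincide.  If only pairs
  coincide, the cross-ratio is still defined, with value 0, 1 or \<open>\<infinity>\<close>.
\<close>

definition generic4 :: "'k::field \<times> 'k \<Rightarrow> 'k \<times> 'k \<Rightarrow> 'k \<times> 'k \<Rightarrow> 'k \<times> 'k \<Rightarrow> bool" where
  "generic4 u1 u2 u3 u4 \<longleftrightarrow> det2 u1 u3 * det2 u2 u4 \<noteq> 0 \<or> det2 u1 u4 * det2 u2 u3 \<noteq> 0"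

lemma generic4_swap:
  assumes "generic4 u1 u2 u3 u4"
  shows "generic4 u3 u4 u1 u2" "generic4 u1 u2 u4 u3" "generic4 u1 u3 u2 u4"
  using assms det2_pluecker[of u1 u3 u2 u4] det2_swap[of u3 u1] det2_swap[of u4 u2]
    det2_swap[of u4 u1] det2_swap[of u3 u2]
  by (auto simp: generic4_def)

lemma hcoords_vcr:
  assumes "generic4 u1 u2 u3 u4"
  obtains c where "c \<noteq> 0"
    "hcoords (vcr u1 u2 u3 u4) = (c * (det2 u1 u3 * det2 u2 u4), c * (det2 u1 u4 * det2 u2 u3))"
  using assms hcoords_ratio unfolding generic4_def vcr_def by metis

lemma vcr_s4_related:
  assumes g: "generic4 u1 u2 u3 u4"
  shows "s4_related (vcr u1 u2 u3 u4) (vcr u1 u2 u4 u3) (vcr u1 u3 u2 u4)"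
proof -
  obtain c where c: "hcoords (vcr u1 u2 u3 u4) =
      (c * (det2 u1 u3 * det2 u2 u4), c * (det2 u1 u4 * det2 u2 u3))"
    using hcoords_vcr[OF g] by metis
  obtain c2 where c2: "hcoords (vcr u1 u2 u4 u3) =
      (c2 * (det2 u1 u4 * det2 u2 u3), c2 * (det2 u1 u3 * det2 u2 u4))"
    using hcoords_vcr[OF generic4_swap(2)[OF g]] by metis
  obtain c3 where c3: "hcoords (vcr u1 u3 u2 u4) =
      (c3 * (det2 u1 u2 * det2 u3 u4), c3 * (det2 u1 u4 * det2 u3 u2))"
    using hcoords_vcr[OF generic4_swap(3)[OF g]] by metis
  show ?thesis
    unfolding s4_related_def c c2 c3 det2_swap[of u3 u2] fst_conv snd_conv
      det2_pluecker[of u1 u3 u2 u4, symmetric]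
    by (simp add: algebra_simps)
qed

lemma vcr_product_related:
  assumes "generic4 ua ub uc ud" "generic4 ua ub ud ue" "generic4 ua ub uc ue"
  shows "product_related (vcr ua ub uc ud) (vcr ua ub ud ue) (vcr ua ub uc ue)"
proof -
  obtain c1 where c1: "hcoords (vcr ua ub uc ud) =
      (c1 * (det2 ua uc * det2 ub ud), c1 * (det2 ua ud * det2 ub uc))"
    using hcoords_vcr[OF assms(1)] by metis
  obtain c2 where c2: "hcoords (vcr ua ub ud ue) =
      (c2 * (det2 ua ud * det2 ub ue), c2 * (det2 ua ue * det2 ub ud))"
    using hcoords_vcr[OF assms(2)] by metis
  obtain c3 where c3: "hcoords (vcr ua ub uc ue) =
      (c3 * (det2 ua uc * det2 ub ue), c3 * (det2 ua ue * det2 ub uc))"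
    using hcoords_vcr[OF assms(3)] by metis
  show ?thesis unfolding product_related_def c1 c2 c3 by (simp add: algebra_simps)
qed

text \<open>
  The cross-ratios of configurations of distinct points, that is, of smooth curves.
\<close>

definition open_part :: "'z set \<Rightarrow> ('z quad \<Rightarrow> 'k::field pline) set" where
  "open_part Z = cr_of Z ` {u. config Z u}"

lemma config_generic4:
  "config Z u \<Longrightarrow> (a, b, c, d) \<in> quads Z \<Longrightarrow> generic4 (u a) (u b) (u c) (u d)"
  by (auto simp: config_def generic4_def quads_iff)

lemma cr_system_cr_of:
  assumes "config Z u"
  shows "cr_system Z (cr_of Z u)"
  unfolding cr_system_def
proof (intro conjI allI impI)
  show "cr_of Z u \<in> quads Z \<rightarrow>\<^sub>E UNIV" by (simp add: cr_of_def)
next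
  fix a b c d assume q: "(a, b, c, d) \<in> quads Z"
  then have q': "(c, d, a, b) \<in> quads Z" "(a, b, d, c) \<in> quads Z" "(a, c, b, d) \<in> quads Z"
    by (auto simp: quads_iff)
  show "cr_of Z u (c, d, a, b) = cr_of Z u (a, b, c, d)"
    using q q' vcr_sym by (simp add: cr_of_def)
  show "s4_related (cr_of Z u (a, b, c, d)) (cr_of Z u (a, b, d, c)) (cr_of Z u (a, c, b, d))"
    using vcr_s4_related[OF config_generic4[OF assms q]] q q' by (simp add: cr_of_def)
next
  fix a b c d e assume "{a, b, c, d, e} \<subseteq> Z" "distinct [a, b, c, d, e]"
  then have q: "(a, b, c, d) \<in> quads Z" "(a, b, d, e) \<in> quads Z" "(a, b, c, e) \<in> quads Z"
    by (auto simp: quads_iff)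
  show "product_related (cr_of Z u (a, b, c, d)) (cr_of Z u (a, b, d, e)) (cr_of Z u (a, b, c, e))"
    using vcr_product_related[OF q[THEN config_generic4[OF assms]]] q by (simp add: cr_of_def)
qed

lemma open_part_no_splits:
  assumes "config Z u" "(a, b, c, d) \<in> quads Z"
  shows "cr_of Z u (a, b, c, d) \<noteq> Fin 1"
proof
  assume "cr_of Z u (a, b, c, d) = Fin 1"
  then have "det2 (u a) (u c) * det2 (u b) (u d) = det2 (u a) (u d) * det2 (u b) (u c)"
    using assms by (auto simp: cr_of_def vcr_def ratio_def divide_eq_1_iff split: if_splits)
  then have "det2 (u a) (u b) * det2 (u c) (u d) = 0"
    using det2_pluecker[of "u a" "u c" "u b" "u d"] by simp
  then show False using assms by (auto simp: config_def quads_iff)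
qed

definition in_closure :: "'i set \<Rightarrow> ('i \<Rightarrow> 'k::field pline) set \<Rightarrow> ('i \<Rightarrow> 'k pline) \<Rightarrow> bool" where
  "in_closure I M x \<longleftrightarrow> x \<in> I \<rightarrow>\<^sub>E UNIV \<and>
     (\<forall>d F. multiform I d F \<longrightarrow> (\<forall>m\<in>M. F (hcoords \<circ> m) = 0) \<longrightarrow> F (hcoords \<circ> x) = 0)"

lemma multiform_uminus: "multiform I d F \<Longrightarrow> multiform I d (\<lambda>h. - F h)"
  using multiform.mult[OF multiform.scalar[of I "-1"]] by simp

lemma multiform_diff:
  "multiform I d F \<Longrightarrow> multiform I d G \<Longrightarrow> multiform I d (\<lambda>h. F h - G h)"
  using multiform.add[of I d F "\<lambda>h. - G h"] multiform_uminus[of I d G] by simp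

lemma in_closure_eq:
  assumes "in_closure I M x" "multiform I d F" "multiform I d G"
    and "\<And>m. m \<in> M \<Longrightarrow> F (hcoords \<circ> m) = G (hcoords \<circ> m)"
  shows "F (hcoords \<circ> x) = G (hcoords \<circ> x)"
proof -
  have "F (hcoords \<circ> x) - G (hcoords \<circ> x) = 0"
    using assms(1) multiform_diff[OF assms(2,3)] assms(4) unfolding in_closure_def
    by (metis (no_types, lifting) right_minus_eq)
  then show ?thesis by simp
qed

lemma cr_system_closed:
  fixes x :: "'z quad \<Rightarrow> 'k::field pline"
  assumes x: "in_closure (quads Z) M x" and M: "\<And>m. m \<in> M \<Longrightarrow> cr_system Z m"
  shows "cr_system Z x"
  unfolding cr_system_def
proof (intro conjI allI impI)
  show "x \<in> quads Z \<rightarrow>\<^sub>E UNIV" using x by (simp add: in_closure_def)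
next
  note m = multiform.mult and c1 = multiform.coord1 and c2 = multiform.coord2
  fix a b c d assume q: "(a, b, c, d) \<in> quads Z"
  then have q': "(c, d, a, b) \<in> quads Z" "(a, b, d, c) \<in> quads Z" "(a, c, b, d) \<in> quads Z"
    by (auto simp: quads_iff)
  have "numer y (c, d, a, b) * denom y (a, b, c, d) = denom y (c, d, a, b) * numer y (a, b, c, d)"
    if "y \<in> M" for y
    using cr_sym[OF M[OF that] q] by (simp add: mult.commute)
  then have "numer x (c, d, a, b) * denom x (a, b, c, d) = denom x (c, d, a, b) * numer x (a, b, c, d)"
    using in_closure_eq[OF x m[OF c1[OF q'(1)] c2[OF q]] m[OF c2[OF q'(1)] c1[OF q]]] by auto
  then show "x (c, d, a, b) = x (a, b, c, d)" by (rule hcoords_eqI)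
  have "numer x (a, b, c, d) * numer x (a, b, d, c) = denom x (a, b, c, d) * denom x (a, b, d, c)"
    using in_closure_eq[OF x m[OF c1[OF q] c1[OF q'(2)]] m[OF c2[OF q] c2[OF q'(2)]]]
      cr_inverse[OF M q] by auto
  moreover have "denom y (a, b, c, d) * numer y (a, c, b, d) =
      (denom y (a, b, c, d) - numer y (a, b, c, d)) * denom y (a, c, b, d)" if "y \<in> M" for y
    using cr_complement[OF M[OF that] q] by (simp add: mult.commute)
  then have "denom x (a, b, c, d) * numer x (a, c, b, d) =
      (denom x (a, b, c, d) - numer x (a, b, c, d)) * denom x (a, c, b, d)"
    using in_closure_eq[OF x m[OF c2[OF q] c1[OF q'(3)]]
        m[OF multiform_diff[OF c2[OF q] c1[OF q]] c2[OF q'(3)]]] by auto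
  ultimately show "s4_related (x (a, b, c, d)) (x (a, b, d, c)) (x (a, c, b, d))"
    by (simp add: s4_related_def mult.commute)
next
  note m = multiform.mult and c1 = multiform.coord1 and c2 = multiform.coord2
  fix a b c d e assume abcde: "{a, b, c, d, e} \<subseteq> Z" "distinct [a, b, c, d, e]"
  then have q: "(a, b, c, d) \<in> quads Z" "(a, b, d, e) \<in> quads Z" "(a, b, c, e) \<in> quads Z"
    by (auto simp: quads_iff)
  show "product_related (x (a, b, c, d)) (x (a, b, d, e)) (x (a, b, c, e))"
    using in_closure_eq[OF x m[OF m[OF c1[OF q(1)] c1[OF q(2)]] c2[OF q(3)]]
        m[OF m[OF c2[OF q(1)] c2[OF q(2)]] c1[OF q(3)]]] cr_mult[OF M abcde]
    unfolding product_related_def by auto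
qed

lemma poly_zero_of_cofinite:
  fixes p :: "'k::alg_closed_field poly"
  assumes "finite B" "\<And>t. t \<notin> B \<Longrightarrow> poly p t = 0"
  shows "p = 0"
proof (rule ccontr)
  assume "p \<noteq> 0"
  then have "finite ({t. poly p t = 0} \<union> B)"
    using poly_roots_finite assms(1) by blast
  moreover have "{t. poly p t = 0} \<union> B = UNIV" using assms(2) by auto
  ultimately show False using alg_closed_infinite by metis
qed

text \<open>
  A form that vanishes on \<open>M\<close> restricts to a polynomial in the parameter with infinitely many zeros.
\<close>

lemma in_closure_limit:
  fixes x :: "'i \<Rightarrow> 'k::alg_closed_field pline"
  assumes "finite I" "finite B"
    and generic: "\<And>t. t \<notin> B \<Longrightarrow> \<exists>m\<in>M. \<forall>i\<in>I. (poly (\<sigma> i) t \<noteq> 0 \<or> poly (\<rho> i) t \<noteq> 0) \<and>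
        m i = ratio (poly (\<sigma> i) t) (poly (\<rho> i) t)"
    and nz: "\<And>i. i \<in> I \<Longrightarrow> poly (\<sigma> i) t0 \<noteq> 0 \<or> poly (\<rho> i) t0 \<noteq> 0"
    and x: "x = (\<lambda>i\<in>I. ratio (poly (\<sigma> i) t0) (poly (\<rho> i) t0))"
  shows "in_closure I M x"
  unfolding in_closure_def
proof (intro conjI allI impI)
  show "x \<in> I \<rightarrow>\<^sub>E UNIV" by (simp add: x)
next
  fix d F assume F: "multiform I d F" and van: "\<forall>m\<in>M. F (hcoords \<circ> m) = 0"
  obtain P where P: "\<And>t. F (\<lambda>i. (poly (\<sigma> i) t, poly (\<rho> i) t)) = poly P t"
    using multiform_compose_poly[OF F] by blast
  have "poly P t = 0" if t: "t \<notin> B" for t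
  proof -
    obtain m where m: "m \<in> M" "\<And>i. i \<in> I \<Longrightarrow> poly (\<sigma> i) t \<noteq> 0 \<or> poly (\<rho> i) t \<noteq> 0"
      "\<And>i. i \<in> I \<Longrightarrow> m i = ratio (poly (\<sigma> i) t) (poly (\<rho> i) t)"
      using generic[OF t] by blast
    have "F (hcoords \<circ> m) = 0 \<longleftrightarrow> F (\<lambda>i. (poly (\<sigma> i) t, poly (\<rho> i) t)) = 0"
      using m by (intro multiform_zero_ratio[OF F assms(1)]) auto
    then show ?thesis using van m(1) P by simp
  qed
  then have "P = 0" using poly_zero_of_cofinite assms(2) by blast
  moreover have "F (hcoords \<circ> x) = 0 \<longleftrightarrow> F (\<lambda>i. (poly (\<sigma> i) t0, poly (\<rho> i) t0)) = 0"
    using nz by (intro multiform_zero_ratio[OF F assms(1)]) (auto simp: x)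
  ultimately show "F (hcoords \<circ> x) = 0" using P by simp
qed

text \<open>
  Any two configurations of vectors are joined by a line, along which all but finitely many
  members are configurations again.
\<close>

lemma open_part_irreducible:
  fixes F G :: "('z quad \<Rightarrow> 'k::alg_closed_field \<times> 'k) \<Rightarrow> 'k"
  assumes "finite Z" "multiform (quads Z) d F" "multiform (quads Z) e G"
    and prod: "\<And>m. m \<in> open_part Z \<Longrightarrow> F (hcoords \<circ> m) * G (hcoords \<circ> m) = 0"
  shows "(\<forall>m\<in>open_part Z. F (hcoords \<circ> m) = 0) \<or> (\<forall>m\<in>open_part Z. G (hcoords \<circ> m) = 0)"
proof (rule ccontr)
  assume "\<not> ?thesis"
  then obtain u w where u: "config Z u" "F (hcoords \<circ> cr_of Z u) \<noteq> 0"
    and w: "config Z w" "G (hcoords \<circ> cr_of Z w) \<noteq> 0"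
    by (auto simp: open_part_def)
  define z1 z2 where "z1 i = [:fst (u i), fst (w i) - fst (u i):]"
    and "z2 i = [:snd (u i), snd (w i) - snd (u i):]" for i
  define z where "z t i = (poly (z1 i) t, poly (z2 i) t)" for t i
  have z01: "z 0 = u" "z 1 = w" by (auto simp: z_def z1_def z2_def)
  define D where "D i j = z1 i * z2 j - z2 i * z1 j" for i j
  have D: "det2 (z t i) (z t j) = poly (D i j) t" for t i j
    by (simp add: det2_def z_def D_def)
  define B where "B = (\<Union>i\<in>Z. \<Union>j\<in>Z - {i}. {t. poly (D i j) t = 0})"
  have nz: "D i j \<noteq> 0" if "i \<in> Z" "j \<in> Z" "i \<noteq> j" for i j
    using u(1) that D[of 0 i j] z01 by (auto simp: config_def)
  have B: "finite B"
    unfolding B_def using assms(1) nz by (intro finite_UN_I poly_roots_finite) auto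
  have conf: "config Z (z t)" if "t \<notin> B" for t
    using that by (auto simp: config_def D B_def)
  define \<sigma> \<rho> where "\<sigma> = (\<lambda>(a, b, c, d). D a c * D b d)" and "\<rho> = (\<lambda>(a, b, c, d). D a d * D b c)"
  obtain P where P: "\<And>t. F (\<lambda>i. (poly (\<sigma> i) t, poly (\<rho> i) t)) = poly P t"
    using multiform_compose_poly[OF assms(2)] by blast
  obtain Q where Q: "\<And>t. G (\<lambda>i. (poly (\<sigma> i) t, poly (\<rho> i) t)) = poly Q t"
    using multiform_compose_poly[OF assms(3)] by blast
  have eval: "H (hcoords \<circ> cr_of Z (z t)) = 0 \<longleftrightarrow> H (\<lambda>i. (poly (\<sigma> i) t, poly (\<rho> i) t)) = 0"
    if "config Z (z t)" "multiform (quads Z) d' H" for H t d'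
  proof (rule multiform_zero_ratio[OF that(2) finite_quads[OF assms(1)]])
    fix q assume q: "q \<in> quads Z"
    obtain a b c d where [simp]: "q = (a, b, c, d)" by (cases q)
    show "fst (poly (\<sigma> q) t, poly (\<rho> q) t) \<noteq> 0 \<or> snd (poly (\<sigma> q) t, poly (\<rho> q) t) \<noteq> 0"
      using config_generic4[OF that(1)] q by (auto simp: generic4_def \<sigma>_def \<rho>_def D)
    show "cr_of Z (z t) q = ratio (fst (poly (\<sigma> q) t, poly (\<rho> q) t)) (snd (poly (\<sigma> q) t, poly (\<rho> q) t))"
      using q by (auto simp: cr_of_def vcr_def \<sigma>_def \<rho>_def D)
  qed
  have "poly (P * Q) t = 0" if "t \<notin> B" for t
    using prod[of "cr_of Z (z t)"] conf[OF that] eval[OF conf[OF that] assms(2)]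
      eval[OF conf[OF that] assms(3)] P Q by (auto simp: open_part_def)
  then have "P * Q = 0" using poly_zero_of_cofinite[OF B] by blast
  moreover have "poly P 0 \<noteq> 0" using eval[of 0, OF _ assms(2)] u P z01 by simp
  moreover have "poly Q 1 \<noteq> 0" using eval[of 1, OF _ assms(3)] w Q z01 by simp
  ultimately show False by auto
qed

section \<open>Grafting systems along a split\<close>

definition collapse :: "'z set \<Rightarrow> 'z \<Rightarrow> 'z \<Rightarrow> 'z" where
  "collapse A c z = (if z \<in> A then z else c)"

definition collapse4 :: "'z set \<Rightarrow> 'z \<Rightarrow> 'z quad \<Rightarrow> 'z quad" where
  "collapse4 A c0 = (\<lambda>(a, b, c, d). (collapse A c0 a, collapse A c0 b, collapse A c0 c, collapse A c0 d))"

abbreviation survives :: "'z set \<Rightarrow> 'z \<Rightarrow> 'z quad \<Rightarrow> bool" where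
  "survives A c0 q \<equiv> collapse4 A c0 q \<in> quads (insert c0 A)"

text \<open>
  \<open>graft Z A a0 c0 x1 x2\<close> puts a system on \<open>A\<close> and a point \<open>c0\<close> together with one on the complement of
  \<open>A\<close> and a point \<open>a0\<close>: a quadruple with at least three members on one side is evaluated there, after
  its other member has been replaced by \<open>c0\<close> or \<open>a0\<close>, and a quadruple with two members on each side has
  the value prescribed by the split.  The values are of an arbitrary type because homogeneous
  coordinates are grafted as well.
\<close>

fun graft_by :: "'z set \<Rightarrow> 'z set \<Rightarrow> 'z \<Rightarrow> 'z \<Rightarrow> 'v \<times> 'v \<times> 'v \<Rightarrow>
    ('z quad \<Rightarrow> 'v) \<Rightarrow> ('z quad \<Rightarrow> 'v) \<Rightarrow> 'z quad \<Rightarrow> 'v" where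
  "graft_by Z A a0 c0 (one, zero, infty) x1 x2 (a, b, c, d) =
    (if survives A c0 (a, b, c, d) then x1 (collapse4 A c0 (a, b, c, d))
     else if survives (Z - A) a0 (a, b, c, d)
       then x2 (collapse4 (Z - A) a0 (a, b, c, d))
     else if (a \<in> A) = (b \<in> A) then one else if (a \<in> A) = (c \<in> A) then zero else infty)"

declare graft_by.simps [simp del]

definition graft :: "'z set \<Rightarrow> 'z set \<Rightarrow> 'z \<Rightarrow> 'z \<Rightarrow> ('z quad \<Rightarrow> 'k::field pline) \<Rightarrow>
    ('z quad \<Rightarrow> 'k pline) \<Rightarrow> 'z quad \<Rightarrow> 'k pline" where
  "graft Z A a0 c0 x1 x2 = restrict (graft_by Z A a0 c0 (Fin 1, Fin 0, Infty) x1 x2) (quads Z)"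

lemma hcoords_graft_by:
  "hcoords (graft_by Z A a0 c0 (Fin 1, Fin 0, Infty) x1 x2 q) =
    graft_by Z A a0 c0 ((1, 1), (0, 1), (1, 0)) (hcoords \<circ> x1) (hcoords \<circ> x2) q"
  by (cases q) (auto simp: graft_by.simps)

text \<open>
  For a fixed second argument, grafting replaces each coordinate by a coordinate of the first
  argument or by a constant; so forms pull back to forms.
\<close>

lemma multiform_substitute:
  assumes "multiform I d F" "finite I"
    and "\<And>i. i \<in> I \<Longrightarrow> (\<exists>j\<in>J. \<forall>h. \<tau> i h = h j) \<or> (\<exists>v. \<forall>h. \<tau> i h = v)"
  obtains e where "multiform J e (\<lambda>h. F (\<lambda>i. \<tau> i h))"
proof -
  have "\<exists>e. multiform J e (\<lambda>h. fst (\<tau> i h)) \<and> multiform J e (\<lambda>h. snd (\<tau> i h))" if "i \<in> I" for i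
    using assms(3)[OF that]
  proof
    assume "\<exists>j\<in>J. \<forall>h. \<tau> i h = h j"
    then obtain j where j: "j \<in> J" "\<And>h. \<tau> i h = h j" by blast
    show ?thesis
      unfolding j(2) using multiform.coord1[OF j(1)] multiform.coord2[OF j(1)] by blast
  next
    assume "\<exists>v. \<forall>h. \<tau> i h = v"
    then obtain v where v: "\<And>h. \<tau> i h = v" by blast
    show ?thesis unfolding v using multiform.scalar by blast
  qed
  then obtain e where "\<And>i. i \<in> I \<Longrightarrow> multiform J (e i) (\<lambda>h. fst (\<tau> i h))"
    "\<And>i. i \<in> I \<Longrightarrow> multiform J (e i) (\<lambda>h. snd (\<tau> i h))" by metis
  from multiform_compose[OF assms(1,2) this] show ?thesis by (rule that)
qed

lemma graft_by_first:
  "(\<exists>p\<in>quads (insert c0 A). \<forall>h. graft_by Z A a0 c0 k h h2 q = h p) \<or>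
    (\<exists>v. \<forall>h. graft_by Z A a0 c0 k h h2 q = v)"
  by (cases q; cases k; cases "survives A c0 q") (auto simp: graft_by.simps)

lemma graft_by_second:
  "(\<exists>p\<in>quads (insert a0 (Z - A)). \<forall>h. graft_by Z A a0 c0 k h1 h q = h p) \<or>
    (\<exists>v. \<forall>h. graft_by Z A a0 c0 k h1 h q = v)"
  by (cases q; cases k; cases "survives A c0 q";
      cases "survives (Z - A) a0 q") (auto simp: graft_by.simps)

text \<open>
  The closure can be taken in one argument at a time, first in \<open>x1\<close> for a fixed member of \<open>M2\<close>, then
  in \<open>x2\<close>.
\<close>

lemma in_closure_graft:
  assumes "finite Z" and x1: "in_closure (quads (insert c0 A)) M1 x1"
    and x2: "in_closure (quads (insert a0 (Z - A))) M2 x2"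
    and M: "\<And>m1 m2. m1 \<in> M1 \<Longrightarrow> m2 \<in> M2 \<Longrightarrow> in_closure (quads Z) M (graft Z A a0 c0 m1 m2)"
  shows "in_closure (quads Z) M (graft Z A a0 c0 x1 x2)"
  unfolding in_closure_def
proof (intro conjI allI impI)
  show "graft Z A a0 c0 x1 x2 \<in> quads Z \<rightarrow>\<^sub>E UNIV" by (simp add: graft_def)
next
  fix d F assume F: "multiform (quads Z) d F" and van: "\<forall>m\<in>M. F (hcoords \<circ> m) = 0"
  let ?g = "\<lambda>h1 h2. F (graft_by Z A a0 c0 ((1, 1), (0, 1), (1, 0)) h1 h2)"
  have F_graft: "F (hcoords \<circ> graft Z A a0 c0 y1 y2) = ?g (hcoords \<circ> y1) (hcoords \<circ> y2)" for y1 y2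
    by (rule multiform_cong_on[OF F]) (simp add: graft_def hcoords_graft_by)
  have 1: "?g (hcoords \<circ> x1) (hcoords \<circ> m2) = 0" if "m2 \<in> M2" for m2
  proof -
    obtain e where "multiform (quads (insert c0 A)) e (\<lambda>h1. ?g h1 (hcoords \<circ> m2))"
      by (rule multiform_substitute[OF F finite_quads[OF assms(1)] graft_by_first])
    moreover have "?g (hcoords \<circ> m1) (hcoords \<circ> m2) = 0" if "m1 \<in> M1" for m1
      using M[OF that \<open>m2 \<in> M2\<close>] F van unfolding F_graft[symmetric] in_closure_def by blast
    ultimately show ?thesis using x1 unfolding in_closure_def by blast
  qed
  obtain e where "multiform (quads (insert a0 (Z - A))) e (?g (hcoords \<circ> x1))"
    by (rule multiform_substitute[OF F finite_quads[OF assms(1)] graft_by_second])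
  then have "?g (hcoords \<circ> x1) (hcoords \<circ> x2) = 0"
    using x2 1 unfolding in_closure_def by blast
  then show "F (hcoords \<circ> graft Z A a0 c0 x1 x2) = 0" by (simp add: F_graft)
qed

lemma cr_system_restrict:
  assumes sys: "cr_system Z x" and "W \<subseteq> Z"
  shows "cr_system W (restrict x (quads W))"
  unfolding cr_system_def
proof (intro conjI allI impI)
  note W = subsetD[OF quads_mono[OF assms(2)]]
  fix a b c d assume q: "(a, b, c, d) \<in> quads W"
  then have q': "(c, d, a, b) \<in> quads W" "(a, b, d, c) \<in> quads W" "(a, c, b, d) \<in> quads W"
    by (auto simp: quads_iff)
  show "restrict x (quads W) (c, d, a, b) = restrict x (quads W) (a, b, c, d)"
    using cr_sym[OF sys W[OF q]] q q' by simp
  show "s4_related (restrict x (quads W) (a, b, c, d)) (restrict x (quads W) (a, b, d, c))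
      (restrict x (quads W) (a, c, b, d))"
    using cr_inverse[OF sys W[OF q]] cr_complement[OF sys W[OF q]] q q' by (simp add: s4_related_def)
next
  fix a b c d e assume p: "{a, b, c, d, e} \<subseteq> W" "distinct [a, b, c, d, e]"
  then have q: "(a, b, c, d) \<in> quads W" "(a, b, d, e) \<in> quads W" "(a, b, c, e) \<in> quads W"
    by (auto simp: quads_iff)
  have "{a, b, c, d, e} \<subseteq> Z" using p assms(2) by blast
  from cr_mult[OF sys this p(2)]
  show "product_related (restrict x (quads W) (a, b, c, d)) (restrict x (quads W) (a, b, d, e))
      (restrict x (quads W) (a, b, c, e))"
    by (simp only: product_related_def q restrict_apply if_True)
qed auto

lemma collapse4_quads_iff:
  assumes "(a, b, c, d) \<in> quads Z" "c0 \<notin> A"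
  shows "survives A c0 (a, b, c, d) \<longleftrightarrow>
    (a \<in> A \<and> b \<in> A \<and> c \<in> A) \<or> (a \<in> A \<and> b \<in> A \<and> d \<in> A) \<or>
    (a \<in> A \<and> c \<in> A \<and> d \<in> A) \<or> (b \<in> A \<and> c \<in> A \<and> d \<in> A)"
  using assms by (auto simp: collapse4_def collapse_def quads_iff)

text \<open>
  The four cases with a member outside \<open>A\<close> are reduced by symmetry to the one where it comes last.
\<close>

lemma split_collapse:
  assumes sys: "cr_system Z x" and A: "splits Z x A" "A \<subseteq> Z" and c0: "c0 \<in> Z - A"
    and q: "(a, b, c, d) \<in> quads Z"
    and survives: "survives A c0 (a, b, c, d)"
  shows "x (collapse4 A c0 (a, b, c, d)) = x (a, b, c, d)"
proof -
  have rep: "x (a1, a2, a3, c0) = x (a1, a2, a3, z)" if "{a1, a2, a3} \<subseteq> A" "distinct [a1, a2, a3]" "z \<in> Z - A"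
    for a1 a2 a3 z
    using splits_replace[OF sys A that(1,2), of c0 z] c0 that(3) by auto
  have qA: "{a, b, c, d} \<subseteq> Z" "distinct [a, b, c, d]" using q by (auto simp: quads_iff)
  have inA: "z \<in> Z" if "z \<in> A" for z using that A(2) by blast
  consider "a \<in> A" "b \<in> A" "c \<in> A" "d \<in> A" | "a \<in> A" "b \<in> A" "c \<in> A" "d \<notin> A"
    | "a \<in> A" "b \<in> A" "c \<notin> A" "d \<in> A" | "a \<in> A" "b \<notin> A" "c \<in> A" "d \<in> A"
    | "a \<notin> A" "b \<in> A" "c \<in> A" "d \<in> A"
    using survives collapse4_quads_iff[OF q, of c0 A] c0 by blast
  then show ?thesis
  proof cases
    case 1
    then show ?thesis by (simp add: collapse4_def collapse_def)
  next
    case 2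
    then show ?thesis using rep[of a b c d] qA by (simp add: collapse4_def collapse_def)
  next
    case 3
    have "x (a, b, z, d) = x (b, a, d, z)" if "z \<in> Z - A" for z
      using that 3 qA inA cr_reverse[OF sys, of b a d z] by (auto simp: quads_iff)
    then show ?thesis using rep[of b a d c] 3 qA c0 by (auto simp: collapse4_def collapse_def)
  next
    case 4
    have "x (a, z, c, d) = x (c, d, a, z)" if "z \<in> Z - A" for z
      using that 4 qA inA cr_sym[OF sys, of c d a z] by (auto simp: quads_iff)
    then show ?thesis using rep[of c d a b] 4 qA c0 by (auto simp: collapse4_def collapse_def)
  next
    case 5
    have "x (z, b, c, d) = x (d, c, b, z)" if "z \<in> Z - A" for z
    proof -
      have "(c, d, z, b) \<in> quads Z" using that 5 qA inA by (auto simp: quads_iff)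
      then show ?thesis using cr_sym[OF sys, of c d z b] cr_reverse[OF sys, of c d z b] by simp
    qed
    then show ?thesis using rep[of d c b a] 5 qA c0 by (auto simp: collapse4_def collapse_def)
  qed
qed

lemma graft_of_split:
  assumes sys: "cr_system Z x" and A: "splits Z x A" "A \<subseteq> Z" and a0: "a0 \<in> A" and c0: "c0 \<in> Z - A"
  shows "x = graft Z A a0 c0 (restrict x (quads (insert c0 A))) (restrict x (quads (insert a0 (Z - A))))"
    (is "x = ?g")
proof
  fix q
  have compl: "splits Z x (Z - A)" "Z - A \<subseteq> Z" "a0 \<in> Z - (Z - A)"
    using splits_complement[OF sys A] a0 A(2) by auto
  show "x q = ?g q"
  proof (cases "q \<in> quads Z")
    case False
    have "x \<in> quads Z \<rightarrow>\<^sub>E UNIV" using sys unfolding cr_system_def by blast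
    then show ?thesis using PiE_arb[OF _ False] False unfolding graft_def by fastforce
  next
    case True
    obtain a b c d where q: "q = (a, b, c, d)" by (cases q)
    have Q: "(a, b, c, d) \<in> quads Z" using True q by simp
    consider (1) "survives A c0 (a, b, c, d)"
      | (2) "\<not> survives A c0 (a, b, c, d)"
        "survives (Z - A) a0 (a, b, c, d)"
      | (3) "\<not> survives A c0 (a, b, c, d)"
        "\<not> survives (Z - A) a0 (a, b, c, d)" by blast
    then show ?thesis
    proof cases
      case 1
      then show ?thesis using split_collapse[OF sys A c0 Q 1] Q q by (simp add: graft_def graft_by.simps)
    next
      case 2
      then show ?thesis using split_collapse[OF sys compl Q 2(2)] Q q
        by (simp add: graft_def graft_by.simps)
    next
      case 3
      have m: "a \<in> Z" "b \<in> Z" "c \<in> Z" "d \<in> Z" using Q by (auto simp: quads_iff)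
      have Q': "(a, c, b, d) \<in> quads Z" "(a, d, b, c) \<in> quads Z" using Q by (auto simp: quads_iff)
      consider "a \<in> A" "b \<in> A" "c \<notin> A" "d \<notin> A" | "a \<notin> A" "b \<notin> A" "c \<in> A" "d \<in> A"
        | "a \<in> A" "c \<in> A" "b \<notin> A" "d \<notin> A" | "a \<notin> A" "c \<notin> A" "b \<in> A" "d \<in> A"
        | "a \<in> A" "d \<in> A" "b \<notin> A" "c \<notin> A" | "a \<notin> A" "d \<notin> A" "b \<in> A" "c \<in> A"
        using collapse4_quads_iff[OF Q, of c0 A] collapse4_quads_iff[OF Q, of a0 "Z - A"] 3 a0 c0 m by auto
      then have "x (a, b, c, d) = (if (a \<in> A) = (b \<in> A) then Fin 1 else if (a \<in> A) = (c \<in> A) then Fin 0 else Infty)"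
      proof cases
        case 1
        then show ?thesis using A Q by (auto simp: splits_def quads_iff)
      next
        case 2
        then show ?thesis using compl Q by (auto simp: splits_def quads_iff)
      next
        case 3
        then show ?thesis using A Q cr_zero_iff_one[OF sys Q'(1)] by (auto simp: splits_def quads_iff)
      next
        case 4
        then show ?thesis using compl Q cr_zero_iff_one[OF sys Q'(1)] by (auto simp: splits_def quads_iff)
      next
        case 5
        then show ?thesis using A Q cr_infty_iff_one[OF sys Q] by (auto simp: splits_def quads_iff)
      next
        case 6
        then show ?thesis using compl Q cr_infty_iff_one[OF sys Q] by (auto simp: splits_def quads_iff)
      qed
      then show ?thesis using 3 Q q by (simp add: graft_def graft_by.simps)
    qed
  qed
qed

section \<open>Every system of cross-ratios is a limit of configurations\<close>

lemma linear_form_value: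
  fixes v :: "'k::field \<times> 'k"
  assumes "fst v \<noteq> 0 \<or> snd v \<noteq> 0"
  obtains l1 l2 where "l1 * fst v + l2 * snd v = s"
proof (cases "fst v = 0")
  case True
  then show ?thesis using assms that[of 0 "s / snd v"] by simp
next
  case False
  then show ?thesis using that[of "s / fst v" 0] by simp
qed

text \<open>
  The limit is taken along an explicit family.  In suitable coordinates \<open>c0\<close> is the point at infinity
  of the first line and \<open>a0\<close> the origin of the second; the points \<open>i\<close> of \<open>A\<close>, at \<open>\<alpha> i / \<beta> i\<close> on the first
  line, are put at \<open>t * \<alpha> i / \<beta> i\<close> on the second, and contract to \<open>a0\<close> as \<open>t\<close> tends to 0.  The determinant
  of the points \<open>i\<close> and \<open>j\<close> is \<open>t ^ n i j * B i j\<close> with \<open>B i j\<close> nonzero at \<open>t = 0\<close>, so the limits of the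
  cross-ratios are obtained by cancelling the common power of \<open>t\<close>.
\<close>

lemma graft_of_configs_in_closure:
  fixes y w :: "'z \<Rightarrow> 'k::alg_closed_field \<times> 'k"
  assumes fin: "finite Z" and A: "A \<subseteq> Z" and a0: "a0 \<in> A" and c0: "c0 \<in> Z - A"
    and y: "config (insert c0 A) y" and w: "config (insert a0 (Z - A)) w"
  shows "in_closure (quads Z) (open_part Z)
    (graft Z A a0 c0 (cr_of (insert c0 A) y) (cr_of (insert a0 (Z - A)) w))"
proof -
  have "det2 (y a0) (y c0) \<noteq> 0" "det2 (w c0) (w a0) \<noteq> 0"
    using y w a0 c0 by (auto simp: config_def)
  then have "fst (y c0) \<noteq> 0 \<or> snd (y c0) \<noteq> 0" "fst (w a0) \<noteq> 0 \<or> snd (w a0) \<noteq> 0"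
    by (auto simp: det2_def)
  then obtain l1 l2 m1 m2 where l: "l1 * fst (y c0) + l2 * snd (y c0) = 1"
    and m: "m1 * fst (w a0) + m2 * snd (w a0) = -1"
    using linear_form_value by metis
  define \<alpha> \<beta> where "\<alpha> i = l1 * fst (y i) + l2 * snd (y i)" and "\<beta> i = det2 (y c0) (y i)" for i
  define \<gamma> \<delta> where "\<gamma> i = det2 (w a0) (w i)" and "\<delta> i = m1 * fst (w i) + m2 * snd (w i)" for i
  have \<beta>: "\<beta> i \<noteq> 0" if "i \<in> A" for i
    using y that c0 by (auto simp: \<beta>_def config_def)
  have \<gamma>: "\<gamma> i \<noteq> 0" if "i \<in> Z - A" for i
    using w that a0 by (auto simp: \<gamma>_def config_def)
  have det_y: "\<alpha> i * \<beta> j - \<beta> i * \<alpha> j = det2 (y i) (y j)" for i j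
  proof -
    have "\<alpha> i * \<beta> j - \<beta> i * \<alpha> j = (l1 * fst (y c0) + l2 * snd (y c0)) * det2 (y i) (y j)"
      by (simp add: \<alpha>_def \<beta>_def det2_def algebra_simps)
    then show ?thesis by (simp add: l)
  qed
  have det_w: "\<gamma> i * \<delta> j - \<delta> i * \<gamma> j = det2 (w i) (w j)" for i j
  proof -
    have "\<gamma> i * \<delta> j - \<delta> i * \<gamma> j = - (m1 * fst (w a0) + m2 * snd (w a0)) * det2 (w i) (w j)"
      by (simp add: \<gamma>_def \<delta>_def det2_def algebra_simps)
    then show ?thesis by (simp add: m)
  qed
  define z where "z t i = (if i \<in> A then (t * \<alpha> i, \<beta> i) else (\<gamma> i, \<delta> i))" for t i
  define n :: "'z \<Rightarrow> 'z \<Rightarrow> nat" where "n i j = (if i \<in> A \<and> j \<in> A then 1 else 0)" for i j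
  define B where "B i j = (if i \<in> A then if j \<in> A then [:det2 (y i) (y j):] else [:- \<beta> i * \<gamma> j, \<alpha> i * \<delta> j:]
      else if j \<in> A then [:\<beta> j * \<gamma> i, - \<alpha> j * \<delta> i:] else [:det2 (w i) (w j):])" for i j
  have det_z: "det2 (z t i) (z t j) = t ^ n i j * poly (B i j) t" for t i j
    unfolding det2_def[of "z t i"]
    by (auto simp: z_def n_def B_def det_y[symmetric] det_w[symmetric] algebra_simps)
  define b where "b i j = poly (B i j) 0" for i j
  have b_nz: "b i j \<noteq> 0" if "i \<in> Z" "j \<in> Z" "i \<noteq> j" for i j
    using that \<beta> \<gamma> y w by (auto simp: b_def B_def config_def)
  \<comment> \<open>Truncated subtraction in the exponents leaves no common power of the parameter.\<close>
  define \<sigma> \<rho> where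
    "\<sigma> = (\<lambda>(a, b, c, d). monom 1 (n a c + n b d - (n a d + n b c)) * B a c * B b d)" and
    "\<rho> = (\<lambda>(a, b, c, d). monom 1 (n a d + n b c - (n a c + n b d)) * B a d * B b c)"
  define bad where "bad = insert 0 (\<Union>i\<in>Z. \<Union>j\<in>Z - {i}. {t. poly (B i j) t = 0})"
  have bad: "finite bad"
  proof -
    have "finite {t. poly (B i j) t = 0}" if "i \<in> Z" "j \<in> Z - {i}" for i j
      using b_nz[of i j] that by (intro poly_roots_finite) (auto simp: b_def)
    then show ?thesis unfolding bad_def using fin by blast
  qed
  have generic: "\<exists>m\<in>open_part Z. \<forall>q\<in>quads Z. (poly (\<sigma> q) t \<noteq> 0 \<or> poly (\<rho> q) t \<noteq> 0) \<and>
      m q = ratio (poly (\<sigma> q) t) (poly (\<rho> q) t)" if t: "t \<notin> bad" for t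
  proof (intro bexI ballI conjI)
    have t0: "t \<noteq> 0" using t by (auto simp: bad_def)
    have nz: "poly (B i j) t \<noteq> 0" if "i \<in> Z" "j \<in> Z" "i \<noteq> j" for i j
      using t that by (auto simp: bad_def)
    show "cr_of Z (z t) \<in> open_part Z"
      unfolding open_part_def using nz t0 by (auto simp: config_def det_z)
    fix q assume "q \<in> quads Z"
    moreover obtain a1 a2 a3 a4 where q: "q = (a1, a2, a3, a4)" by (cases q)
    ultimately have Q: "(a1, a2, a3, a4) \<in> quads Z" by simp
    show "poly (\<sigma> q) t \<noteq> 0 \<or> poly (\<rho> q) t \<noteq> 0"
      using nz Q t0 by (auto simp: \<sigma>_def q quads_iff poly_monom)
    let ?N = "n a1 a3 + n a2 a4" and ?M = "n a1 a4 + n a2 a3"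
    have "t ^ ?N = t ^ min ?N ?M * t ^ (?N - ?M)" "t ^ ?M = t ^ min ?N ?M * t ^ (?M - ?N)"
      unfolding power_add[symmetric] by (rule arg_cong[of _ _ "(^) t"]; linarith)+
    then have "det2 (z t a1) (z t a3) * det2 (z t a2) (z t a4) = t ^ min ?N ?M * poly (\<sigma> q) t"
      "det2 (z t a1) (z t a4) * det2 (z t a2) (z t a3) = t ^ min ?N ?M * poly (\<rho> q) t"
      by (simp_all add: det_z \<sigma>_def \<rho>_def q poly_monom power_add[symmetric] mult_ac)
    then have "vcr (z t a1) (z t a2) (z t a3) (z t a4) = ratio (poly (\<sigma> q) t) (poly (\<rho> q) t)"
      using t0 by (simp add: vcr_def ratio_scale)
    then show "cr_of Z (z t) q = ratio (poly (\<sigma> q) t) (poly (\<rho> q) t)"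
      using Q q by (simp add: cr_of_def)
  qed
  let ?x1 = "cr_of (insert c0 A) y" and ?x2 = "cr_of (insert a0 (Z - A)) w"
  have special: "(poly (\<sigma> q) 0 \<noteq> 0 \<or> poly (\<rho> q) 0 \<noteq> 0) \<and>
      graft Z A a0 c0 ?x1 ?x2 q = ratio (poly (\<sigma> q) 0) (poly (\<rho> q) 0)" if "q \<in> quads Z" for q
  proof -
    obtain a1 a2 a3 a4 where q: "q = (a1, a2, a3, a4)" by (cases q)
    then have Q: "(a1, a2, a3, a4) \<in> quads Z" using that by simp
    then have m: "a1 \<in> Z" "a2 \<in> Z" "a3 \<in> Z" "a4 \<in> Z" by (auto simp: quads_iff)
    have nz: "b a1 a3 \<noteq> 0" "b a1 a4 \<noteq> 0" "b a2 a3 \<noteq> 0" "b a2 a4 \<noteq> 0"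
      using Q b_nz by (auto simp: quads_iff)
    have \<sigma>0: "poly (\<sigma> q) 0 = (if n a1 a3 + n a2 a4 \<le> n a1 a4 + n a2 a3 then b a1 a3 * b a2 a4 else 0)"
      and \<rho>0: "poly (\<rho> q) 0 = (if n a1 a4 + n a2 a3 \<le> n a1 a3 + n a2 a4 then b a1 a4 * b a2 a3 else 0)"
      by (auto simp: \<sigma>_def \<rho>_def q b_def poly_monom power_0_left)
    have 1: "poly (\<sigma> q) 0 \<noteq> 0 \<or> poly (\<rho> q) 0 \<noteq> 0"
      using nz unfolding \<sigma>0 \<rho>0 by auto
    have survive: "ratio (poly (\<sigma> q) 0) (poly (\<rho> q) 0) = vcr (s a1) (s a2) (s a3) (s a4)"
      if n_eq: "n a1 a3 + n a2 a4 = n a1 a4 + n a2 a3" and g: "\<And>i. i \<in> Z \<Longrightarrow> g i \<noteq> 0"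
        and b: "\<And>i j. (i, j) \<in> {(a1, a3), (a2, a4), (a1, a4), (a2, a3)} \<Longrightarrow>
          b i j = det2 (s i) (s j) * (g i * g j)" for s and g :: "'z \<Rightarrow> 'k"
    proof -
      define G where "G = g a1 * g a2 * g a3 * g a4"
      have "G \<noteq> 0" using g m by (simp add: G_def)
      moreover have "b a1 a3 * b a2 a4 = G * (det2 (s a1) (s a3) * det2 (s a2) (s a4))"
        "b a1 a4 * b a2 a3 = G * (det2 (s a1) (s a4) * det2 (s a2) (s a3))"
        by (simp_all add: b G_def mult_ac)
      ultimately show ?thesis
        unfolding \<sigma>0 \<rho>0 n_eq vcr_def using ratio_scale by auto
    qed
    let ?f1 = "collapse A c0" and ?f2 = "collapse (Z - A) a0"
    consider (in1) "survives A c0 q"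
      | (in2) "\<not> survives A c0 q" "survives (Z - A) a0 q"
      | (none) "\<not> survives A c0 q" "\<not> survives (Z - A) a0 q"
      by blast
    then have "graft_by Z A a0 c0 (Fin 1, Fin 0, Infty) ?x1 ?x2 q = ratio (poly (\<sigma> q) 0) (poly (\<rho> q) 0)"
    proof cases
      case in1
      define g where "g i = (if i \<in> A then 1 else \<gamma> i)" for i
      have b: "b i j = det2 (y (?f1 i)) (y (?f1 j)) * (g i * g j)" if "i \<in> A \<or> j \<in> A" for i j
      proof -
        have "det2 (y k) (y c0) = - \<beta> k" "det2 (y c0) (y k) = \<beta> k" for k
          by (simp_all add: \<beta>_def det2_def)
        then show ?thesis using that by (auto simp: b_def B_def collapse_def g_def)
      qed
      have three: "(a1 \<in> A \<and> a2 \<in> A \<and> a3 \<in> A) \<or> (a1 \<in> A \<and> a2 \<in> A \<and> a4 \<in> A) \<or>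
          (a1 \<in> A \<and> a3 \<in> A \<and> a4 \<in> A) \<or> (a2 \<in> A \<and> a3 \<in> A \<and> a4 \<in> A)"
        using in1 collapse4_quads_iff[OF Q, of c0 A] c0 q by auto
      then have n_eq: "n a1 a3 + n a2 a4 = n a1 a4 + n a2 a3"
        by (auto simp: n_def)
      have "ratio (poly (\<sigma> q) 0) (poly (\<rho> q) 0) =
          vcr (y (?f1 a1)) (y (?f1 a2)) (y (?f1 a3)) (y (?f1 a4))"
        by (rule survive[of g "\<lambda>i. y (?f1 i)", OF n_eq])
          (use \<gamma> in \<open>simp add: g_def\<close>, rule b, use three in auto)
      then show ?thesis using in1 q by (simp add: graft_by.simps collapse4_def cr_of_def)
    next
      case in2
      define g where "g i = (if i \<in> A then - \<beta> i else 1)" for i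
      have b: "b i j = det2 (w (?f2 i)) (w (?f2 j)) * (g i * g j)"
        if "i \<in> Z" "j \<in> Z" "i \<notin> A \<or> j \<notin> A" for i j
      proof -
        have "det2 (w k) (w a0) = - \<gamma> k" "det2 (w a0) (w k) = \<gamma> k" for k
          by (simp_all add: \<gamma>_def det2_def)
        then show ?thesis using that by (auto simp: b_def B_def collapse_def g_def)
      qed
      have three: "(a1 \<notin> A \<and> a2 \<notin> A \<and> a3 \<notin> A) \<or> (a1 \<notin> A \<and> a2 \<notin> A \<and> a4 \<notin> A) \<or>
          (a1 \<notin> A \<and> a3 \<notin> A \<and> a4 \<notin> A) \<or> (a2 \<notin> A \<and> a3 \<notin> A \<and> a4 \<notin> A)"
        using in2(2) collapse4_quads_iff[OF Q, of a0 "Z - A"] a0 q by auto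
      then have n_eq: "n a1 a3 + n a2 a4 = n a1 a4 + n a2 a3"
        by (auto simp: n_def)
      have "ratio (poly (\<sigma> q) 0) (poly (\<rho> q) 0) =
          vcr (w (?f2 a1)) (w (?f2 a2)) (w (?f2 a3)) (w (?f2 a4))"
        by (rule survive[of g "\<lambda>i. w (?f2 i)", OF n_eq])
          (use \<beta> in \<open>simp add: g_def\<close>, rule b, use three m in auto)
      then show ?thesis using in2 q by (simp add: graft_by.simps collapse4_def cr_of_def)
    next
      case none
      have val: "graft_by Z A a0 c0 (Fin 1, Fin 0, Infty) ?x1 ?x2 q =
          (if (a1 \<in> A) = (a2 \<in> A) then Fin 1 else if (a1 \<in> A) = (a3 \<in> A) then Fin 0 else Infty)"
        using none q by (simp add: graft_by.simps)
      have b_mixed: "b i j = (if i \<in> A then - \<beta> i * \<gamma> j else \<beta> j * \<gamma> i)" if "(i \<in> A) \<noteq> (j \<in> A)" for i j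
        using that by (auto simp: b_def B_def)
      consider "(a1 \<in> A) = (a2 \<in> A)" "(a3 \<in> A) = (a4 \<in> A)" "(a1 \<in> A) \<noteq> (a3 \<in> A)"
        | "(a1 \<in> A) = (a3 \<in> A)" "(a2 \<in> A) = (a4 \<in> A)" "(a1 \<in> A) \<noteq> (a2 \<in> A)"
        | "(a1 \<in> A) = (a4 \<in> A)" "(a2 \<in> A) = (a3 \<in> A)" "(a1 \<in> A) \<noteq> (a2 \<in> A)"
      proof -
        have "\<not> (a1 \<in> A \<and> a2 \<in> A \<and> a3 \<in> A)" "\<not> (a1 \<in> A \<and> a2 \<in> A \<and> a4 \<in> A)"
          "\<not> (a1 \<in> A \<and> a3 \<in> A \<and> a4 \<in> A)" "\<not> (a2 \<in> A \<and> a3 \<in> A \<and> a4 \<in> A)"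
          using none(1) collapse4_quads_iff[OF Q, of c0 A] c0 q by auto
        moreover have "a1 \<in> A \<or> a2 \<in> A \<or> a3 \<in> A" "a1 \<in> A \<or> a2 \<in> A \<or> a4 \<in> A"
          "a1 \<in> A \<or> a3 \<in> A \<or> a4 \<in> A" "a2 \<in> A \<or> a3 \<in> A \<or> a4 \<in> A"
          using none(2) collapse4_quads_iff[OF Q, of a0 "Z - A"] a0 q m by auto
        ultimately show ?thesis
          using that by (cases "a1 \<in> A"; cases "a2 \<in> A"; cases "a3 \<in> A") simp_all
      qed
      then show ?thesis
      proof cases
        case 1
        then have "b a1 a3 * b a2 a4 = b a1 a4 * b a2 a3"
          by (cases "a1 \<in> A") (auto simp: b_mixed mult_ac)
        moreover have "n a1 a3 + n a2 a4 = n a1 a4 + n a2 a3" using 1 by (auto simp: n_def)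
        ultimately have "ratio (poly (\<sigma> q) 0) (poly (\<rho> q) 0) = Fin 1"
          using nz unfolding \<sigma>0 \<rho>0 by (simp add: ratio_def)
        then show ?thesis using 1 val by simp
      next
        case 2
        then have "n a1 a4 + n a2 a3 < n a1 a3 + n a2 a4" by (auto simp: n_def)
        then have "ratio (poly (\<sigma> q) 0) (poly (\<rho> q) 0) = Fin 0"
          using nz unfolding \<sigma>0 \<rho>0 by (simp add: ratio_def)
        then show ?thesis using 2 val by auto
      next
        case 3
        then have "n a1 a3 + n a2 a4 < n a1 a4 + n a2 a3" by (auto simp: n_def)
        then have "ratio (poly (\<sigma> q) 0) (poly (\<rho> q) 0) = Infty"
          using nz unfolding \<sigma>0 \<rho>0 by (simp add: ratio_def)
        then show ?thesis using 3 val by auto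
      qed
    qed
    then show ?thesis using 1 that by (simp add: graft_def)
  qed
  have "graft Z A a0 c0 ?x1 ?x2 = (\<lambda>q\<in>quads Z. ratio (poly (\<sigma> q) 0) (poly (\<rho> q) 0))"
    using special by (auto simp: fun_eq_iff) (simp add: graft_def)
  then show ?thesis
    using special by (intro in_closure_limit[OF finite_quads[OF fin] bad generic, where ?t0.0 = 0]) auto
qed

lemma indexes_divisor_quartet:
  assumes "finite Z" "(a, b, c, d) \<in> quads Z" "E \<subseteq> Z" "a \<in> E" "b \<in> E" "c \<notin> E" "d \<notin> E"
  shows "indexes_divisor Z E"
proof -
  have q: "a \<noteq> b" "c \<noteq> d" "{c, d} \<subseteq> Z - E" using assms by (auto simp: quads_iff)
  have fin: "finite E" using assms(1,3) finite_subset by blast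
  have "2 \<le> card E"
    using card_mono[of E "{a, b}"] q(1) assms fin by auto
  moreover have "2 \<le> card (Z - E)"
    using card_mono[OF _ q(3)] q(2) assms(1) by auto
  moreover have "card (Z - E) = card Z - card E"
    using assms(3) fin by (intro card_Diff_subset)
  ultimately show ?thesis
    using assms(3) by (auto simp: indexes_divisor_def)
qed

text \<open>
  The induction on the number of marked points cuts along a split: both parts are smaller, and with
  three points each of them still carries a stable curve.
\<close>

lemma indexes_divisor_cut:
  assumes "finite Z" "indexes_divisor Z A"
  obtains a0 c0 where "a0 \<in> A" "c0 \<in> Z - A" "insert c0 A \<subseteq> Z" "insert a0 (Z - A) \<subseteq> Z"
    "card (insert c0 A) < card Z" "card (insert a0 (Z - A)) < card Z"
    "3 \<le> card (insert c0 A)" "3 \<le> card (insert a0 (Z - A))"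
proof -
  have A: "A \<subseteq> Z" "2 \<le> card A" "card A + 2 \<le> card Z" using assms(2) by (auto simp: indexes_divisor_def)
  have finA: "finite A" using A assms(1) finite_subset by blast
  have cA: "card (Z - A) = card Z - card A" using A finA by (intro card_Diff_subset)
  have "A \<noteq> {}" "Z - A \<noteq> {}" using A cA by auto
  then obtain a0 c0 where ac: "a0 \<in> A" "c0 \<in> Z - A" by blast
  have "card (insert c0 A) = card A + 1" "card (insert a0 (Z - A)) = card Z - card A + 1"
    using ac finA assms(1) cA by auto
  then show ?thesis using A ac by (intro that[OF ac]) auto
qed

theorem cr_system_in_closure:
  fixes x :: "'z quad \<Rightarrow> 'k::alg_closed_field pline"
  assumes "finite Z" "3 \<le> card Z" "cr_system Z x"
  shows "in_closure (quads Z) (open_part Z) x"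
  using assms
proof (induction "card Z" arbitrary: Z x rule: less_induct)
  case less
  show ?case
  proof (cases "\<forall>q\<in>quads Z. x q \<noteq> Fin 1")
    case True
    then obtain u where "config Z u" "x = cr_of Z u"
      using nondegenerate_system_is_config[OF less.prems(3,2)] by blast
    then have "x \<in> open_part Z" by (auto simp: open_part_def)
    moreover have "x \<in> quads Z \<rightarrow>\<^sub>E UNIV" using less.prems(3) unfolding cr_system_def by blast
    ultimately show ?thesis by (auto simp: in_closure_def)
  next
    case False
    then obtain a b c d where Q: "(a, b, c, d) \<in> quads Z" "x (a, b, c, d) = Fin 1"
      by (metis surj_pair)
    obtain A where A: "A \<subseteq> Z" "a \<in> A" "b \<in> A" "c \<notin> A" "d \<notin> A" "splits Z x A"
      by (rule quartet_extends_to_split[OF less.prems(3) Q])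
    obtain a0 c0 where ac: "a0 \<in> A" "c0 \<in> Z - A" "insert c0 A \<subseteq> Z" "insert a0 (Z - A) \<subseteq> Z"
      "card (insert c0 A) < card Z" "card (insert a0 (Z - A)) < card Z"
      "3 \<le> card (insert c0 A)" "3 \<le> card (insert a0 (Z - A))"
      using indexes_divisor_cut[OF less.prems(1) indexes_divisor_quartet[OF less.prems(1) Q(1) A(1-5)]] .
    let ?x1 = "restrict x (quads (insert c0 A))" and ?x2 = "restrict x (quads (insert a0 (Z - A)))"
    have fin: "finite (insert c0 A)" "finite (insert a0 (Z - A))"
      using less.prems(1) A(1) finite_subset by auto
    have "in_closure (quads (insert c0 A)) (open_part (insert c0 A)) ?x1"
      using less.hyps[OF ac(5) fin(1) ac(7)] cr_system_restrict[OF less.prems(3) ac(3)] .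
    moreover have "in_closure (quads (insert a0 (Z - A))) (open_part (insert a0 (Z - A))) ?x2"
      using less.hyps[OF ac(6) fin(2) ac(8)] cr_system_restrict[OF less.prems(3) ac(4)] .
    moreover have "in_closure (quads Z) (open_part Z) (graft Z A a0 c0 p1 p2)"
      if "p1 \<in> open_part (insert c0 A)" "p2 \<in> open_part (insert a0 (Z - A))"
      for p1 p2 :: "'z quad \<Rightarrow> 'k pline"
      using graft_of_configs_in_closure[OF less.prems(1) A(1) ac(1,2)] that
      by (auto simp: open_part_def)
    ultimately have "in_closure (quads Z) (open_part Z) (graft Z A a0 c0 ?x1 ?x2)"
      by (rule in_closure_graft[OF less.prems(1)])
    from back_subst[of "in_closure (quads Z) (open_part Z)",
        OF this graft_of_split[OF less.prems(3) A(6,1) ac(1,2), symmetric]]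
    show ?thesis .
  qed
qed

section \<open>Dual trees\<close>

lemma joined_sym: "(v, w) \<in> joined N \<Longrightarrow> (w, v) \<in> joined N"
  unfolding joined_def by (auto simp: insert_commute)

lemma joined_mono: "N \<subseteq> N' \<Longrightarrow> joined N \<subseteq> joined N'"
  unfolding joined_def by blast

abbreviation linked :: "(nat \<times> 'k pline) set set \<Rightarrow> nat \<Rightarrow> nat \<Rightarrow> bool" where
  "linked N v w \<equiv> (v, w) \<in> (joined N)\<^sup>*"

lemma connected_sym: "linked N v w \<Longrightarrow> linked N w v"
  by (induction rule: rtrancl_induct) (auto intro: converse_rtrancl_into_rtrancl joined_sym)

lemma connected_mono: "linked N v w \<Longrightarrow> N \<subseteq> N' \<Longrightarrow> (v, w) \<in> (joined N')\<^sup>*"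
  using rtrancl_mono[OF joined_mono] by blast

lemma connected_edge: "{(v, p), (w, q)} \<in> N \<Longrightarrow> linked N v w"
  unfolding joined_def by blast

lemma joined_other_edge:
  "{(v, p), (w, q)} \<in> N \<Longrightarrow> {(v, p), (w, q)} \<noteq> e \<Longrightarrow> (v, w) \<in> joined (N - {e})"
  unfolding joined_def by blast

lemma connected_other_edge:
  "{(v, p), (w, q)} \<in> N \<Longrightarrow> {(v, p), (w, q)} \<noteq> e \<Longrightarrow> linked (N - {e}) v w"
  by (rule r_into_rtrancl, rule joined_other_edge)

lemma rtrancl_crossing:
  assumes "(a, b) \<in> r\<^sup>*" "a \<in> S" "b \<notin> S"
  obtains s s' where "(s, s') \<in> r" "s \<in> S" "s' \<notin> S"
  using assms by (induction rule: rtrancl_induct) blast+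

text \<open>
  Growing a connected part from a single component uses up a new node for every new component.
\<close>

lemma connected_card_le:
  assumes "finite V" "finite N" and N: "\<And>e. e \<in> N \<Longrightarrow> fst ` e \<subseteq> V"
    and conn: "\<And>v w. v \<in> V \<Longrightarrow> w \<in> V \<Longrightarrow> linked N v w"
  shows "card V \<le> card N + 1"
proof -
  have grow: "\<exists>S T. S \<subseteq> V \<and> T \<subseteq> N \<and> card S = Suc k \<and> card T = k \<and> (\<forall>e\<in>T. fst ` e \<subseteq> S)"
    if "k < card V" for k
    using that
  proof (induction k)
    case 0
    then obtain v where "v \<in> V" by fastforce
    then show ?case by (intro exI[of _ "{v}"] exI[of _ "{}"]) auto
  next
    case (Suc k)
    then obtain S T where ST: "S \<subseteq> V" "T \<subseteq> N" "card S = Suc k" "card T = k" "\<forall>e\<in>T. fst ` e \<subseteq> S"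
      by auto
    have "S \<noteq> V" "S \<noteq> {}" using ST Suc.prems by auto
    then obtain a b where "a \<in> S" "b \<in> V" "b \<notin> S" using ST(1) by blast
    then have ab: "linked N a b" "a \<in> S" "b \<notin> S" using conn ST(1) by blast+
    obtain s s' where s: "(s, s') \<in> joined N" "s \<in> S" "s' \<notin> S"
      by (rule rtrancl_crossing[OF ab])
    then obtain p q where e: "{(s, p), (s', q)} \<in> N" by (auto simp: joined_def)
    have "{(s, p), (s', q)} \<notin> T" using ST(5) s(3) by fastforce
    moreover have "finite S" "finite T" using ST assms(1,2) finite_subset by auto
    moreover have "\<forall>e\<in>insert {(s, p), (s', q)} T. fst ` e \<subseteq> insert s' S"
    proof
      fix e' assume "e' \<in> insert {(s, p), (s', q)} T"
      then consider "e' = {(s, p), (s', q)}" | "e' \<in> T" by blast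
      then show "fst ` e' \<subseteq> insert s' S"
      proof cases
        case 1
        then show ?thesis using s(2) by simp
      next
        case 2
        then show ?thesis using ST(5) by (meson subset_insertI2)
      qed
    qed
    moreover have "s' \<in> V" using N[OF e] by auto
    ultimately show ?case
      using ST s e
      by (intro exI[of _ "insert s' S"] exI[of _ "insert {(s, p), (s', q)} T"] conjI) auto
  qed
  show ?thesis
  proof (cases "card V")
    case (Suc k)
    then obtain T where "T \<subseteq> N" "card T = k" using grow[of k] by auto
    then show ?thesis using Suc card_mono[OF assms(2)] by auto
  qed simp
qed

locale node_tree =
  fixes V :: "nat set" and M :: "(nat \<times> 'k pline) set set"
  assumes finite_V: "finite V" and finite_M: "finite M"
    and node_card: "\<And>e. e \<in> M \<Longrightarrow> card e = 2" and node_V: "\<And>e. e \<in> M \<Longrightarrow> fst ` e \<subseteq> V"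
    and nodes_disjnt: "pairwise disjnt M"
    and conn: "\<And>v w. v \<in> V \<Longrightarrow> w \<in> V \<Longrightarrow> linked M v w"
    and count: "card V = card M + 1"
begin

text \<open>
  Otherwise the curve would stay connected without the node, with too few nodes for its components.
\<close>

lemma bridge:
  assumes e: "{(v, p), (w, q)} \<in> M"
  shows "\<not> linked (M - {{(v, p), (w, q)}}) v w"
proof
  let ?N = "M - {{(v, p), (w, q)}}"
  assume vw: "linked ?N v w"
  have "joined M \<subseteq> (joined ?N)\<^sup>*"
  proof (intro subrelI)
    fix a b assume "(a, b) \<in> joined M"
    then obtain r s where rs: "{(a, r), (b, s)} \<in> M" by (auto simp: joined_def)
    show "linked ?N a b"
    proof (cases "{(a, r), (b, s)} = {(v, p), (w, q)}")
      case True
      then have "(a = v \<and> b = w) \<or> (a = w \<and> b = v)" by (auto simp: doubleton_eq_iff)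
      then show ?thesis using vw connected_sym[OF vw] by blast
    next
      case False
      then show ?thesis using rs by (intro connected_other_edge)
    qed
  qed
  then have "(joined M)\<^sup>* \<subseteq> (joined ?N)\<^sup>*"
    by (metis rtrancl_idemp rtrancl_mono)
  then have "card V \<le> card ?N + 1"
    using conn node_V by (intro connected_card_le finite_V finite_Diff finite_M) blast+
  moreover have "card ?N < card M" using e finite_M by (intro card_Diff1_less)
  ultimately show False using count by simp
qed

text \<open>
  \<open>toward v u p\<close>: the way from the component \<open>v\<close> to the component \<open>u\<close> leaves \<open>v\<close> at the point \<open>p\<close>.
\<close>

definition toward :: "nat \<Rightarrow> nat \<Rightarrow> 'k pline \<Rightarrow> bool" where
  "toward v u p \<longleftrightarrow>
     (\<exists>e\<in>M. \<exists>w q. e = {(v, p), (w, q)} \<and> linked (M - {e}) w u)"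

lemma node_ends:
  assumes "{(v, p), (w, q)} \<in> M"
  shows "v \<noteq> w" "v \<in> V" "w \<in> V"
  using bridge[OF assms] node_V[OF assms] by auto

lemma toward_edge:
  assumes "{(v, p), (w, q)} \<in> M"
  shows "toward v w p" "toward w v q"
proof -
  show "toward v w p" unfolding toward_def using assms by blast
  have "{(w, q), (v, p)} \<in> M" using assms by (simp add: insert_commute)
  then show "toward w v q" unfolding toward_def by blast
qed

lemma node_determined:
  assumes "{(v, p), (w, q)} \<in> M" "{(v, p), (w', q')} \<in> M"
  shows "w = w'" "q = q'"
proof -
  have eq: "{(v, p), (w, q)} = {(v, p), (w', q')}"
  proof (rule ccontr)
    assume "{(v, p), (w, q)} \<noteq> {(v, p), (w', q')}"
    then have "disjnt {(v, p), (w, q)} {(v, p), (w', q')}"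
      by (rule pairwiseD[OF nodes_disjnt assms])
    then show False by (simp add: disjnt_def)
  qed
  have "v \<noteq> w" "v \<noteq> w'" using node_ends(1) assms by auto
  then show "w = w'" "q = q'" using eq by (auto simp: doubleton_eq_iff)
qed

text \<open>
  Follow the path up to its first passage through the given node.
\<close>

lemma connected_avoiding:
  assumes "linked N a b"
  shows "linked (N - {{(x, p), (y, q)}}) a b \<or>
    linked (N - {{(x, p), (y, q)}}) a x \<or> linked (N - {{(x, p), (y, q)}}) a y"
  using assms
proof (induction rule: rtrancl_induct)
  case (step b c)
  let ?N = "N - {{(x, p), (y, q)}}"
  obtain r s where rs: "{(b, r), (c, s)} \<in> N" using step.hyps(2) by (auto simp: joined_def)
  show ?case
  proof (cases "{(b, r), (c, s)} = {(x, p), (y, q)}")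
    case True
    then have "b = x \<or> b = y" by (auto simp: doubleton_eq_iff)
    then show ?thesis using step.IH by blast
  next
    case False
    then have "(b, c) \<in> joined ?N" using rs by (intro joined_other_edge)
    then show ?thesis using step.IH by (meson rtrancl.rtrancl_into_rtrancl)
  qed
qed simp

lemma toward_self: "\<not> toward v v p"
  unfolding toward_def using bridge connected_sym by blast

text \<open>
  Two different exits towards \<open>u\<close> would lie on a cycle.
\<close>

lemma toward_unique:
  assumes "toward v u p" "toward v u p'"
  shows "p = p'"
proof -
  obtain w q where e: "{(v, p), (w, q)} \<in> M" "linked (M - {{(v, p), (w, q)}}) w u"
    using assms(1) by (auto simp: toward_def)
  obtain w' q' where e': "{(v, p'), (w', q')} \<in> M" "linked (M - {{(v, p'), (w', q')}}) w' u"
    using assms(2) by (auto simp: toward_def)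
  let ?e = "{(v, p), (w, q)}" and ?e' = "{(v, p'), (w', q')}"
  show ?thesis
  proof (cases "?e = ?e'")
    case True
    then show ?thesis using node_ends(1)[OF e(1)] node_ends(1)[OF e'(1)] by (auto simp: doubleton_eq_iff)
  next
    case False
    let ?N = "M - {?e'} - {?e}"
    have vw': "linked (M - {?e}) v w'"
      by (rule connected_other_edge[OF e'(1) not_sym[OF False]])
    consider "linked ?N w' u" | "linked ?N w' v" | "linked ?N w' w"
      using connected_avoiding[OF e'(2)] by blast
    then show ?thesis
    proof cases
      case 1
      then have "linked (M - {?e}) w' u" by (rule connected_mono) blast
      then have "linked (M - {?e}) v w"
        using vw' connected_sym[OF e(2)] by (meson rtrancl_trans)
      then show ?thesis using bridge[OF e(1)] by blast
    next
      case 2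
      then have "linked (M - {?e'}) w' v" by (rule connected_mono) blast
      then show ?thesis using bridge[OF e'(1)] connected_sym by blast
    next
      case 3
      then have "linked (M - {?e}) w' w" by (rule connected_mono) blast
      then have "linked (M - {?e}) v w" using vw' by (meson rtrancl_trans)
      then show ?thesis using bridge[OF e(1)] by blast
    qed
  qed
qed

lemma toward_exists:
  assumes "v \<in> V" "u \<in> V" "u \<noteq> v"
  shows "\<exists>p. toward v u p"
proof -
  have "linked M v u" using conn assms by blast
  then have "u = v \<or> (\<exists>p. toward v u p)"
  proof (induction rule: rtrancl_induct)
    case (step y u)
    obtain r s where rs: "{(y, r), (u, s)} \<in> M" using step.hyps(2) by (auto simp: joined_def)
    show ?case
    proof (cases "y = v")
      case True
      then show ?thesis using toward_edge(1)[OF rs] by blast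
    next
      case False
      then obtain p w q where e: "{(v, p), (w, q)} \<in> M" "linked (M - {{(v, p), (w, q)}}) w y"
        using step.IH by (auto simp: toward_def)
      show ?thesis
      proof (cases "{(y, r), (u, s)} = {(v, p), (w, q)}")
        case True
        then show ?thesis using False by (auto simp: doubleton_eq_iff)
      next
        case neq: False
        then have "linked (M - {{(v, p), (w, q)}}) y u"
          using rs by (intro connected_other_edge)
        then have "linked (M - {{(v, p), (w, q)}}) w u" using e(2) by (meson rtrancl_trans)
        then show ?thesis using e(1) unfolding toward_def by blast
      qed
    qed
  qed simp
  then show ?thesis using assms(3) by blast
qed

text \<open>
  If \<open>v\<close> sees \<open>m\<close> and \<open>u\<close> in different directions, the way from \<open>u\<close> to \<open>m\<close> passes through \<open>v\<close>: the way from
  \<open>v\<close> to \<open>m\<close> cannot meet \<open>u\<close>, or else \<open>v\<close> would see \<open>u\<close> in the direction of \<open>m\<close>.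
\<close>

lemma toward_opposite:
  assumes vu: "toward v u p" and uv: "toward u v p2" and vm: "m = v \<or> (toward v m p' \<and> p' \<noteq> p)"
  shows "toward u m p2"
proof (cases "m = v")
  case False
  then have vm: "toward v m p'" "p' \<noteq> p" using vm by auto
  obtain y q2 where f: "{(u, p2), (y, q2)} \<in> M" "linked (M - {{(u, p2), (y, q2)}}) y v"
    using uv by (auto simp: toward_def)
  obtain w' q' where e': "{(v, p'), (w', q')} \<in> M" "linked (M - {{(v, p'), (w', q')}}) w' m"
    using vm(1) by (auto simp: toward_def)
  let ?f = "{(u, p2), (y, q2)}" and ?e' = "{(v, p'), (w', q')}"
  have uv_ne: "u \<noteq> v" using vu toward_self by blast
  have not_u: "\<not> linked (M - {?e'}) w' u"
  proof
    assume "linked (M - {?e'}) w' u"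
    then have "toward v u p'" using e'(1) unfolding toward_def by blast
    then show False using vu toward_unique vm(2) by blast
  qed
  have ne: "?e' \<noteq> ?f"
  proof
    assume "?e' = ?f"
    then have "w' = u" using uv_ne by (auto simp: doubleton_eq_iff)
    then show False using not_u by blast
  qed
  let ?N = "M - {?e'} - {?f}"
  consider "linked ?N w' m" | "linked ?N w' u" | "linked ?N w' y"
    using connected_avoiding[OF e'(2)] by blast
  then show ?thesis
  proof cases
    case 1
    then have "linked (M - {?f}) w' m" by (rule connected_mono) blast
    moreover have "linked (M - {?f}) v w'"
      by (rule connected_other_edge[OF e'(1) ne])
    ultimately have "linked (M - {?f}) y m" using f(2) by (meson rtrancl_trans)
    then show ?thesis using f(1) unfolding toward_def by blast
  next
    case 2
    then have "linked (M - {?e'}) w' u" by (rule connected_mono) blast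
    then show ?thesis using not_u by blast
  next
    case 3
    then have "linked (M - {?e'}) w' y" by (rule connected_mono) blast
    moreover have "linked (M - {?e'}) u y"
      by (rule connected_other_edge[OF f(1) not_sym[OF ne]])
    ultimately have "linked (M - {?e'}) w' u"
      using connected_sym by (meson rtrancl_trans)
    then show ?thesis using not_u by blast
  qed
qed (use uv in simp)

lemma edge_sides:
  assumes e: "{(v, p), (w, q)} \<in> M" and m: "m \<in> V"
  shows "linked (M - {{(v, p), (w, q)}}) v m \<longleftrightarrow>
    \<not> linked (M - {{(v, p), (w, q)}}) w m"
proof -
  let ?N = "M - {{(v, p), (w, q)}}"
  have "linked ?N m v \<or> linked ?N m w"
    using connected_avoiding[OF conn[OF m node_ends(2)[OF e]], of v p w q] by blast
  moreover have "\<not> (linked ?N v m \<and> linked ?N w m)"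
    using bridge[OF e] connected_sym by (meson rtrancl_trans)
  ultimately show ?thesis using connected_sym by blast
qed

end

section \<open>Moduli points of stable curves\<close>

lemma det2_hcoords_zero_iff: "det2 (hcoords p) (hcoords q) = 0 \<longleftrightarrow> p = q"
  by (cases p; cases q) (auto simp: det2_def)

lemma generic4_hcoords:
  "generic4 (hcoords p1) (hcoords p2) (hcoords p3) (hcoords p4) \<longleftrightarrow>
    (p1 \<noteq> p3 \<and> p2 \<noteq> p4) \<or> (p1 \<noteq> p4 \<and> p2 \<noteq> p3)"
  by (simp add: generic4_def det2_hcoords_zero_iff)

lemma vcr_one_iff:
  assumes "generic4 u1 u2 u3 u4"
  shows "vcr u1 u2 u3 u4 = Fin 1 \<longleftrightarrow> det2 u1 u2 = 0 \<or> det2 u3 u4 = 0"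
proof -
  have "vcr u1 u2 u3 u4 = Fin 1 \<longleftrightarrow> det2 u1 u3 * det2 u2 u4 = det2 u1 u4 * det2 u2 u3"
    using assms by (auto simp: vcr_def ratio_def generic4_def)
  also have "\<dots> \<longleftrightarrow> det2 u1 u2 * det2 u3 u4 = 0"
    using det2_pluecker[of u1 u3 u2 u4] by (metis eq_iff_diff_eq_0)
  finally show ?thesis by simp
qed

locale stable_pointed =
  fixes Z :: "'z set" and C :: "('z, 'k::field) pointed_curve"
  assumes stable: "stable_curve Z C"
begin

sublocale node_tree "comps C" "nodes C"
  using stable unfolding stable_curve_def by unfold_locales auto

abbreviation host :: "'z \<Rightarrow> nat" where "host z \<equiv> fst (mark C z)"

lemma mark_props:
  assumes "z \<in> Z"
  shows "host z \<in> comps C" "mark C z \<notin> \<Union> (nodes C)"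
  using stable assms unfolding stable_curve_def by auto

lemma mark_inj: "y \<in> Z \<Longrightarrow> z \<in> Z \<Longrightarrow> mark C y = mark C z \<Longrightarrow> y = z"
  using stable unfolding stable_curve_def by (meson inj_onD)

definition sees :: "nat \<Rightarrow> 'z \<Rightarrow> 'k pline \<Rightarrow> bool" where
  "sees v z p \<longleftrightarrow> mark C z = (v, p) \<or> toward v (host z) p"

lemma sees_unique:
  assumes "sees v z p" "sees v z p'"
  shows "p = p'"
proof (cases "host z = v")
  case True
  then show ?thesis using assms toward_self by (auto simp: sees_def)
next
  case False
  then show ?thesis using assms toward_unique by (auto simp: sees_def)
qed

lemma sees_exists:
  assumes "v \<in> comps C" "z \<in> Z"
  shows "\<exists>p. sees v z p"
proof (cases "host z = v")
  case True
  then have "mark C z = (v, snd (mark C z))" by (metis prod.collapse)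
  then show ?thesis unfolding sees_def by blast
next
  case False
  then show ?thesis using toward_exists[OF assms(1) mark_props(1)[OF assms(2)]] by (auto simp: sees_def)
qed

abbreviation proj :: "nat \<Rightarrow> 'z \<Rightarrow> 'k pline" where "proj \<equiv> projection C"

lemma projection_eq: "proj v z = (THE p. sees v z p)"
  by (simp add: projection_def sees_def toward_def)

lemma projectionI: "sees v z p \<Longrightarrow> proj v z = p"
  unfolding projection_eq using sees_unique by blast

lemma sees_projection: "v \<in> comps C \<Longrightarrow> z \<in> Z \<Longrightarrow> sees v z (proj v z)"
  using sees_exists projectionI by blast

text \<open>
  All marked points that \<open>v\<close> does not see in the direction of \<open>u\<close> coincide in the view from \<open>u\<close>.  This
  is what makes the cross-ratios on different components comparable.
\<close>

lemma projection_opposite: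
  assumes "u \<in> comps C" "v \<in> comps C" "z \<in> Z" "toward v u p" "toward u v p2"
    and "proj v z \<noteq> p"
  shows "proj u z = p2"
proof (rule projectionI)
  have s: "sees v z (proj v z)" using sees_projection assms by blast
  have "toward u (host z) p2"
  proof (cases "host z = v")
    case True
    then show ?thesis using assms(5) by simp
  next
    case False
    then have "toward v (host z) (proj v z)" using s by (auto simp: sees_def)
    then show ?thesis using toward_opposite[OF assms(4,5)] assms(6) by blast
  qed
  then show "sees u z p2" by (simp add: sees_def)
qed

lemma projection_at_node:
  assumes e: "{(v, p), (w, q)} \<in> nodes C" and z: "z \<in> Z"
  shows "proj v z = p \<longleftrightarrow> linked (nodes C - {{(v, p), (w, q)}}) w (host z)"
proof
  assume "linked (nodes C - {{(v, p), (w, q)}}) w (host z)"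
  then have "toward v (host z) p" using e unfolding toward_def by blast
  then show "proj v z = p" by (intro projectionI) (simp add: sees_def)
next
  assume "proj v z = p"
  then have "sees v z p" using sees_projection[OF node_ends(2)[OF e] z] by simp
  moreover have "mark C z \<noteq> (v, p)" using mark_props(2)[OF z] e by auto
  ultimately have "toward v (host z) p" by (simp add: sees_def)
  then obtain w' q' where "{(v, p), (w', q')} \<in> nodes C"
    "linked (nodes C - {{(v, p), (w', q')}}) w' (host z)"
    by (auto simp: toward_def)
  then show "linked (nodes C - {{(v, p), (w, q)}}) w (host z)"
    using node_determined[OF e] by blast
qed

lemma projection_across_node:
  assumes e: "{(v, p), (w, q)} \<in> nodes C" and z: "z \<in> Z"
  shows "proj w z = q \<longleftrightarrow> proj v z \<noteq> p"
proof -
  have e': "{(w, q), (v, p)} \<in> nodes C" using e by (simp add: insert_commute)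
  show ?thesis
    using projection_at_node[OF e z] projection_at_node[OF e' z] edge_sides[OF e mark_props(1)[OF z]]
    by (simp add: insert_commute)
qed

lemma projection_own:
  assumes "y \<in> Z" "z \<in> Z" "proj (host y) z = snd (mark C y)"
  shows "z = y"
proof -
  have y: "mark C y = (host y, snd (mark C y))" by simp
  have "sees (host y) z (snd (mark C y))"
    using sees_projection[OF mark_props(1)[OF assms(1)] assms(2)] assms(3) by simp
  moreover have "\<not> toward (host y) (host z) (snd (mark C y))"
  proof
    assume "toward (host y) (host z) (snd (mark C y))"
    then have "(host y, snd (mark C y)) \<in> \<Union> (nodes C)" by (auto simp: toward_def)
    then show False using mark_props(2)[OF assms(1)] by simp
  qed
  ultimately have "mark C z = mark C y" using y by (simp add: sees_def)
  then show ?thesis using mark_inj assms by blast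
qed

text \<open>
  Walking from a component that separates \<open>a\<close> from \<open>b\<close> into the branch that contains \<open>a\<close> and \<open>c\<close>, one
  keeps separating \<open>a\<close> from \<open>b\<close>, and the branch shrinks until \<open>a\<close> and \<open>c\<close> part as well.
\<close>

lemma median_walk:
  assumes "v \<in> comps C" "{a, b, c} \<subseteq> Z" "a \<noteq> c"
    and "proj v a \<noteq> proj v b" "proj v c = proj v a"
  shows "\<exists>u\<in>comps C. distinct [proj u a, proj u b, proj u c]"
  using assms
proof (induction "card {u \<in> comps C. toward v u (proj v c)}" arbitrary: v rule: less_induct)
  case less
  define p where "p = proj v a"
  have Z: "a \<in> Z" "b \<in> Z" "c \<in> Z" using less.prems by auto
  have pc: "proj v c = p" and pb: "proj v b \<noteq> p" using less.prems p_def by auto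
  have "sees v a p" using sees_projection[OF less.prems(1) Z(1)] p_def by simp
  moreover have "mark C a \<noteq> (v, p)"
    using projection_own[OF Z(1,3)] pc less.prems(3) by auto
  ultimately have "toward v (host a) p" by (simp add: sees_def)
  then obtain w q where e: "{(v, p), (w, q)} \<in> nodes C" by (auto simp: toward_def)
  have w: "w \<in> comps C" using node_ends(3)[OF e] .
  have qs: "proj w b = q" "proj w a \<noteq> q" "proj w c \<noteq> q"
    using projection_across_node[OF e] Z pb pc p_def by auto
  show ?case
  proof (cases "proj w a = proj w c")
    case False
    then show ?thesis using qs w by (intro bexI[of _ w]) auto
  next
    case True
    have "{u \<in> comps C. toward w u (proj w c)} \<subset> {u \<in> comps C. toward v u (proj v c)}"
    proof
      show "{u \<in> comps C. toward w u (proj w c)} \<subseteq> {u \<in> comps C. toward v u (proj v c)}"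
        using toward_opposite[OF toward_edge(2,1)[OF e]] qs(3) pc by blast
      show "{u \<in> comps C. toward w u (proj w c)} \<noteq> {u \<in> comps C. toward v u (proj v c)}"
        using toward_edge(1)[OF e] w pc toward_self by blast
    qed
    then have "card {u \<in> comps C. toward w u (proj w c)} <
        card {u \<in> comps C. toward v u (proj v c)}"
      using finite_V by (intro psubset_card_mono) auto
    then show ?thesis
      using True qs w less.prems by (intro less.hyps[of w]) auto
  qed
qed

lemma median:
  assumes "{a, b, c} \<subseteq> Z" "distinct [a, b, c]"
  obtains u where "u \<in> comps C" "distinct [proj u a, proj u b, proj u c]"
proof -
  have Z: "a \<in> Z" "b \<in> Z" "c \<in> Z" using assms by auto
  let ?v = "host a"
  have v: "?v \<in> comps C" using mark_props(1)[OF Z(1)] .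
  have own: "proj ?v a = snd (mark C a)"
    by (rule projectionI) (simp add: sees_def)
  have ab: "proj ?v a \<noteq> proj ?v b"
    using projection_own[OF Z(1,2)] assms(2) own by auto
  consider "proj ?v c \<noteq> proj ?v a" "proj ?v c \<noteq> proj ?v b"
    | "proj ?v c = proj ?v a" | "proj ?v c = proj ?v b" by blast
  then have "\<exists>u\<in>comps C. distinct [proj u a, proj u b, proj u c]"
  proof cases
    case 1
    then show ?thesis using ab v by (intro bexI[of _ ?v]) auto
  next
    case 2
    then show ?thesis using median_walk[OF v assms(1)] ab assms(2) by auto
  next
    case 3
    then have "\<exists>u\<in>comps C. distinct [proj u b, proj u a, proj u c]"
      using median_walk[OF v, of b a c] ab assms by (auto simp: insert_commute)
    then obtain u where "u \<in> comps C" "distinct [proj u b, proj u a, proj u c]" ..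
    then show ?thesis by (intro bexI[of _ u]) auto
  qed
  then show ?thesis using that by blast
qed

definition vcr_at :: "nat \<Rightarrow> 'z \<Rightarrow> 'z \<Rightarrow> 'z \<Rightarrow> 'z \<Rightarrow> 'k pline" where
  "vcr_at v a b c d = vcr (hcoords (proj v a)) (hcoords (proj v b))
     (hcoords (proj v c)) (hcoords (proj v d))"

definition generic_at :: "nat \<Rightarrow> 'z \<Rightarrow> 'z \<Rightarrow> 'z \<Rightarrow> 'z \<Rightarrow> bool" where
  "generic_at v a b c d \<longleftrightarrow> generic4 (hcoords (proj v a)) (hcoords (proj v b))
     (hcoords (proj v c)) (hcoords (proj v d))"

text \<open>
  On two different components \<open>u\<close> and \<open>v\<close>, no three of the four points coincide.  So exactly two of them are seen from \<open>v\<close> in the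
  direction of \<open>u\<close>; these coincide on \<open>v\<close>, and the other two coincide on \<open>u\<close>.  On both components the
  cross-ratio has the value that belongs to this splitting.
\<close>

lemma vcr_at_unique:
  assumes Q: "(a, b, c, d) \<in> quads Z" and uv: "u \<in> comps C" "v \<in> comps C"
    and gu: "generic_at u a b c d" and gv: "generic_at v a b c d"
  shows "vcr_at u a b c d = vcr_at v a b c d"
proof (cases "u = v")
  case False
  obtain p where p: "toward v u p" using toward_exists uv False by blast
  obtain q where q: "toward u v q" using toward_exists uv False by blast
  have Z: "a \<in> Z" "b \<in> Z" "c \<in> Z" "d \<in> Z" using Q by (auto simp: quads_iff)
  have opp: "proj v z = p \<or> proj u z = q" if "z \<in> Z" for z
    using projection_opposite[OF uv that p q] by blast
  have gu': "(proj u a \<noteq> proj u c \<and> proj u b \<noteq> proj u d) \<or>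
      (proj u a \<noteq> proj u d \<and> proj u b \<noteq> proj u c)"
    using gu by (simp add: generic_at_def generic4_hcoords)
  have gv': "(proj v a \<noteq> proj v c \<and> proj v b \<noteq> proj v d) \<or>
      (proj v a \<noteq> proj v d \<and> proj v b \<noteq> proj v c)"
    using gv by (simp add: generic_at_def generic4_hcoords)
  have one: "vcr_at t a b c d = Fin 1"
    if "generic_at t a b c d" "proj t a = proj t b \<or> proj t c = proj t d" for t
    using that(2) vcr_one_iff[OF that(1)[unfolded generic_at_def]]
    by (simp add: vcr_at_def det2_hcoords_zero_iff)
  have zero: "vcr_at t a b c d = Fin 0"
    if "generic_at t a b c d" "proj t a = proj t c \<or> proj t b = proj t d" for t
    using that unfolding vcr_at_def generic_at_def generic4_hcoords vcr_def ratio_def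
    by (auto simp: det2_hcoords_zero_iff)
  have infty: "vcr_at t a b c d = Infty"
    if "generic_at t a b c d" "proj t a = proj t d \<or> proj t b = proj t c" for t
    using that unfolding vcr_at_def generic_at_def generic4_hcoords vcr_def ratio_def
    by (auto simp: det2_hcoords_zero_iff)
  consider "proj v a = proj v b \<or> proj v c = proj v d"
      "proj u a = proj u b \<or> proj u c = proj u d"
    | "proj v a = proj v c \<or> proj v b = proj v d"
      "proj u a = proj u c \<or> proj u b = proj u d"
    | "proj v a = proj v d \<or> proj v b = proj v c"
      "proj u a = proj u d \<or> proj u b = proj u c"
    using gu' gv' opp[OF Z(1)] opp[OF Z(2)] opp[OF Z(3)] opp[OF Z(4)] by metis
  then show ?thesis
    using one[OF gu] one[OF gv] zero[OF gu] zero[OF gv] infty[OF gu] infty[OF gv] by cases simp_all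
qed simp

lemma card_projections_generic:
  assumes "3 \<le> card (proj v ` {a, b, c, d})"
  shows "generic_at v a b c d"
proof (rule ccontr)
  assume "\<not> generic_at v a b c d"
  then have "proj v ` {a, b, c, d} \<subseteq> {proj v a, proj v b} \<or>
      proj v ` {a, b, c, d} \<subseteq> {proj v a, proj v c} \<or>
      proj v ` {a, b, c, d} \<subseteq> {proj v a, proj v d}"
    unfolding generic_at_def generic4_hcoords by auto
  then obtain p q where "proj v ` {a, b, c, d} \<subseteq> {p, q}" by blast
  then have "card (proj v ` {a, b, c, d}) \<le> card {p, q}"
    by (intro card_mono) auto
  then show False using assms card_insert_le_m1[of 2 "{q}" p] by auto
qed

lemma moduli_point_value:
  assumes Q: "(a, b, c, d) \<in> quads Z" and v: "v \<in> comps C" and g: "generic_at v a b c d"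
  shows "moduli_point Z C (a, b, c, d) = vcr_at v a b c d"
proof -
  have abc: "{a, b, c} \<subseteq> Z" "distinct [a, b, c]" using Q by (auto simp: quads_iff)
  obtain u where u: "u \<in> comps C" "distinct [proj u a, proj u b, proj u c]"
    by (rule median[OF abc])
  have "card {proj u a, proj u b, proj u c} \<le> card (proj u ` {a, b, c, d})"
    by (intro card_mono) auto
  then have u3: "3 \<le> card (proj u ` {a, b, c, d})" using u(2) by simp
  let ?P = "\<lambda>r. \<exists>v\<in>comps C. 3 \<le> card (proj v ` {a, b, c, d}) \<and>
    r = cross_ratio (proj v a) (proj v b) (proj v c) (proj v d)"
  have "(THE r. ?P r) = vcr_at v a b c d"
  proof (rule the_equality)
    have "vcr_at u a b c d = vcr_at v a b c d"
      using vcr_at_unique[OF Q u(1) v card_projections_generic[OF u3] g] .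
    then show "?P (vcr_at v a b c d)"
      using u(1) u3 by (intro bexI[of _ u]) (simp_all add: vcr_at_def cross_ratio_vcr)
  next
    fix r assume "?P r"
    then obtain t where t: "t \<in> comps C" "3 \<le> card (proj t ` {a, b, c, d})" "r = vcr_at t a b c d"
      by (auto simp: vcr_at_def cross_ratio_vcr)
    then show "r = vcr_at v a b c d"
      using vcr_at_unique[OF Q t(1) v card_projections_generic[OF t(2)] g] by simp
  qed
  then show ?thesis using Q by (simp add: moduli_point_def)
qed

lemma generic_at_exists:
  assumes "(a, b, c, d) \<in> quads Z"
  obtains v where "v \<in> comps C" "generic_at v a b c d"
proof -
  have "{a, b, c} \<subseteq> Z" "distinct [a, b, c]" using assms by (auto simp: quads_iff)
  then obtain u where u: "u \<in> comps C" "distinct [proj u a, proj u b, proj u c]"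
    by (rule median)
  then have "generic_at u a b c d" unfolding generic_at_def generic4_hcoords by auto
  then show ?thesis using that u(1) by blast
qed

text \<open>
  All relations among the cross-ratios of four points are verified on one component.  For five
  points, a component is chosen on which \<open>a\<close>, \<open>b\<close> and \<open>d\<close> are distinct.
\<close>

lemma moduli_point_cr_system: "cr_system Z (moduli_point Z C)"
  unfolding cr_system_def
proof (intro conjI allI impI)
  show "moduli_point Z C \<in> quads Z \<rightarrow>\<^sub>E UNIV" by (simp add: moduli_point_def)
next
  fix a b c d assume q: "(a, b, c, d) \<in> quads Z"
  then have q': "(c, d, a, b) \<in> quads Z" "(a, b, d, c) \<in> quads Z" "(a, c, b, d) \<in> quads Z"
    by (auto simp: quads_iff)
  obtain v where v: "v \<in> comps C" "generic_at v a b c d" using generic_at_exists[OF q] .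
  have g: "generic_at v c d a b" "generic_at v a b d c" "generic_at v a c b d"
    using generic4_swap v(2) unfolding generic_at_def by blast+
  note vals = moduli_point_value[OF q v] moduli_point_value[OF q'(1) v(1) g(1)]
    moduli_point_value[OF q'(2) v(1) g(2)] moduli_point_value[OF q'(3) v(1) g(3)]
  show "moduli_point Z C (c, d, a, b) = moduli_point Z C (a, b, c, d)"
    unfolding vals vcr_at_def by (rule vcr_sym)
  show "s4_related (moduli_point Z C (a, b, c, d)) (moduli_point Z C (a, b, d, c)) (moduli_point Z C (a, c, b, d))"
    unfolding vals vcr_at_def by (rule vcr_s4_related[OF v(2)[unfolded generic_at_def]])
next
  fix a b c d e assume abcde: "{a, b, c, d, e} \<subseteq> Z" "distinct [a, b, c, d, e]"
  then have q: "(a, b, c, d) \<in> quads Z" "(a, b, d, e) \<in> quads Z" "(a, b, c, e) \<in> quads Z"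
    by (auto simp: quads_iff)
  have abd: "{a, b, d} \<subseteq> Z" "distinct [a, b, d]" using abcde by auto
  obtain v where v: "v \<in> comps C" "distinct [proj v a, proj v b, proj v d]"
    by (rule median[OF abd])
  then have g: "generic_at v a b c d" "generic_at v a b d e"
    by (auto simp: generic_at_def generic4_hcoords)
  note vals = moduli_point_value[OF q(1) v(1) g(1)] moduli_point_value[OF q(2) v(1) g(2)]
  show "product_related (moduli_point Z C (a, b, c, d)) (moduli_point Z C (a, b, d, e))
      (moduli_point Z C (a, b, c, e))"
  proof (cases "generic_at v a b c e")
    case True
    note vals' = vals moduli_point_value[OF q(3) v(1) True]
    show ?thesis
      unfolding vals' vcr_at_def
      by (rule vcr_product_related) (use g True in \<open>simp_all add: generic_at_def\<close>)
  next
    \<comment> \<open>Here \<open>c\<close>, \<open>e\<close> and one of \<open>a\<close>, \<open>b\<close> coincide on \<open>v\<close>, and both sides vanish.\<close>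
    case False
    then have "(proj v c = proj v a \<and> proj v e = proj v a) \<or>
        (proj v c = proj v b \<and> proj v e = proj v b)"
      using v(2) by (auto simp: generic_at_def generic4_hcoords)
    then show ?thesis
    proof (elim disjE conjE)
      assume eq: "proj v c = proj v a" "proj v e = proj v a"
      have "vcr_at v a b c d = Fin 0" "vcr_at v a b d e = Infty"
        using v(2) unfolding vcr_at_def vcr_def ratio_def eq
        by (simp_all add: det2_hcoords_zero_iff eq_commute[of "proj v b"])
      then show ?thesis unfolding vals product_related_def by simp
    next
      assume eq: "proj v c = proj v b" "proj v e = proj v b"
      have "vcr_at v a b c d = Infty" "vcr_at v a b d e = Fin 0"
        using v(2) unfolding vcr_at_def vcr_def ratio_def eq
        by (simp_all add: det2_hcoords_zero_iff eq_commute[of "proj v b"])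
      then show ?thesis unfolding vals product_related_def by simp
    qed
  qed
qed

text \<open>
  On the component on the far side of the node, the points of \<open>E\<close> coincide at the node.
\<close>

lemma separates_splits:
  assumes e: "e \<in> nodes C" "separates Z C e E"
  shows "splits Z (moduli_point Z C) E"
proof -
  obtain v p w q where e_eq: "e = {(v, p), (w, q)}"
    and E: "E = {z \<in> Z. linked (nodes C - {e}) v (host z)}"
    using e(2) by (auto simp: separates_def)
  have e': "{(w, q), (v, p)} \<in> nodes C" using e(1) e_eq by (simp add: insert_commute)
  have mem: "z \<in> E \<longleftrightarrow> proj w z = q" if "z \<in> Z" for z
    using projection_at_node[OF e' that] that E e_eq by (simp add: insert_commute)
  show ?thesis
    unfolding splits_def
  proof (intro ballI impI)
    fix a b c d assume abcd: "a \<in> E" "b \<in> E" "c \<in> Z - E" "d \<in> Z - E" "a \<noteq> b" "c \<noteq> d"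
    have EZ: "E \<subseteq> Z" using E by blast
    then have Q: "(a, b, c, d) \<in> quads Z" using abcd by (auto simp: quads_iff)
    have pr: "proj w a = q" "proj w b = q" "proj w c \<noteq> q" "proj w d \<noteq> q"
      using abcd mem EZ by auto
    then have g: "generic_at w a b c d" by (auto simp: generic_at_def generic4_hcoords)
    have "vcr_at w a b c d = Fin 1"
      using vcr_one_iff[OF g[unfolded generic_at_def]] pr
      by (simp add: vcr_at_def det2_hcoords_zero_iff)
    then show "moduli_point Z C (a, b, c, d) = Fin 1"
      using moduli_point_value[OF Q node_ends(2)[OF e'] g] by simp
  qed
qed

end

section \<open>Construction of stable curves\<close>

lemma vcr_scale:
  assumes "c1 \<noteq> 0" "c2 \<noteq> 0" "c3 \<noteq> 0" "c4 \<noteq> 0"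
  shows "vcr (c1 * fst u1, c1 * snd u1) (c2 * fst u2, c2 * snd u2) (c3 * fst u3, c3 * snd u3)
    (c4 * fst u4, c4 * snd u4) = vcr u1 u2 u3 u4"
proof -
  have d: "det2 (r * fst u, r * snd u) (s * fst v, s * snd v) = r * s * det2 u v" for r s and u v :: "'a \<times> 'a"
    by (simp add: det2_def algebra_simps)
  have "ratio ((c1 * c2 * c3 * c4) * (det2 u1 u3 * det2 u2 u4)) ((c1 * c2 * c3 * c4) * (det2 u1 u4 * det2 u2 u3)) =
      vcr u1 u2 u3 u4"
    unfolding vcr_def using assms by (intro ratio_scale) simp
  then show ?thesis by (simp add: vcr_def d mult_ac)
qed

text \<open>
  The number \<open>N\<close> of the component is prescribed so that curves to be glued can be kept disjoint.
\<close>

lemma smooth_curve: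
  assumes "3 \<le> card Z" "config Z u"
  obtains C :: "('z, 'k::field) pointed_curve"
  where "stable_curve Z C" "moduli_point Z C = cr_of Z u" "comps C = {N}"
proof -
  define pt where "pt z = ratio (fst (u z)) (snd (u z))" for z
  define C :: "('z, 'k) pointed_curve" where "C = \<lparr>comps = {N}, nodes = {}, mark = (\<lambda>z. (N, pt z))\<rparr>"
  have fin: "finite Z" using assms(1) by (metis card.infinite not_numeral_le_zero)
  have nz: "fst (u z) \<noteq> 0 \<or> snd (u z) \<noteq> 0" if "z \<in> Z" for z
  proof -
    have "\<not> Z \<subseteq> {z}" using assms(1) card_mono[of "{z}" Z] by auto
    then obtain y where "y \<in> Z" "y \<noteq> z" by blast
    then have "det2 (u z) (u y) \<noteq> 0" using assms(2) that by (auto simp: config_def)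
    then show ?thesis by (auto simp: det2_def)
  qed
  have "inj_on pt Z"
  proof (rule inj_onI)
    fix y z assume yz: "y \<in> Z" "z \<in> Z" "pt y = pt z"
    then have "det2 (u y) (u z) = 0"
      using ratio_eq_iff[OF nz[OF yz(1)] nz[OF yz(2)]] by (simp add: pt_def det2_def)
    then show "y = z" using assms(2) yz by (auto simp: config_def)
  qed
  then have "card (pt ` Z) = card Z" "inj_on (\<lambda>z. (N, pt z)) Z"
    by (simp_all add: card_image inj_on_def)
  moreover have "{p. (N, p) \<in> special_points Z C} = pt ` Z"
    by (auto simp: special_points_def C_def)
  ultimately have stable: "stable_curve Z C"
    unfolding stable_curve_def using assms(1) fin by (simp add: C_def)
  interpret stable_pointed Z C by unfold_locales (rule stable)
  have proj: "projection C N z = pt z" for z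
    by (rule projectionI, unfold sees_def) (simp add: C_def)
  have "moduli_point Z C q = cr_of Z u q" for q
  proof (cases "q \<in> quads Z")
    case True
    then obtain a b c d where q: "q = (a, b, c, d)" and Q: "(a, b, c, d) \<in> quads Z" by (cases q) auto
    have Zq: "a \<in> Z" "b \<in> Z" "c \<in> Z" "d \<in> Z" using Q by (auto simp: quads_iff)
    have "\<exists>r. r \<noteq> 0 \<and> hcoords (pt z) = (r * fst (u z), r * snd (u z))" if "z \<in> Z" for z
      using hcoords_ratio[OF nz[OF that]] unfolding pt_def by metis
    then obtain r where r: "\<And>z. z \<in> Z \<Longrightarrow> r z \<noteq> 0"
      "\<And>z. z \<in> Z \<Longrightarrow> hcoords (pt z) = (r z * fst (u z), r z * snd (u z))" by metis
    have "generic_at N a b c d"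
      using Q Zq \<open>inj_on pt Z\<close> unfolding generic_at_def generic4_hcoords proj
      by (auto simp: quads_iff inj_on_eq_iff)
    moreover have "N \<in> comps C" by (simp add: C_def)
    ultimately have "moduli_point Z C (a, b, c, d) = vcr_at N a b c d"
      using moduli_point_value[OF Q] by blast
    also have "\<dots> = vcr (u a) (u b) (u c) (u d)"
      unfolding vcr_at_def proj r(2)[OF Zq(1)] r(2)[OF Zq(2)] r(2)[OF Zq(3)] r(2)[OF Zq(4)]
      using r(1) Zq by (intro vcr_scale)
    finally show ?thesis using Q q by (simp add: cr_of_def)
  qed (simp add: moduli_point_def cr_of_def)
  then have "moduli_point Z C = cr_of Z u" by blast
  then show ?thesis using stable that by (simp add: C_def)
qed

text \<open>
  The marked points \<open>c0\<close> of \<open>C1\<close> and \<open>a0\<close> of \<open>C2\<close> are glued to a node.  Fixing the marking outside \<open>Z\<close> makes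
  the construction symmetric in the two curves, so that statements about \<open>C1\<close> carry over to \<open>C2\<close>.
\<close>

definition glue :: "'z set \<Rightarrow> 'z set \<Rightarrow> 'z \<Rightarrow> 'z \<Rightarrow> ('z, 'k) pointed_curve \<Rightarrow> ('z, 'k) pointed_curve \<Rightarrow>
    ('z, 'k) pointed_curve" where
  "glue Z A a0 c0 C1 C2 = \<lparr>comps = comps C1 \<union> comps C2,
     nodes = insert {mark C1 c0, mark C2 a0} (nodes C1 \<union> nodes C2),
     mark = (\<lambda>z. if z \<in> A then mark C1 z else if z \<in> Z then mark C2 z else undefined)\<rparr>"

locale two_curves =
  fixes Z A :: "'z set" and a0 c0 :: 'z and C1 C2 :: "('z, 'k::field) pointed_curve"
  assumes A: "A \<subseteq> Z" "a0 \<in> A" "c0 \<in> Z - A"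
    and stable1: "stable_curve (insert c0 A) C1" and stable2: "stable_curve (insert a0 (Z - A)) C2"
    and disjoint: "comps C1 \<inter> comps C2 = {}"
begin

sublocale S1: stable_pointed "insert c0 A" C1 by unfold_locales (rule stable1)
sublocale S2: stable_pointed "insert a0 (Z - A)" C2 by unfold_locales (rule stable2)

abbreviation new_node :: "(nat \<times> 'k pline) set" where
  "new_node \<equiv> {mark C1 c0, mark C2 a0}"

abbreviation C :: "('z, 'k) pointed_curve" where "C \<equiv> glue Z A a0 c0 C1 C2"

lemma C_simps:
  "comps C = comps C1 \<union> comps C2" "nodes C = insert new_node (nodes C1 \<union> nodes C2)"
  "mark C = (\<lambda>z. if z \<in> A then mark C1 z else if z \<in> Z then mark C2 z else undefined)"
  by (simp_all add: glue_def)

lemma hosts: "fst (mark C1 c0) \<in> comps C1" "fst (mark C2 a0) \<in> comps C2"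
  using S1.mark_props(1) S2.mark_props(1) by auto

lemma new_node_fresh: "new_node \<notin> nodes C1" "new_node \<notin> nodes C2"
  using S1.mark_props(2)[of c0] S2.mark_props(2)[of a0] by auto

lemma node_point_host:
  "x \<in> e \<Longrightarrow> e \<in> nodes C1 \<Longrightarrow> fst x \<in> comps C1"
  "x \<in> e \<Longrightarrow> e \<in> nodes C2 \<Longrightarrow> fst x \<in> comps C2"
  using S1.node_V S2.node_V by blast+

lemma not_both_hosts: "v \<in> comps C1 \<Longrightarrow> v \<in> comps C2 \<Longrightarrow> False"
  using disjoint by blast

lemma nodes_disjoint:
  assumes "e \<in> nodes C1" "e' \<in> nodes C2"
  shows "e \<inter> e' = {}"
  using node_point_host assms not_both_hosts by blast

lemma node_nonempty: "e \<in> nodes C1 \<Longrightarrow> e \<notin> nodes C2"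
  using nodes_disjoint[of e e] S1.node_card[of e] by auto

lemma new_node_disjoint:
  assumes "e \<in> nodes C1 \<union> nodes C2"
  shows "new_node \<inter> e = {}"
proof -
  have "mark C1 c0 \<notin> e" "mark C2 a0 \<notin> e"
    using assms S1.mark_props(2)[of c0] S2.mark_props(2)[of a0] hosts node_point_host not_both_hosts
    by blast+
  then show ?thesis by blast
qed

lemma special_points_glue: "special_points Z C = special_points (insert c0 A) C1 \<union> special_points (insert a0 (Z - A)) C2"
proof -
  have "mark C ` Z = mark C1 ` A \<union> mark C2 ` (Z - A)"
    using A(1) by (auto simp: C_simps)
  then show ?thesis by (auto simp: special_points_def C_simps)
qed

lemma special_points_host:
  "(v, p) \<in> special_points (insert c0 A) C1 \<Longrightarrow> v \<in> comps C1"
  "(v, p) \<in> special_points (insert a0 (Z - A)) C2 \<Longrightarrow> v \<in> comps C2"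
proof -
  show "v \<in> comps C1" if "(v, p) \<in> special_points (insert c0 A) C1"
  proof -
    from that consider z where "z \<in> insert c0 A" "(v, p) = mark C1 z" | e where "e \<in> nodes C1" "(v, p) \<in> e"
      unfolding special_points_def by blast
    then show ?thesis
      using S1.mark_props(1) node_point_host(1)[of "(v, p)"] by cases (metis fst_conv, simp)
  qed
  show "v \<in> comps C2" if "(v, p) \<in> special_points (insert a0 (Z - A)) C2"
  proof -
    from that consider z where "z \<in> insert a0 (Z - A)" "(v, p) = mark C2 z" | e where "e \<in> nodes C2" "(v, p) \<in> e"
      unfolding special_points_def by blast
    then show ?thesis
      using S2.mark_props(1) node_point_host(2)[of "(v, p)"] by cases (metis fst_conv, simp)
  qed
qed

lemma connected1: "v \<in> comps C1 \<Longrightarrow> w \<in> comps C1 \<Longrightarrow> linked (nodes C) v w"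
  using S1.conn by (rule connected_mono) (auto simp: C_simps)

lemma connected2: "v \<in> comps C2 \<Longrightarrow> w \<in> comps C2 \<Longrightarrow> linked (nodes C) v w"
  using S2.conn by (rule connected_mono) (auto simp: C_simps)

lemma new_node_edge: "new_node = {(fst (mark C1 c0), snd (mark C1 c0)), (fst (mark C2 a0), snd (mark C2 a0))}"
  by simp

lemma stable_glue: "stable_curve Z C"
  unfolding stable_curve_def
proof (intro conjI)
  show "finite (comps C)" "comps C \<noteq> {}" "finite (nodes C)"
    using S1.finite_V S2.finite_V S1.finite_M S2.finite_M hosts by (auto simp: C_simps)
  have "mark C1 c0 \<noteq> mark C2 a0" using hosts disjoint by (metis disjoint_iff)
  then have "card new_node = 2" by simp
  moreover have "fst ` new_node \<subseteq> comps C" using hosts by (auto simp: C_simps)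
  moreover have "card e = 2 \<and> fst ` e \<subseteq> comps C" if "e \<in> nodes C1 \<union> nodes C2" for e
    using that S1.node_card S2.node_card S1.node_V S2.node_V unfolding C_simps by blast
  ultimately show "\<forall>e\<in>nodes C. card e = 2 \<and> fst ` e \<subseteq> comps C"
    unfolding C_simps(2) by blast
  show "pairwise disjnt (nodes C)"
  proof (rule pairwiseI)
    fix e e' assume e: "e \<in> nodes C" "e' \<in> nodes C" "e \<noteq> e'"
    consider "e = new_node" | "e' = new_node" | "e \<in> nodes C1" "e' \<in> nodes C1"
      | "e \<in> nodes C2" "e' \<in> nodes C2" | "e \<in> nodes C1" "e' \<in> nodes C2" | "e \<in> nodes C2" "e' \<in> nodes C1"
      using e unfolding C_simps by blast
    then show "disjnt e e'"
    proof cases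
      case 1
      then show ?thesis using e new_node_disjoint[of e'] unfolding C_simps disjnt_def by blast
    next
      case 2
      then show ?thesis using e new_node_disjoint[of e] unfolding C_simps disjnt_def by blast
    next
      case 3
      then show ?thesis using pairwiseD[OF S1.nodes_disjnt] e(3) by auto
    next
      case 4
      then show ?thesis using pairwiseD[OF S2.nodes_disjnt] e(3) by auto
    next
      case 5
      then show ?thesis using nodes_disjoint by (simp add: disjnt_def)
    next
      case 6
      then show ?thesis using nodes_disjoint[of e' e] by (simp add: disjnt_def Int_commute)
    qed
  qed
  have link: "linked (nodes C) v w" if "v \<in> comps C1" "w \<in> comps C2" for v w
  proof -
    have "linked (nodes C) (fst (mark C1 c0)) (fst (mark C2 a0))"
      by (rule connected_edge[of _ "snd (mark C1 c0)" _ "snd (mark C2 a0)"]) (simp add: C_simps)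
    then show ?thesis
      using connected1[OF that(1) hosts(1)] connected2[OF hosts(2) that(2)] by (meson rtrancl_trans)
  qed
  show "\<forall>v\<in>comps C. \<forall>w\<in>comps C. linked (nodes C) v w"
    using connected1 connected2 link connected_sym[OF link] unfolding C_simps(1) by blast
  have "card (comps C) = card (comps C1) + card (comps C2)"
    unfolding C_simps using S1.finite_V S2.finite_V disjoint by (rule card_Un_disjoint)
  moreover have "card (nodes C1 \<union> nodes C2) = card (nodes C1) + card (nodes C2)"
    using S1.finite_M S2.finite_M node_nonempty by (intro card_Un_disjoint) auto
  ultimately show "card (comps C) = card (nodes C) + 1"
    unfolding C_simps(2) using S1.count S2.count new_node_fresh S1.finite_M S2.finite_M by simp
  show "inj_on (mark C) Z"
  proof (rule inj_onI)
    fix y z assume yz: "y \<in> Z" "z \<in> Z" "mark C y = mark C z"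
    have ne: "mark C1 s \<noteq> mark C2 t" if "s \<in> A" "t \<in> Z - A" for s t
      using S1.mark_props(1)[of s] S2.mark_props(1)[of t] that disjoint by (metis disjoint_iff insertI2)
    show "y = z"
      using yz ne[of y z] ne[of z y] S1.mark_inj[of y z] S2.mark_inj[of y z]
      by (auto simp: C_simps split: if_splits)
  qed
  show "\<forall>z\<in>Z. fst (mark C z) \<in> comps C \<and> mark C z \<notin> \<Union> (nodes C)"
  proof (intro ballI conjI)
    fix z assume z: "z \<in> Z"
    show "fst (mark C z) \<in> comps C"
      using z S1.mark_props(1)[of z] S2.mark_props(1)[of z] by (auto simp: C_simps)
    have *: "mark C z \<notin> e" if e: "e \<in> nodes C1 \<union> nodes C2" for e
    proof (cases "z \<in> A")
      case True
      then have "mark C1 z \<notin> e" using e S1.mark_props[of z] node_point_host not_both_hosts by blast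
      then show ?thesis using True by (simp add: C_simps)
    next
      case False
      then have "mark C2 z \<notin> e" using e z S2.mark_props[of z] node_point_host not_both_hosts by blast
      then show ?thesis using False z by (simp add: C_simps)
    qed
    have "mark C z \<noteq> mark C1 c0" "mark C z \<noteq> mark C2 a0"
    proof -
      show "mark C z \<noteq> mark C1 c0"
      proof (cases "z \<in> A")
        case True
        then show ?thesis using S1.mark_inj[of z c0] A(3) by (auto simp: C_simps)
      next
        case False
        then have "fst (mark C2 z) \<in> comps C2" using z S2.mark_props(1)[of z] by simp
        then show ?thesis using False z hosts(1) disjoint by (auto simp: C_simps)
      qed
      show "mark C z \<noteq> mark C2 a0"
      proof (cases "z \<in> A")
        case True
        then have "fst (mark C1 z) \<in> comps C1" using S1.mark_props(1)[of z] by simp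
        then show ?thesis using True hosts(2) disjoint by (auto simp: C_simps)
      next
        case False
        then show ?thesis using z S2.mark_inj[of z a0] A(2) by (auto simp: C_simps)
      qed
    qed
    then show "mark C z \<notin> \<Union> (nodes C)" using * unfolding C_simps(2) by blast
  qed
  show "\<forall>v\<in>comps C. finite {p. (v, p) \<in> special_points Z C} \<and> 3 \<le> card {p. (v, p) \<in> special_points Z C}"
  proof
    fix v assume "v \<in> comps C"
    then consider (1) "v \<in> comps C1" "v \<notin> comps C2" | (2) "v \<in> comps C2" "v \<notin> comps C1"
      using disjoint unfolding C_simps by blast
    then show "finite {p. (v, p) \<in> special_points Z C} \<and> 3 \<le> card {p. (v, p) \<in> special_points Z C}"
    proof cases
      case 1
      then have "{p. (v, p) \<in> special_points Z C} = {p. (v, p) \<in> special_points (insert c0 A) C1}"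
        using special_points_host unfolding special_points_glue by blast
      then show ?thesis using stable1 1 unfolding stable_curve_def by simp
    next
      case 2
      then have "{p. (v, p) \<in> special_points Z C} = {p. (v, p) \<in> special_points (insert a0 (Z - A)) C2}"
        using special_points_host unfolding special_points_glue by blast
      then show ?thesis using stable2 2 unfolding stable_curve_def by simp
    qed
  qed
qed

sublocale S: stable_pointed Z C by unfold_locales (rule stable_glue)

lemma new_node_separates: "separates Z C new_node A"
proof -
  let ?N = "nodes C - {new_node}"
  have N: "?N = nodes C1 \<union> nodes C2" using new_node_fresh unfolding C_simps by blast
  let ?v = "fst (mark C1 c0)"
  have stay: "w \<in> comps C1" if "linked ?N ?v w" for w
    using that
  proof (induction rule: rtrancl_induct)
    case (step y w)
    then obtain p q where e: "{(y, p), (w, q)} \<in> nodes C1 \<union> nodes C2" unfolding N joined_def by blast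
    have "{(y, p), (w, q)} \<notin> nodes C2" using S2.node_V[of "{(y, p), (w, q)}"] step.IH disjoint by auto
    then show ?case using e S1.node_V[of "{(y, p), (w, q)}"] by auto
  qed (rule hosts(1))
  have "A = {z \<in> Z. linked ?N ?v (fst (mark C z))}"
  proof (intro set_eqI iffI)
    fix z assume z: "z \<in> A"
    have "linked (nodes C1) ?v (fst (mark C1 z))"
      using S1.conn[OF hosts(1)] S1.mark_props(1)[of z] z by simp
    then have "linked ?N ?v (fst (mark C1 z))" unfolding N by (rule connected_mono) simp
    then show "z \<in> {z \<in> Z. linked ?N ?v (fst (mark C z))}" using z A(1) by (auto simp: C_simps)
  next
    fix z assume "z \<in> {z \<in> Z. linked ?N ?v (fst (mark C z))}"
    then have z: "z \<in> Z" "fst (mark C z) \<in> comps C1" using stay by auto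
    show "z \<in> A"
    proof (rule ccontr)
      assume "z \<notin> A"
      then have "fst (mark C z) \<in> comps C2" using z S2.mark_props(1)[of z] by (simp add: C_simps)
      then show False using z disjoint by blast
    qed
  qed
  then show ?thesis
    unfolding separates_def using new_node_edge by blast
qed

text \<open>
  A component of \<open>C1\<close> sees the whole of \<open>C2\<close> through the new node, at the former place of \<open>c0\<close>.
\<close>

lemma projection_glue1:
  assumes v: "v \<in> comps C1" and z: "z \<in> Z"
  shows "projection C v z = projection C1 v (collapse A c0 z)"
proof (rule S.projectionI)
  let ?p = "projection C1 v (collapse A c0 z)"
  have "collapse A c0 z \<in> insert c0 A" by (simp add: collapse_def)
  then have sees1: "S1.sees v (collapse A c0 z) ?p" by (rule S1.sees_projection[OF v])
  have transfer: "S.toward v m p"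
    if toward1: "S1.toward v m' p" and m: "m = m' \<or> (m' = fst (mark C1 c0) \<and> m \<in> comps C2)" for m m' p
  proof -
    obtain w q where e: "{(v, p), (w, q)} \<in> nodes C1"
      "linked (nodes C1 - {{(v, p), (w, q)}}) w m'" (is "linked (_ - {?e}) _ _")
      using toward1 unfolding S1.toward_def by blast
    have e2: "?e \<notin> nodes C2" using node_nonempty e(1) by blast
    have ne: "new_node \<noteq> ?e" using new_node_fresh e(1) by metis
    have r1: "linked (nodes C - {?e}) w m'"
      using e(2) by (rule connected_mono) (auto simp: C_simps)
    have "linked (nodes C - {?e}) m' m"
    proof (cases "m = m'")
      case False
      then have m: "m' = fst (mark C1 c0)" "m \<in> comps C2" using m by auto
      have "linked (nodes C - {?e}) m' (fst (mark C2 a0))"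
        using ne m(1) by (intro connected_edge[of _ "snd (mark C1 c0)" _ "snd (mark C2 a0)"]) (simp add: C_simps)
      moreover have "linked (nodes C - {?e}) (fst (mark C2 a0)) m"
        using S2.conn[OF hosts(2) m(2)] by (rule connected_mono) (use e2 in \<open>auto simp: C_simps\<close>)
      ultimately show ?thesis by (rule rtrancl_trans)
    qed simp
    then have "linked (nodes C - {?e}) w m" using r1 by (meson rtrancl_trans)
    moreover have "?e \<in> nodes C" using e(1) by (simp add: C_simps)
    ultimately show ?thesis unfolding S.toward_def by blast
  qed
  show "S.sees v z ?p"
  proof (cases "z \<in> A")
    case True
    then have coll: "collapse A c0 z = z" "mark C z = mark C1 z" by (simp_all add: collapse_def C_simps)
    then show ?thesis using sees1 transfer[of "fst (mark C1 z)"] unfolding S.sees_def S1.sees_def by auto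
  next
    case False
    then have coll: "collapse A c0 z = c0" "mark C z = mark C2 z"
      using z by (simp_all add: collapse_def C_simps)
    have host: "fst (mark C2 z) \<in> comps C2" using z False S2.mark_props(1)[of z] by simp
    have "S.toward v (fst (mark C2 z)) ?p"
    proof (cases "mark C1 c0 = (v, ?p)")
      case True
      have "linked (nodes C - {new_node}) (fst (mark C2 a0)) (fst (mark C2 z))"
        using S2.conn[OF hosts(2) host] by (rule connected_mono) (use new_node_fresh in \<open>auto simp: C_simps\<close>)
      moreover have "new_node = {(v, ?p), (fst (mark C2 a0), snd (mark C2 a0))}" using True by simp
      moreover have "new_node \<in> nodes C" by (simp add: C_simps)
      ultimately show ?thesis unfolding S.toward_def by blast
    next
      case neq: False
      then have "S1.toward v (fst (mark C1 c0)) ?p" using sees1 coll by (simp add: S1.sees_def)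
      then show ?thesis using transfer host by blast
    qed
    then show ?thesis using coll by (simp add: S.sees_def)
  qed
qed

lemma restrict_glue1:
  "restrict (moduli_point Z C) (quads (insert c0 A)) = moduli_point (insert c0 A) C1"
proof
  fix q
  show "restrict (moduli_point Z C) (quads (insert c0 A)) q = moduli_point (insert c0 A) C1 q"
  proof (cases "q \<in> quads (insert c0 A)")
    case True
    then obtain a b c d where q: "q = (a, b, c, d)" and Q1: "(a, b, c, d) \<in> quads (insert c0 A)"
      by (cases q) auto
    have Q: "(a, b, c, d) \<in> quads Z" using Q1 A by (auto simp: quads_iff)
    obtain v where v: "v \<in> comps C1" "S1.generic_at v a b c d" using S1.generic_at_exists[OF Q1] .
    have vC: "v \<in> comps C" using v(1) by (simp add: C_simps)
    have proj: "projection C v z = projection C1 v z" if "z \<in> insert c0 A" for z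
      using projection_glue1[OF v(1), of z] that A by (auto simp: collapse_def)
    have Zq: "a \<in> insert c0 A" "b \<in> insert c0 A" "c \<in> insert c0 A" "d \<in> insert c0 A"
      using Q1 by (auto simp: quads_iff)
    note projs = Zq[THEN proj]
    have "S.generic_at v a b c d"
      using v(2) unfolding S.generic_at_def S1.generic_at_def projs .
    then have "moduli_point Z C (a, b, c, d) = S.vcr_at v a b c d"
      by (rule S.moduli_point_value[OF Q vC])
    also have "\<dots> = S1.vcr_at v a b c d" unfolding S.vcr_at_def S1.vcr_at_def projs ..
    also have "\<dots> = moduli_point (insert c0 A) C1 (a, b, c, d)"
      using S1.moduli_point_value[OF Q1 v] by simp
    finally show ?thesis using q Q1 by simp
  qed (simp add: moduli_point_def)
qed

lemma glue_commute: "glue Z (Z - A) c0 a0 C2 C1 = C"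
  using A(1) by (auto simp: glue_def fun_eq_iff insert_commute Un_commute)

lemma restrict_glue2:
  "restrict (moduli_point Z C) (quads (insert a0 (Z - A))) = moduli_point (insert a0 (Z - A)) C2"
proof -
  have dd: "Z - (Z - A) = A" using A(1) by blast
  interpret D: two_curves Z "Z - A" c0 a0 C2 C1
    by unfold_locales (use A stable1 stable2 disjoint dd in auto)
  show ?thesis using D.restrict_glue1 unfolding glue_commute .
qed

text \<open>
  Both systems split along \<open>A\<close>, and a system that splits is the graft of its restrictions.
\<close>

lemma moduli_point_glue:
  assumes "cr_system Z x" "splits Z x A"
    and "moduli_point (insert c0 A) C1 = restrict x (quads (insert c0 A))"
    and "moduli_point (insert a0 (Z - A)) C2 = restrict x (quads (insert a0 (Z - A)))"
  shows "moduli_point Z C = x"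
proof -
  have "new_node \<in> nodes C" by (simp add: C_simps)
  then have "splits Z (moduli_point Z C) A"
    using S.separates_splits new_node_separates by blast
  from graft_of_split[OF S.moduli_point_cr_system this A] graft_of_split[OF assms(1,2) A]
  show ?thesis
    unfolding restrict_glue1 restrict_glue2 assms(3,4) by (rule trans_sym)
qed

end

text \<open>
  The hypothesis \<open>smaller\<close> is the induction hypothesis of \<open>cr_system_realised\<close>.  Stating the step
  separately gives a curve with a node that separates \<open>A\<close> also for \<open>divisor_eq\<close>.
\<close>

lemma realise_split:
  fixes x :: "'z quad \<Rightarrow> 'k::field pline"
  assumes "finite Z" and x: "cr_system Z x" and split: "indexes_divisor Z A" "splits Z x A"
    and smaller: "\<And>W (y :: 'z quad \<Rightarrow> 'k pline) N. W \<subseteq> Z \<Longrightarrow> card W < card Z \<Longrightarrow> 3 \<le> card W \<Longrightarrow>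
      cr_system W y \<Longrightarrow> \<exists>C. stable_curve W C \<and> moduli_point W C = y \<and> (\<forall>v\<in>comps C. N \<le> v)"
  shows "\<exists>C. stable_curve Z C \<and> moduli_point Z C = x \<and> (\<forall>v\<in>comps C. N \<le> v) \<and>
    (\<exists>e\<in>nodes C. separates Z C e A)"
proof -
  obtain a0 c0 where ac: "a0 \<in> A" "c0 \<in> Z - A" "insert c0 A \<subseteq> Z" "insert a0 (Z - A) \<subseteq> Z"
    "card (insert c0 A) < card Z" "card (insert a0 (Z - A)) < card Z"
    "3 \<le> card (insert c0 A)" "3 \<le> card (insert a0 (Z - A))"
    using indexes_divisor_cut[OF assms(1) split(1)] .
  obtain C1 where C1: "stable_curve (insert c0 A) C1"
    "moduli_point (insert c0 A) C1 = restrict x (quads (insert c0 A))" "\<forall>v\<in>comps C1. N \<le> v"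
    using smaller[OF ac(3,5,7) cr_system_restrict[OF x ac(3)]] by blast
  \<comment> \<open>The components of the second curve are numbered beyond those of the first.\<close>
  define N' where "N' = Suc (Max (insert N (comps C1)))"
  obtain C2 where C2: "stable_curve (insert a0 (Z - A)) C2"
    "moduli_point (insert a0 (Z - A)) C2 = restrict x (quads (insert a0 (Z - A)))"
    "\<forall>v\<in>comps C2. N' \<le> v"
    using smaller[OF ac(4,6,8) cr_system_restrict[OF x ac(4)]] by blast
  have fin: "finite (insert N (comps C1))" using C1(1) by (simp add: stable_curve_def)
  have "v < N'" if "v \<in> insert N (comps C1)" for v
    using Max_ge[OF fin that] by (simp add: N'_def)
  then have less: "N < N'" "\<And>v. v \<in> comps C1 \<Longrightarrow> v < N'" by blast+
  have disj: "comps C1 \<inter> comps C2 = {}" using less(2) C2(3) by (meson disjoint_iff not_le)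
  have "A \<subseteq> Z" using split(1) by (simp add: indexes_divisor_def)
  then interpret two_curves Z A a0 c0 C1 C2
    using ac(1,2) C1(1) C2(1) disj by unfold_locales
  have "new_node \<in> nodes C" by (simp add: C_simps)
  moreover have "\<forall>v\<in>comps C. N \<le> v"
    using C1(3) C2(3) less(1) unfolding C_simps(1) by (metis Un_iff le_trans less_imp_le)
  ultimately show ?thesis
    using stable_glue moduli_point_glue[OF x split(2) C1(2) C2(2)] new_node_separates by blast
qed

theorem cr_system_realised:
  fixes x :: "'z quad \<Rightarrow> 'k::field pline"
  assumes "finite Z" "3 \<le> card Z" "cr_system Z x"
  shows "\<exists>C. stable_curve Z C \<and> moduli_point Z C = x \<and> (\<forall>v\<in>comps C. N \<le> v)"
  using assms
proof (induction "card Z" arbitrary: Z x N rule: less_induct)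
  case less
  show ?case
  proof (cases "\<forall>q\<in>quads Z. x q \<noteq> Fin 1")
    case True
    then obtain u where u: "config Z u" "x = cr_of Z u"
      using nondegenerate_system_is_config[OF less.prems(3,2)] by blast
    obtain C :: "('z, 'k) pointed_curve" where "stable_curve Z C" "moduli_point Z C = cr_of Z u" "comps C = {N}"
      by (rule smooth_curve[OF less.prems(2) u(1)])
    then show ?thesis using u(2) by (intro exI[of _ C]) simp
  next
    case False
    then obtain a b c d where Q: "(a, b, c, d) \<in> quads Z" "x (a, b, c, d) = Fin 1"
      by (metis surj_pair)
    obtain A where A: "A \<subseteq> Z" "a \<in> A" "b \<in> A" "c \<notin> A" "d \<notin> A" "splits Z x A"
      by (rule quartet_extends_to_split[OF less.prems(3) Q])
    have "indexes_divisor Z A" by (rule indexes_divisor_quartet[OF less.prems(1) Q(1) A(1-5)])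
    from realise_split[OF less.prems(1,3) this A(6)] show ?thesis
      using less.hyps finite_subset[OF _ less.prems(1)] by blast
  qed
qed

theorem Mbar_eq:
  assumes "finite Z" "3 \<le> card Z"
  shows "Mbar Z = {x. cr_system Z x}"
proof -
  have "cr_system Z (moduli_point Z C)" if "stable_curve Z C" for C
    by (rule stable_pointed.moduli_point_cr_system) (unfold_locales, rule that)
  then show ?thesis
    using cr_system_realised[OF assms] unfolding Mbar_def by blast
qed

theorem divisor_eq:
  assumes "finite Z" "indexes_divisor Z A"
  shows "divisor Z A = {x. cr_system Z x \<and> splits Z x A}"
proof (intro set_eqI iffI)
  fix x assume "x \<in> divisor Z A"
  then obtain C e where C: "stable_curve Z C" "x = moduli_point Z C" "e \<in> nodes C" "separates Z C e A"
    by (auto simp: divisor_def)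
  interpret stable_pointed Z C by unfold_locales (rule C(1))
  show "x \<in> {x. cr_system Z x \<and> splits Z x A}"
    using moduli_point_cr_system separates_splits[OF C(3,4)] C(2) by simp
next
  fix x assume "x \<in> {x. cr_system Z x \<and> splits Z x A}"
  then have x: "cr_system Z x" "splits Z x A" by auto
  have "\<exists>C. stable_curve Z C \<and> moduli_point Z C = x \<and> (\<forall>v\<in>comps C. 0 \<le> v) \<and>
      (\<exists>e\<in>nodes C. separates Z C e A)"
    using cr_system_realised finite_subset[OF _ assms(1)] by (intro realise_split assms x) blast
  then show "x \<in> divisor Z A" unfolding divisor_def by blast
qed

section \<open>The boundary divisors are pairwise distinct\<close>

text \<open>
  The partition of the marked points into \<open>G\<close> and its complement induces the splitting \<open>ab|cd\<close>.
\<close>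

definition displays :: "'z set \<Rightarrow> 'z \<Rightarrow> 'z \<Rightarrow> 'z \<Rightarrow> 'z \<Rightarrow> bool" where
  "displays G a b c d \<longleftrightarrow> (a \<in> G) = (b \<in> G) \<and> (c \<in> G) = (d \<in> G) \<and> (a \<in> G) \<noteq> (c \<in> G)"

lemma config_exists:
  assumes "finite Z"
  obtains u :: "'z \<Rightarrow> 'k::alg_closed_field \<times> 'k" where "config Z u"
proof -
  obtain T :: "'k set" where T: "finite T" "card T = card Z"
    using infinite_arbitrarily_large[OF alg_closed_infinite] by blast
  then obtain f where f: "inj_on f Z" "f ` Z \<subseteq> T"
    using card_le_inj[OF assms T(1)] by auto
  have "config Z (\<lambda>z. (f z, 1))"
    using f(1) by (auto simp: config_def det2_def inj_on_def)
  then show ?thesis by (rule that)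
qed

text \<open>
  The moduli point of a curve with two components, on which the marked points and the node are
  pairwise distinct: a graft of two configurations.
\<close>

lemma general_point_of_divisor:
  assumes "finite Z" "indexes_divisor Z E"
  obtains x :: "'z quad \<Rightarrow> 'k::alg_closed_field pline" where "cr_system Z x" "splits Z x E"
    "\<And>a b c d. (a, b, c, d) \<in> quads Z \<Longrightarrow> x (a, b, c, d) = Fin 1 \<Longrightarrow> displays E a b c d"
proof -
  have E: "E \<subseteq> Z" using assms(2) by (simp add: indexes_divisor_def)
  obtain a0 c0 where ac: "a0 \<in> E" "c0 \<in> Z - E" using indexes_divisor_cut[OF assms] by metis
  have fin: "finite (insert c0 E)" "finite (insert a0 (Z - E))" using assms(1) E finite_subset by auto
  obtain y :: "'z \<Rightarrow> 'k \<times> 'k" where y: "config (insert c0 E) y" using config_exists[OF fin(1)] .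
  obtain w :: "'z \<Rightarrow> 'k \<times> 'k" where w: "config (insert a0 (Z - E)) w" using config_exists[OF fin(2)] .
  define x where "x = graft Z E a0 c0 (cr_of (insert c0 E) y) (cr_of (insert a0 (Z - E)) w)"
  have "in_closure (quads Z) (open_part Z) x"
    unfolding x_def by (rule graft_of_configs_in_closure[OF assms(1) E ac y w])
  then have sys: "cr_system Z x"
    by (rule cr_system_closed) (auto simp: open_part_def cr_system_cr_of)
  have x_val: "x (a, b, c, d) = (if survives E c0 (a, b, c, d)
        then cr_of (insert c0 E) y (collapse4 E c0 (a, b, c, d))
      else if survives (Z - E) a0 (a, b, c, d)
        then cr_of (insert a0 (Z - E)) w (collapse4 (Z - E) a0 (a, b, c, d))
      else if (a \<in> E) = (b \<in> E) then Fin 1 else if (a \<in> E) = (c \<in> E) then Fin 0 else Infty)"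
    if "(a, b, c, d) \<in> quads Z" for a b c d
    using that by (simp add: x_def graft_def graft_by.simps)
  have "splits Z x E"
    unfolding splits_def
  proof (intro ballI impI)
    fix a b c d assume abcd: "a \<in> E" "b \<in> E" "c \<in> Z - E" "d \<in> Z - E" "a \<noteq> b" "c \<noteq> d"
    then have Q: "(a, b, c, d) \<in> quads Z" using E by (auto simp: quads_iff)
    have "\<not> survives E c0 (a, b, c, d)"
      using abcd ac collapse4_quads_iff[OF Q, of c0 E] by auto
    moreover have "\<not> survives (Z - E) a0 (a, b, c, d)"
      using abcd ac collapse4_quads_iff[OF Q, of a0 "Z - E"] by auto
    ultimately show "x (a, b, c, d) = Fin 1" using x_val[OF Q] abcd by simp
  qed
  moreover have "displays E a b c d" if Q: "(a, b, c, d) \<in> quads Z" and one: "x (a, b, c, d) = Fin 1" for a b c d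
  proof -
    have 1: "\<not> survives E c0 (a, b, c, d)"
    proof
      assume in1: "survives E c0 (a, b, c, d)"
      then have "cr_of (insert c0 E) y (collapse4 E c0 (a, b, c, d)) \<noteq> Fin 1"
        using open_part_no_splits[OF y] by (simp add: collapse4_def)
      then show False using x_val[OF Q] in1 one by simp
    qed
    have 2: "\<not> survives (Z - E) a0 (a, b, c, d)"
    proof
      assume in2: "survives (Z - E) a0 (a, b, c, d)"
      then have "cr_of (insert a0 (Z - E)) w (collapse4 (Z - E) a0 (a, b, c, d)) \<noteq> Fin 1"
        using open_part_no_splits[OF w] by (simp add: collapse4_def)
      then show False using x_val[OF Q] 1 in2 one by simp
    qed
    have ab: "(a \<in> E) = (b \<in> E)"
      using x_val[OF Q] 1 2 one by (auto split: if_splits)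
    have "a \<in> Z" "b \<in> Z" "c \<in> Z" "d \<in> Z" using Q by (auto simp: quads_iff)
    then show ?thesis
      using ab 1 2 ac collapse4_quads_iff[OF Q, of c0 E] collapse4_quads_iff[OF Q, of a0 "Z - E"]
      by (cases "a \<in> E"; cases "b \<in> E"; cases "c \<in> E"; cases "d \<in> E") (simp_all add: displays_def)
  qed
  ultimately show ?thesis using that sys by blast
qed

lemma indexes_divisor_complement:
  assumes "finite Z" "indexes_divisor Z E"
  shows "indexes_divisor Z (Z - E)"
proof -
  have E: "E \<subseteq> Z" using assms(2) by (simp add: indexes_divisor_def)
  then have "finite E" using assms(1) finite_subset by blast
  then show ?thesis
    using assms E card_mono[OF assms(1) E] by (auto simp: indexes_divisor_def card_Diff_subset)
qed

lemma displays_all_eq: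
  assumes fin: "finite Z" and E: "indexes_divisor Z E" and G: "indexes_divisor Z G"
    and disp: "\<And>a b c d. a \<in> G \<Longrightarrow> b \<in> G \<Longrightarrow> c \<in> Z - G \<Longrightarrow> d \<in> Z - G \<Longrightarrow> a \<noteq> b \<Longrightarrow> c \<noteq> d \<Longrightarrow>
      displays E a b c d"
  shows "E = G \<or> E = Z - G"
proof -
  have sub: "E \<subseteq> Z" "G \<subseteq> Z" using E G by (auto simp: indexes_divisor_def)
  have "2 \<le> card G" "2 \<le> card (Z - G)"
    using G indexes_divisor_complement[OF fin G] by (simp_all add: indexes_divisor_def)
  then obtain a b c d where abcd: "a \<in> G" "b \<in> G" "a \<noteq> b" "c \<in> Z - G" "d \<in> Z - G" "c \<noteq> d"
  proof -
    obtain S where S: "S \<subseteq> G" "card S = 2" by (rule obtain_subset_with_card_n[OF \<open>2 \<le> card G\<close>])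
    obtain T where T: "T \<subseteq> Z - G" "card T = 2" by (rule obtain_subset_with_card_n[OF \<open>2 \<le> card (Z - G)\<close>])
    show ?thesis using S T that unfolding card_2_iff by auto
  qed
  have G_const: "(x \<in> E) = (a \<in> E)" if "x \<in> G" for x
    using disp[of a x c d] abcd that by (cases "x = a") (auto simp: displays_def)
  have C_const: "(x \<in> E) = (a \<notin> E)" if "x \<in> Z - G" for x
    using disp[of a b c x] disp[of a b c d] abcd that by (cases "x = c") (auto simp: displays_def)
  show ?thesis using G_const C_const sub by (cases "a \<in> E") blast+
qed

text \<open>
  The general point of the first divisor splits along \<open>G\<close> only if \<open>E\<close> induces all quartets of \<open>G\<close>.
\<close>

lemma divisor_eqD:
  assumes "finite Z" "indexes_divisor Z E" "indexes_divisor Z G"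
    and eq: "(divisor Z E :: ('z quad \<Rightarrow> 'k::alg_closed_field pline) set) = divisor Z G"
  shows "E = G \<or> E = Z - G"
proof -
  obtain x :: "'z quad \<Rightarrow> 'k pline" where x: "cr_system Z x" "splits Z x E"
    "\<And>a b c d. (a, b, c, d) \<in> quads Z \<Longrightarrow> x (a, b, c, d) = Fin 1 \<Longrightarrow> displays E a b c d"
    using general_point_of_divisor[OF assms(1,2)] by blast
  have "x \<in> divisor Z G" using x(1,2) eq divisor_eq[OF assms(1,2)] by auto
  then have G: "splits Z x G" using divisor_eq[OF assms(1,3)] by auto
  have "G \<subseteq> Z" using assms(3) by (simp add: indexes_divisor_def)
  show ?thesis
  proof (rule displays_all_eq[OF assms(1-3)])
    fix a b c d assume "a \<in> G" "b \<in> G" "c \<in> Z - G" "d \<in> Z - G" "a \<noteq> b" "c \<noteq> d"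
    then show "displays E a b c d"
      using G \<open>G \<subseteq> Z\<close> by (intro x(3)) (auto simp: splits_def quads_iff)
  qed
qed

lemma divisor_complement:
  assumes "finite Z" "indexes_divisor Z E"
  shows "divisor Z (Z - E) = divisor Z E"
proof -
  have E: "E \<subseteq> Z" using assms(2) by (simp add: indexes_divisor_def)
  have ind: "indexes_divisor Z (Z - E)" by (rule indexes_divisor_complement[OF assms])
  have dd: "Z - (Z - E) = E" using E by blast
  have "splits Z x (Z - E) \<longleftrightarrow> splits Z x E" if "cr_system Z x" for x :: "_ \<Rightarrow> 'b pline"
    using splits_complement[OF that, of E] splits_complement[OF that, of "Z - E"] E dd by auto
  then show "divisor Z (Z - E) = (divisor Z E :: (_ \<Rightarrow> 'b pline) set)"
    unfolding divisor_eq[OF assms] divisor_eq[OF assms(1) ind] by auto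
qed

section \<open>Which quartets can be displayed\<close>

definition cuts :: "'z set \<Rightarrow> 'z set \<Rightarrow> bool" where
  "cuts G S \<longleftrightarrow> S \<inter> G \<noteq> {} \<and> S - G \<noteq> {}"

definition undisplayed :: "'z set set \<Rightarrow> 'z set \<Rightarrow> 'z set \<Rightarrow> bool" where
  "undisplayed \<Gamma> E F \<longleftrightarrow> (\<exists>a\<in>E. \<exists>b\<in>E. \<exists>c\<in>F. \<exists>d\<in>F. a \<noteq> b \<and> c \<noteq> d \<and> (\<forall>G\<in>\<Gamma>. \<not> displays G a b c d))"

lemma displays_flip: "displays G a b c d \<longleftrightarrow> displays G c d a b"
  by (auto simp: displays_def)

lemma undisplayed_flip: "undisplayed \<Gamma> E F \<Longrightarrow> undisplayed \<Gamma> F E"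
  unfolding undisplayed_def using displays_flip by metis

text \<open>
  A set \<open>G\<close> fails to induce \<open>ab|cd\<close> as soon as it separates \<open>c\<close> from \<open>d\<close>, or does not separate \<open>c\<close> from one
  of \<open>a\<close> and \<open>b\<close>.  The points \<open>e1\<close> and \<open>e2\<close> may be equal; then any other point of \<open>E\<close> serves as the second
  one.
\<close>

lemma undisplayedI:
  assumes "2 \<le> card E" "e1 \<in> E" "e2 \<in> E" "c \<in> F" "d \<in> F" "c \<noteq> d"
    and "\<And>G. G \<in> \<Gamma> \<Longrightarrow> (c \<in> G) \<noteq> (d \<in> G) \<or> (e1 \<in> G) = (c \<in> G) \<or> (e2 \<in> G) = (c \<in> G)"
  shows "undisplayed \<Gamma> E F"
proof -
  have "\<not> E \<subseteq> {e1}" using assms(1) card_mono[of "{e1}" E] by auto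
  then obtain e where e: "e \<in> E" "e \<noteq> e1" by blast
  define e' where "e' = (if e2 = e1 then e else e2)"
  have "e' \<in> E" "e1 \<noteq> e'" using e assms(3) by (auto simp: e'_def)
  moreover have "\<not> displays G e1 e' c d" if "G \<in> \<Gamma>" for G
    using assms(7)[OF that] by (auto simp: displays_def e'_def split: if_splits)
  ultimately show ?thesis unfolding undisplayed_def using assms by blast
qed

lemma cuts_match:
  assumes "cuts G E"
  obtains e where "e \<in> E" "(e \<in> G) = (c \<in> G)"
  using assms by (cases "c \<in> G") (auto simp: cuts_def)

lemma cuts_pair:
  assumes "cuts G E"
  obtains c d where "c \<in> E" "d \<in> E" "c \<noteq> d" "(c \<in> G) \<noteq> (d \<in> G)"
  using assms by (auto simp: cuts_def)

lemma undisplayed_two_one: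
  assumes "2 \<le> card E" "cuts G1 E" "cuts G2 E" "cuts G3 F"
  shows "undisplayed {G1, G2, G3} E F"
proof -
  obtain c d where cd: "c \<in> F" "d \<in> F" "c \<noteq> d" "(c \<in> G3) \<noteq> (d \<in> G3)" using cuts_pair[OF assms(4)] .
  obtain e1 where e1: "e1 \<in> E" "(e1 \<in> G1) = (c \<in> G1)" using cuts_match[OF assms(2)] .
  obtain e2 where e2: "e2 \<in> E" "(e2 \<in> G2) = (c \<in> G2)" using cuts_match[OF assms(3)] .
  show ?thesis
    by (rule undisplayedI[OF assms(1) e1(1) e2(1) cd(1-3)]) (use e1 e2 cd in auto)
qed

text \<open>
  If the union belongs to \<open>\<Gamma>\<close> and \<open>c\<close> lies outside it, a point of \<open>E\<close> outside the union matches \<open>c\<close>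
  for all three sets at once.  Otherwise \<open>c\<close> lies in \<open>A\<close> or in \<open>B\<close>, and the point that matches it there also matches it for the union.
\<close>

lemma undisplayed_same_side:
  assumes "2 \<le> card E" "2 \<le> card F" "cuts A E" "cuts B E"
    and U: "\<Gamma> \<subseteq> {A, B, A \<union> B}" "A \<union> B \<in> \<Gamma> \<Longrightarrow> cuts (A \<union> B) E"
  shows "undisplayed \<Gamma> E F"
proof -
  have "F \<noteq> {}" using assms(2) by auto
  then obtain c where c: "c \<in> F" by blast
  have "\<not> F \<subseteq> {c}" using assms(2) card_mono[of "{c}" F] by auto
  then obtain d where d: "d \<in> F" "c \<noteq> d" by blast
  obtain eA where eA: "eA \<in> E" "(eA \<in> A) = (c \<in> A)" using cuts_match[OF assms(3)] .
  obtain eB where eB: "eB \<in> E" "(eB \<in> B) = (c \<in> B)" using cuts_match[OF assms(4)] .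
  show ?thesis
  proof (cases "c \<in> A \<union> B \<or> A \<union> B \<notin> \<Gamma>")
    case True
    show ?thesis
      by (rule undisplayedI[OF assms(1) eA(1) eB(1) c d]) (use eA eB U(1) True in blast)
  next
    case False
    then obtain e where "e \<in> E" "e \<notin> A \<union> B" using U(2) by (auto simp: cuts_def)
    then show ?thesis
      using False U(1) by (intro undisplayedI[OF assms(1) _ _ c d, of e e]) auto
  qed
qed

lemma cuts_or_cuts:
  assumes "indexes_divisor Z G" "E \<subseteq> Z" "E \<noteq> G" "Z - E \<noteq> G"
  shows "cuts G E \<or> cuts G (Z - E)"
proof (rule ccontr)
  assume "\<not> ?thesis"
  moreover have "G \<subseteq> Z" "G \<noteq> {}" "G \<noteq> Z" using assms(1) by (auto simp: indexes_divisor_def)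
  ultimately show False using assms(2-4) unfolding cuts_def by blast
qed

text \<open>
  A member of \<open>\<Gamma>\<close> is neither \<open>E\<close> nor its complement, so it cuts one of them.  If all members cut the
  same side, two points of that side match a point of the other side for all of them; otherwise one set cuts one side and the remaining
  ones can be taken to cut the other.
\<close>

lemma undisplayed_quartet_exists:
  assumes "finite Z" "indexes_divisor Z E"
    and \<Gamma>: "\<Gamma> = {A, B} \<or> \<Gamma> = {A, B, A \<union> B}" "\<And>G. G \<in> \<Gamma> \<Longrightarrow> indexes_divisor Z G"
    and notin: "E \<notin> \<Gamma>" "Z - E \<notin> \<Gamma>"
  shows "undisplayed \<Gamma> E (Z - E)"
proof -
  have E: "E \<subseteq> Z" "2 \<le> card E" using assms(2) by (auto simp: indexes_divisor_def)
  have card_C: "2 \<le> card (Z - E)"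
    using indexes_divisor_complement[OF assms(1,2)] by (simp add: indexes_divisor_def)
  have cut: "cuts G E \<or> cuts G (Z - E)" if "G \<in> \<Gamma>" for G
    using cuts_or_cuts[OF \<Gamma>(2)[OF that] E(1)] that notin by blast
  note two_one = undisplayed_two_one[OF E(2), where F = "Z - E"]
    undisplayed_flip[OF undisplayed_two_one[OF card_C, where F = E]]
  note same = undisplayed_same_side[OF E(2) card_C, of A B \<Gamma>]
    undisplayed_flip[OF undisplayed_same_side[OF card_C E(2), of A B \<Gamma>]]
  from \<Gamma>(1) show ?thesis
  proof
    assume G: "\<Gamma> = {A, B}"
    consider "cuts A E" "cuts B E" | "cuts A (Z - E)" "cuts B (Z - E)"
      | "cuts A E" "cuts B (Z - E)" | "cuts B E" "cuts A (Z - E)"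
      using cut G by blast
    then show ?thesis
    proof cases
      case 1
      then have "A \<union> B \<in> \<Gamma> \<Longrightarrow> cuts (A \<union> B) E" using G by (metis insertE singletonD)
      then show ?thesis using same(1) 1 G by blast
    next
      case 2
      then have "A \<union> B \<in> \<Gamma> \<Longrightarrow> cuts (A \<union> B) (Z - E)" using G by (metis insertE singletonD)
      then show ?thesis using same(2) 2 G by blast
    next
      case 3
      then show ?thesis using two_one(1)[of A A B] G by simp
    next
      case 4
      then show ?thesis using two_one(1)[of B B A] G by (simp add: insert_commute)
    qed
  next
    assume G: "\<Gamma> = {A, B, A \<union> B}"
    let ?U = "A \<union> B"
    have perm: "{A, ?U, B} = \<Gamma>" "{B, ?U, A} = \<Gamma>" "{A, B, ?U} = \<Gamma>" using G by auto
    have c: "cuts A E \<or> cuts A (Z - E)" "cuts B E \<or> cuts B (Z - E)" "cuts ?U E \<or> cuts ?U (Z - E)"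
      using cut G by auto
    consider "cuts A E" "cuts B E" "cuts ?U E" | "cuts A (Z - E)" "cuts B (Z - E)" "cuts ?U (Z - E)"
      | "cuts A E" "cuts B E" "cuts ?U (Z - E)" | "cuts A E" "cuts ?U E" "cuts B (Z - E)"
      | "cuts B E" "cuts ?U E" "cuts A (Z - E)" | "cuts A (Z - E)" "cuts B (Z - E)" "cuts ?U E"
      | "cuts A (Z - E)" "cuts ?U (Z - E)" "cuts B E" | "cuts B (Z - E)" "cuts ?U (Z - E)" "cuts A E"
      using c by argo
    then show ?thesis
    proof cases
      case 1
      then show ?thesis using same(1) G by simp
    next
      case 2
      then show ?thesis using same(2) G by simp
    qed (use two_one perm in metis)+
  qed
qed

text \<open>
  Three sets would be needed, inducing different splittings.  But if \<open>A\<close> and \<open>B\<close> induce different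
  splittings, each contains two of the four points, and they share just one; so the union contains
  three of them and induces no splitting.
\<close>

lemma not_all_quartets_displayed:
  assumes "\<Gamma> \<subseteq> {A, B, A \<union> B}"
  shows "\<not> ((\<exists>G\<in>\<Gamma>. displays G a b c d) \<and> (\<exists>G\<in>\<Gamma>. displays G a c b d) \<and> (\<exists>G\<in>\<Gamma>. displays G a d b c))"
proof
  assume "(\<exists>G\<in>\<Gamma>. displays G a b c d) \<and> (\<exists>G\<in>\<Gamma>. displays G a c b d) \<and> (\<exists>G\<in>\<Gamma>. displays G a d b c)"
  then obtain G1 G2 G3 where D: "displays G1 a b c d" "displays G2 a c b d" "displays G3 a d b c"
    and \<Gamma>: "G1 \<in> \<Gamma>" "G2 \<in> \<Gamma>" "G3 \<in> \<Gamma>"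
    by (elim conjE bexE) metis
  have G: "G1 = A \<or> G1 = B \<or> G1 = A \<union> B" "G2 = A \<or> G2 = B \<or> G2 = A \<union> B"
      "G3 = A \<or> G3 = B \<or> G3 = A \<union> B"
    using \<Gamma>[THEN subsetD[OF assms]] by simp_all
  have excl: False if "displays G a b c d \<and> displays G a c b d \<or> displays G a b c d \<and> displays G a d b c \<or>
      displays G a c b d \<and> displays G a d b c" for G
    using that unfolding displays_def by argo
  have ne: "G1 \<noteq> G2" "G1 \<noteq> G3" "G2 \<noteq> G3"
    using D excl by metis+
  have D': "displays G1 a b d c" "displays G2 a c d b" "displays G3 a d c b"
    using D unfolding displays_def by argo+
  have three: False if "displays A p q r s" "displays B p r q s" "displays (A \<union> B) p s q r" for p q r s
    using that unfolding displays_def Un_iff by argo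
  consider "G1 = A" "G2 = B" "G3 = A \<union> B" | "G1 = A" "G3 = B" "G2 = A \<union> B" | "G2 = A" "G1 = B" "G3 = A \<union> B"
    | "G2 = A" "G3 = B" "G1 = A \<union> B" | "G3 = A" "G1 = B" "G2 = A \<union> B" | "G3 = A" "G2 = B" "G1 = A \<union> B"
    using G ne by metis
  then show False
  proof cases
    case 1
    show ?thesis by (rule three[of a b c d]) (use D 1 in simp_all)
  next
    case 2
    show ?thesis by (rule three[of a b d c]) (use D D' 2 in simp_all)
  next
    case 3
    show ?thesis by (rule three[of a c b d]) (use D D' 3 in simp_all)
  next
    case 4
    show ?thesis by (rule three[of a c d b]) (use D D' 4 in simp_all)
  next
    case 5
    show ?thesis by (rule three[of a d b c]) (use D D' 5 in simp_all)
  next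
    case 6
    show ?thesis by (rule three[of a d c b]) (use D D' 6 in simp_all)
  qed
qed

section \<open>The affine chart\<close>

lemma polynomial_funs_cong:
  assumes "p \<in> polynomial_funs N" "\<And>i. i < N \<Longrightarrow> v i = w i"
  shows "p v = p w"
  using assms by induction auto

lemma open_part_cr_system: "m \<in> open_part Z \<Longrightarrow> cr_system Z m"
  by (auto simp: open_part_def cr_system_cr_of)

lemma open_part_finite:
  assumes "m \<in> open_part Z" "(a, b, c, d) \<in> quads Z"
  shows "m (a, b, c, d) \<noteq> Infty"
proof -
  have "(a, d, b, c) \<in> quads Z" using assms(2) by (auto simp: quads_iff)
  moreover obtain u where "config Z u" "m = cr_of Z u" using assms(1) by (auto simp: open_part_def)
  ultimately have "m (a, d, b, c) \<noteq> Fin 1" by (simp add: open_part_no_splits)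
  then show ?thesis
    using cr_infty_iff_one[OF open_part_cr_system[OF assms(1)] assms(2)] by simp
qed

text \<open>
  A quadruple is bounded if no divisor in question separates \<open>{a, d}\<close> from \<open>{b, c}\<close>, the splitting at
  which the cross-ratio is infinite.
\<close>

definition bounded_quads :: "'z set \<Rightarrow> 'z set set \<Rightarrow> 'z quad set" where
  "bounded_quads Z \<Gamma> = {(a, b, c, d) \<in> quads Z. \<forall>G\<in>\<Gamma>. \<not> displays G a d b c}"

lemma bounded_quads_iff:
  "(a, b, c, d) \<in> bounded_quads Z \<Gamma> \<longleftrightarrow> (a, b, c, d) \<in> quads Z \<and> (\<forall>G\<in>\<Gamma>. \<not> displays G a d b c)"
  by (simp add: bounded_quads_def)

text \<open>
  A pole of the cross-ratio of \<open>(a, b, c, d)\<close> is a quartet \<open>ad|bc\<close>, which extends to a split, so the point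
  lies on a divisor; this gives one inclusion.  For the other, a point on a divisor that does
  not come from \<open>\<Gamma>\<close> has a pole at a bounded quadruple, namely at a quartet of that divisor which no
  member of \<open>\<Gamma>\<close> induces.
\<close>

lemma partial_compactification_eq:
  fixes Z :: "'z set"
  assumes fin: "finite Z" "3 \<le> card Z" and \<Gamma>: "\<And>G. G \<in> \<Gamma> \<Longrightarrow> indexes_divisor Z G"
    and und: "\<And>E. indexes_divisor Z E \<Longrightarrow> E \<notin> \<Gamma> \<Longrightarrow> Z - E \<notin> \<Gamma> \<Longrightarrow> undisplayed \<Gamma> E (Z - E)"
  shows "partial_compactification Z (divisor Z ` \<Gamma>) =
    {x :: 'z quad \<Rightarrow> 'k::alg_closed_field pline. cr_system Z x \<and> (\<forall>r\<in>bounded_quads Z \<Gamma>. x r \<noteq> Infty)}"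
    (is "?X = ?R")
proof (intro set_eqI iffI)
  fix x :: "'z quad \<Rightarrow> 'k pline"
  assume "x \<in> ?X"
  then have sys: "cr_system Z x"
    and avoid: "\<And>E. indexes_divisor Z E \<Longrightarrow> splits Z x E \<Longrightarrow>
      (divisor Z E :: (_ \<Rightarrow> 'k pline) set) \<in> divisor Z ` \<Gamma>"
    using Mbar_eq[OF fin] divisor_eq[OF fin(1)]
    unfolding partial_compactification_def boundary_divisors_def by blast+
  have "x (a, b, c, d) \<noteq> Infty" if r: "(a, b, c, d) \<in> bounded_quads Z \<Gamma>" for a b c d
  proof
    assume inf: "x (a, b, c, d) = Infty"
    have Q: "(a, b, c, d) \<in> quads Z" "(a, d, b, c) \<in> quads Z"
      using r by (auto simp: bounded_quads_iff quads_iff)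
    have "x (a, d, b, c) = Fin 1" using cr_infty_iff_one[OF sys Q(1)] inf by simp
    then obtain E where E: "E \<subseteq> Z" "a \<in> E" "d \<in> E" "b \<notin> E" "c \<notin> E" "splits Z x E"
      using quartet_extends_to_split[OF sys Q(2)] by metis
    have ind: "indexes_divisor Z E" by (rule indexes_divisor_quartet[OF fin(1) Q(2) E(1-5)])
    obtain G where G: "G \<in> \<Gamma>" "(divisor Z E :: (_ \<Rightarrow> 'k pline) set) = divisor Z G"
      using avoid[OF ind E(6)] by blast
    have "E = G \<or> E = Z - G" by (rule divisor_eqD[OF fin(1) ind \<Gamma>[OF G(1)] G(2)])
    then have "displays G a d b c" using E(2-5) Q(1) by (auto simp: displays_def quads_iff)
    then show False using r G(1) by (auto simp: bounded_quads_iff)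
  qed
  then show "x \<in> ?R" using sys by auto
next
  fix x :: "'z quad \<Rightarrow> 'k pline"
  assume "x \<in> ?R"
  then have sys: "cr_system Z x" and bounded: "\<And>r. r \<in> bounded_quads Z \<Gamma> \<Longrightarrow> x r \<noteq> Infty" by auto
  have "x \<notin> (divisor Z E :: (_ \<Rightarrow> 'k pline) set)"
    if ind: "indexes_divisor Z E" and out: "(divisor Z E :: (_ \<Rightarrow> 'k pline) set) \<notin> divisor Z ` \<Gamma>" for E
  proof
    assume "x \<in> divisor Z E"
    then have split: "splits Z x E" using divisor_eq[OF fin(1) ind] by auto
    have "Z - E \<notin> \<Gamma>" using out divisor_complement[OF fin(1) ind, where 'b = 'k] by (metis imageI)
    moreover have "E \<notin> \<Gamma>" using out by blast
    ultimately obtain a b c d where abcd: "a \<in> E" "b \<in> E" "c \<in> Z - E" "d \<in> Z - E" "a \<noteq> b" "c \<noteq> d"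
      "\<forall>G\<in>\<Gamma>. \<not> displays G a b c d"
      using und[OF ind] unfolding undisplayed_def by blast
    have "E \<subseteq> Z" using ind by (simp add: indexes_divisor_def)
    then have Q: "(a, c, d, b) \<in> quads Z" using abcd by (auto simp: quads_iff)
    then have "x (a, c, d, b) \<noteq> Infty" using bounded abcd(7) by (auto simp: bounded_quads_iff)
    moreover have "x (a, b, c, d) = Fin 1" using split abcd by (auto simp: splits_def)
    ultimately show False using cr_infty_iff_one[OF sys Q] by simp
  qed
  then show "x \<in> ?X"
    using sys Mbar_eq[OF fin] unfolding partial_compactification_def boundary_divisors_def by blast
qed

locale affine_chart =
  fixes Z :: "'z set" and \<Gamma> :: "'z set set" and N :: nat and q :: "nat \<Rightarrow> 'z quad"
  assumes finite_Z: "finite Z" and card_Z: "3 \<le> card Z"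
    and not_all: "\<And>a b c d. \<not> ((\<exists>G\<in>\<Gamma>. displays G a b c d) \<and> (\<exists>G\<in>\<Gamma>. displays G a c b d) \<and>
      (\<exists>G\<in>\<Gamma>. displays G a d b c))"
    and enum: "bij_betw q {..<N} (bounded_quads Z \<Gamma>)"
begin

definition domain :: "('z quad \<Rightarrow> 'k::alg_closed_field pline) set" where
  "domain = {x. cr_system Z x \<and> (\<forall>r\<in>bounded_quads Z \<Gamma>. x r \<noteq> Infty)}"

definition coords :: "('z quad \<Rightarrow> 'k::alg_closed_field pline) \<Rightarrow> nat \<Rightarrow> 'k" where
  "coords x = (\<lambda>j\<in>{..<N}. numer x (q j))"

text \<open>
  The affine model: the Zariski closure of the bounded cross-ratios of configurations.
\<close>

definition image_closure :: "(nat \<Rightarrow> 'k::alg_closed_field) set" where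
  "image_closure = {v \<in> {..<N} \<rightarrow>\<^sub>E UNIV. \<forall>p\<in>polynomial_funs N.
     (\<forall>m\<in>open_part Z. p (coords m) = 0) \<longrightarrow> p v = 0}"

definition idx :: "'z quad \<Rightarrow> nat" where
  "idx r = inv_into {..<N} q r"

lemma idx: "r \<in> bounded_quads Z \<Gamma> \<Longrightarrow> idx r < N" "r \<in> bounded_quads Z \<Gamma> \<Longrightarrow> q (idx r) = r"
  using enum inv_into_into[of r q "{..<N}"] f_inv_into_f[of r q "{..<N}"]
  by (auto simp: idx_def bij_betw_def)

lemma q_bounded: "j < N \<Longrightarrow> q j \<in> bounded_quads Z \<Gamma>"
  using enum by (auto simp: bij_betw_def)

lemma idx_q: "j < N \<Longrightarrow> idx (q j) = j"
  using enum by (auto simp: idx_def bij_betw_def)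

lemma q_quads: "j < N \<Longrightarrow> q j \<in> quads Z"
  using q_bounded[of j] by (auto simp: bounded_quads_def)

lemma open_part_domain: "open_part Z \<subseteq> domain"
  using open_part_cr_system open_part_finite by (fastforce simp: domain_def bounded_quads_def)

lemma domain_hcoords:
  assumes "x \<in> domain" "r \<in> bounded_quads Z \<Gamma>"
  shows "denom x r = 1" "x r = Fin (numer x r)"
  using assms by (cases "x r"; auto simp: domain_def)+

text \<open>
  Every cross-ratio is a fractional linear function of a bounded one; \<open>lift h r\<close> are the
  homogeneous coordinates of the former in terms of those of the latter.
\<close>

fun lift :: "('z quad \<Rightarrow> 'k::field \<times> 'k) \<Rightarrow> 'z quad \<Rightarrow> 'k \<times> 'k" where
  "lift h (a, b, c, d) =
    (if (a, b, c, d) \<in> bounded_quads Z \<Gamma> then h (a, b, c, d)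
     else if (a, b, d, c) \<in> bounded_quads Z \<Gamma> then (snd (h (a, b, d, c)), fst (h (a, b, d, c)))
     else (fst (h (a, c, d, b)) - snd (h (a, c, d, b)), fst (h (a, c, d, b))))"

declare lift.simps [simp del]

lemma third_bounded:
  assumes "(a, b, c, d) \<in> quads Z" "(a, b, c, d) \<notin> bounded_quads Z \<Gamma>" "(a, b, d, c) \<notin> bounded_quads Z \<Gamma>"
  shows "(a, c, d, b) \<in> bounded_quads Z \<Gamma>"
proof -
  have "\<exists>G\<in>\<Gamma>. displays G a d b c" using assms(1,2) by (auto simp: bounded_quads_iff)
  moreover have "\<exists>G\<in>\<Gamma>. displays G a c b d"
    using assms(1,3) by (auto simp: bounded_quads_iff quads_iff)
  ultimately have "\<not> (\<exists>G\<in>\<Gamma>. displays G a b c d)" using not_all[of a b c d] by blast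
  then show ?thesis using assms(1) by (auto simp: bounded_quads_iff quads_iff)
qed

lemma lift_cases:
  assumes "r \<in> quads Z"
  obtains (same) "r \<in> bounded_quads Z \<Gamma>"
      "\<And>h :: 'z quad \<Rightarrow> 'k::field \<times> 'k. lift h r = h r"
  | (swap) s where "s \<in> bounded_quads Z \<Gamma>"
      "\<And>h :: 'z quad \<Rightarrow> 'k \<times> 'k. lift h r = (snd (h s), fst (h s))"
  | (diff) s where "s \<in> bounded_quads Z \<Gamma>"
      "\<And>h :: 'z quad \<Rightarrow> 'k \<times> 'k. lift h r = (fst (h s) - snd (h s), fst (h s))"
proof -
  obtain a b c d where r: "r = (a, b, c, d)" by (cases r)
  show ?thesis
  proof (cases "(a, b, c, d) \<in> bounded_quads Z \<Gamma>")
    case True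
    then show ?thesis using same r by (simp add: lift.simps)
  next
    case False
    show ?thesis
    proof (cases "(a, b, d, c) \<in> bounded_quads Z \<Gamma>")
      case True
      then show ?thesis using swap False r by (simp add: lift.simps)
    next
      case False2: False
      have "(a, c, d, b) \<in> bounded_quads Z \<Gamma>" using third_bounded False False2 assms r by simp
      then show ?thesis using diff False False2 r by (simp add: lift.simps)
    qed
  qed
qed

lemma lift_nonzero:
  fixes h :: "'z quad \<Rightarrow> 'k::field \<times> 'k"
  assumes "r \<in> quads Z" "\<And>s. s \<in> bounded_quads Z \<Gamma> \<Longrightarrow> fst (h s) \<noteq> 0 \<or> snd (h s) \<noteq> 0"
  shows "fst (lift h r) \<noteq> 0 \<or> snd (lift h r) \<noteq> 0"
proof (rule lift_cases[OF assms(1), where 'k = 'k])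
qed (use assms(2) in auto)

lemma lift_cong:
  fixes h h' :: "'z quad \<Rightarrow> 'k::field \<times> 'k"
  assumes "r \<in> quads Z" "\<And>s. s \<in> bounded_quads Z \<Gamma> \<Longrightarrow> h s = h' s"
  shows "lift h r = lift h' r"
  by (rule lift_cases[OF assms(1), where 'k = 'k]) (simp_all add: assms(2))

lemma lift_value:
  fixes x :: "'z quad \<Rightarrow> 'k::field pline"
  assumes sys: "cr_system Z x" and r: "r \<in> quads Z"
  shows "x r = ratio (fst (lift (hcoords \<circ> x) r)) (snd (lift (hcoords \<circ> x) r))"
proof -
  obtain a b c d where r_eq: "r = (a, b, c, d)" by (cases r)
  then have Q: "(a, b, c, d) \<in> quads Z" using r by simp
  then have Q2: "(a, c, b, d) \<in> quads Z" by (auto simp: quads_iff)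
  have inv: "x (a, b, c, d) = ratio (denom x (a, b, d, c)) (numer x (a, b, d, c))"
    using cr_inverse[OF sys Q] hcoords_nonzero[of "x (a, b, d, c)"]
    by (cases "x (a, b, c, d)"; cases "x (a, b, d, c)") (auto simp: ratio_def field_simps)
  have compl: "x (a, b, c, d) = ratio (numer x (a, c, d, b) - denom x (a, c, d, b)) (numer x (a, c, d, b))"
  proof (cases "x (a, c, b, d)")
    case Infty
    then have "x (a, b, c, d) = Infty"
      using cr_complement[OF sys Q] by (cases "x (a, b, c, d)") auto
    moreover have "x (a, c, d, b) = Fin 0" using cr_infty_iff_zero[OF sys Q2] Infty by simp
    ultimately show ?thesis by (simp add: ratio_def)
  next
    case (Fin t)
    then have val: "x (a, b, c, d) = Fin (1 - t)" using cr_complement_value[OF sys Q2] by simp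
    show ?thesis
    proof (cases "t = 0")
      case True
      then have "x (a, c, d, b) = Infty"
        using cr_inverse[OF sys Q2] Fin by (cases "x (a, c, d, b)") auto
      then show ?thesis using val True by (simp add: ratio_def)
    next
      case False
      then have "x (a, c, d, b) = Fin (1 / t)" using cr_inverse_value[OF sys Q2 Fin] by simp
      moreover have "(1 / t - 1) / (1 / t) = 1 - t" using False by (simp add: field_simps)
      ultimately show ?thesis using val False by (simp add: ratio_def)
    qed
  qed
  show ?thesis
    unfolding r_eq lift.simps using inv compl by simp
qed

definition unchart :: "(nat \<Rightarrow> 'k::field pline) \<Rightarrow> 'z quad \<Rightarrow> 'k pline" where
  "unchart w = (\<lambda>r\<in>quads Z. ratio (fst (lift (hcoords \<circ> w \<circ> idx) r)) (snd (lift (hcoords \<circ> w \<circ> idx) r)))"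

lemma affine_embed_coords:
  assumes "x \<in> domain" "j < N"
  shows "affine_embed N (coords x) j = x (q j)"
  using domain_hcoords(2)[OF assms(1) q_bounded[OF assms(2)]] assms(2)
  by (simp add: affine_embed_def coords_def)

lemma unchart_coords:
  assumes x: "x \<in> domain"
  shows "unchart (affine_embed N (coords x)) = x"
proof
  fix r
  have sys: "cr_system Z x" using x by (simp add: domain_def)
  show "unchart (affine_embed N (coords x)) r = x r"
  proof (cases "r \<in> quads Z")
    case True
    have "lift (hcoords \<circ> affine_embed N (coords x) \<circ> idx) r = lift (hcoords \<circ> x) r"
      using idx affine_embed_coords[OF x] by (intro lift_cong[OF True]) simp
    then show ?thesis using True lift_value[OF sys True] by (simp add: unchart_def)
  next
    case False
    have "x \<in> quads Z \<rightarrow>\<^sub>E UNIV" using sys unfolding cr_system_def by blast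
    then show ?thesis using PiE_arb[OF _ False] False unfolding unchart_def by fastforce
  qed
qed

lemma coords_extensional: "coords x \<in> {..<N} \<rightarrow>\<^sub>E UNIV"
  by (simp add: coords_def)

lemma vanishing_form:
  fixes p :: "(nat \<Rightarrow> 'k::alg_closed_field) \<Rightarrow> 'k"
  assumes "p \<in> polynomial_funs N"
  obtains d F where "multiform (quads Z) d F" "\<And>x. x \<in> domain \<Longrightarrow> F (hcoords \<circ> x) = p (coords x)"
proof -
  obtain d F where F: "multiform (quads Z) d F"
    "\<And>h. (\<And>j. j < N \<Longrightarrow> snd (h (q j)) = 1) \<Longrightarrow> F h = p (\<lambda>j. fst (h (q j)))"
    using homogenization[OF assms, of q "quads Z"] q_quads by blast
  have "F (hcoords \<circ> x) = p (coords x)" if x: "x \<in> domain" for x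
  proof -
    have "F (hcoords \<circ> x) = p (\<lambda>j. numer x (q j))"
      using F(2)[of "hcoords \<circ> x"] domain_hcoords(1)[OF x q_bounded] by simp
    also have "\<dots> = p (coords x)"
      by (rule polynomial_funs_cong[OF assms]) (simp add: coords_def)
    finally show ?thesis .
  qed
  then show ?thesis using that F(1) by blast
qed

text \<open>
  A polynomial that vanishes on configurations homogenizes to a form that does, and configurations
  are dense in the moduli space.
\<close>

lemma coords_in_closure:
  fixes x :: "'z quad \<Rightarrow> 'k::alg_closed_field pline"
  assumes x: "x \<in> domain"
  shows "coords x \<in> image_closure"
  unfolding image_closure_def
proof (intro CollectI conjI coords_extensional ballI impI)
  fix p :: "(nat \<Rightarrow> 'k) \<Rightarrow> 'k"
  assume p: "p \<in> polynomial_funs N" "\<forall>m\<in>open_part Z. p (coords m) = 0"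
  obtain d F where F: "multiform (quads Z) d F" "\<And>x. x \<in> domain \<Longrightarrow> F (hcoords \<circ> x) = p (coords x)"
    using vanishing_form[OF p(1)] by blast
  have "\<forall>m\<in>open_part Z. F (hcoords \<circ> m) = 0" using F(2) p(2) open_part_domain by auto
  moreover have "in_closure (quads Z) (open_part Z) x"
    by (rule cr_system_in_closure[OF finite_Z card_Z]) (use x in \<open>simp add: domain_def\<close>)
  ultimately have "F (hcoords \<circ> x) = 0" using F(1) unfolding in_closure_def by blast
  then show "p (coords x) = 0" using F(2)[OF x] by simp
qed

text \<open>
  The system recovered from \<open>v\<close> lies in the moduli space because the latter is closed: a form that
  vanishes on configurations becomes, after the substitution \<open>lift\<close>, a polynomial in the bounded
  cross-ratios that vanishes on configurations, hence at \<open>v\<close>.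
\<close>

lemma unchart_closure:
  fixes v :: "nat \<Rightarrow> 'k::alg_closed_field"
  assumes v: "v \<in> image_closure"
  shows "unchart (affine_embed N v) \<in> domain" "coords (unchart (affine_embed N v)) = v"
proof -
  let ?y = "unchart (affine_embed N v)"
  define h where "h w s = (w (idx s), 1 :: 'k)" for w :: "nat \<Rightarrow> 'k" and s
  have h_eq: "lift (hcoords \<circ> affine_embed N v \<circ> idx) r = lift (h v) r" if "r \<in> quads Z" for r
    using idx(1) by (intro lift_cong[OF that]) (simp add: affine_embed_def h_def)
  have y: "?y r = ratio (fst (lift (h v) r)) (snd (lift (h v) r))" if "r \<in> quads Z" for r
    using that h_eq[OF that] by (simp add: unchart_def)
  have nz: "fst (lift (h w) r) \<noteq> 0 \<or> snd (lift (h w) r) \<noteq> 0" if "r \<in> quads Z" for w r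
    using lift_nonzero[OF that, of "h w"] by (simp add: h_def)
  have bounded: "?y r = Fin (v (idx r))" if "r \<in> bounded_quads Z \<Gamma>" for r
  proof -
    have "r \<in> quads Z" using that by (auto simp: bounded_quads_def)
    moreover have "lift (h v) r = h v r" using that by (cases r) (simp add: lift.simps)
    ultimately show ?thesis using y by (simp add: h_def ratio_def)
  qed
  have "in_closure (quads Z) (open_part Z) ?y"
    unfolding in_closure_def
  proof (intro conjI allI impI)
    show "?y \<in> quads Z \<rightarrow>\<^sub>E UNIV" by (simp add: unchart_def)
  next
    fix d and F :: "(_ \<Rightarrow> 'k \<times> 'k) \<Rightarrow> 'k"
    assume F: "multiform (quads Z) d F" and van: "\<forall>m\<in>open_part Z. F (hcoords \<circ> m) = 0"
    define p where "p w = F (\<lambda>r. lift (h w) r)" for w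
    have poly: "(\<lambda>w. fst (lift (h w) r)) \<in> polynomial_funs N \<and> (\<lambda>w. snd (lift (h w) r)) \<in> polynomial_funs N"
      if "r \<in> quads Z" for r
    proof -
      have c: "(\<lambda>w :: nat \<Rightarrow> 'k. w (idx s)) \<in> polynomial_funs N" if "s \<in> bounded_quads Z \<Gamma>" for s
        using idx(1)[OF that] by (rule polynomial_funs.coord)
      have c1: "(\<lambda>w :: nat \<Rightarrow> 'k. w (idx s) - 1) \<in> polynomial_funs N" if "s \<in> bounded_quads Z \<Gamma>" for s
        using polynomial_funs.add[OF c[OF that] polynomial_funs.scalar[of "-1"]] by simp
      show ?thesis
        by (rule lift_cases[OF that, where 'k = 'k])
          (simp_all add: h_def c c1 polynomial_funs.scalar)
    qed
    have p: "p \<in> polynomial_funs N"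
      unfolding p_def using poly by (intro multiform_compose_polynomial_funs[OF F]) auto
    have "p (coords m) = 0" if m: "m \<in> open_part Z" for m
    proof -
      have md: "m \<in> domain" using m open_part_domain by blast
      have "h (coords m) s = hcoords (m s)" if "s \<in> bounded_quads Z \<Gamma>" for s
        using idx[OF that] domain_hcoords(1)[OF md that] by (intro prod_eqI) (simp_all add: h_def coords_def)
      then have "lift (h (coords m)) r = lift (hcoords \<circ> m) r" if "r \<in> quads Z" for r
        by (intro lift_cong[OF that]) simp
      then have "m r = ratio (fst (lift (h (coords m)) r)) (snd (lift (h (coords m)) r))" if "r \<in> quads Z" for r
        using lift_value[OF open_part_cr_system[OF m] that] that by simp
      then have "F (hcoords \<circ> m) = 0 \<longleftrightarrow> F (\<lambda>r. lift (h (coords m)) r) = 0"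
        using nz by (intro multiform_zero_ratio[OF F finite_quads[OF finite_Z]]) auto
      then show ?thesis using van m by (simp add: p_def)
    qed
    then have "p v = 0" using v p unfolding image_closure_def by blast
    moreover have "F (hcoords \<circ> ?y) = 0 \<longleftrightarrow> F (\<lambda>r. lift (h v) r) = 0"
      using nz y by (intro multiform_zero_ratio[OF F finite_quads[OF finite_Z]]) auto
    ultimately show "F (hcoords \<circ> ?y) = 0" by (simp add: p_def)
  qed
  then have "cr_system Z ?y" by (rule cr_system_closed) (rule open_part_cr_system)
  then show "?y \<in> domain" using bounded by (simp add: domain_def)
  show "coords ?y = v"
  proof
    fix j
    have ext: "v \<in> {..<N} \<rightarrow>\<^sub>E UNIV" using v by (simp add: image_closure_def)
    show "coords ?y j = v j"
    proof (cases "j < N")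
      case True
      then show ?thesis using bounded[OF q_bounded[OF True]] idx_q[OF True] by (simp add: coords_def)
    next
      case False
      then show ?thesis using PiE_arb[OF ext, of j] by (simp add: coords_def)
    qed
  qed
qed

lemma image_closure_irreducible: "irreducible_closed N (image_closure :: (nat \<Rightarrow> 'k::alg_closed_field) set)"
  unfolding irreducible_closed_def
proof (intro conjI allI impI)
  show "zariski_closed N (image_closure :: (nat \<Rightarrow> 'k) set)"
    unfolding zariski_closed_def image_closure_def
    by (rule exI[of _ "{p \<in> polynomial_funs N. \<forall>m\<in>open_part Z. p (coords m) = 0}"]) auto
  obtain u :: "'z \<Rightarrow> 'k \<times> 'k" where u: "config Z u" using config_exists[OF finite_Z] .
  have "cr_of Z u \<in> open_part Z" using u by (simp add: open_part_def)
  then show "(image_closure :: (nat \<Rightarrow> 'k) set) \<noteq> {}"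
    using coords_in_closure open_part_domain by blast
next
  fix V1 V2 :: "(nat \<Rightarrow> 'k) set"
  assume V: "zariski_closed N V1" "zariski_closed N V2" "image_closure = V1 \<union> V2"
  obtain P1 where P1: "P1 \<subseteq> polynomial_funs N" "V1 = {v \<in> {..<N} \<rightarrow>\<^sub>E UNIV. \<forall>p\<in>P1. p v = 0}"
    using V(1) unfolding zariski_closed_def by blast
  obtain P2 where P2: "P2 \<subseteq> polynomial_funs N" "V2 = {v \<in> {..<N} \<rightarrow>\<^sub>E UNIV. \<forall>p\<in>P2. p v = 0}"
    using V(2) unfolding zariski_closed_def by blast
  have all1: "image_closure \<subseteq> {v \<in> {..<N} \<rightarrow>\<^sub>E UNIV. \<forall>p\<in>P. p v = 0}"
    if "P \<subseteq> polynomial_funs N" "\<And>p m. p \<in> P \<Longrightarrow> m \<in> open_part Z \<Longrightarrow> p (coords m) = 0"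
    for P :: "((nat \<Rightarrow> 'k) \<Rightarrow> 'k) set"
  proof (intro subsetI CollectI conjI ballI)
    fix v :: "nat \<Rightarrow> 'k" assume v: "v \<in> image_closure"
    then show "v \<in> {..<N} \<rightarrow>\<^sub>E UNIV" unfolding image_closure_def by simp
    fix p assume p: "p \<in> P"
    have "\<forall>p\<in>polynomial_funs N. (\<forall>m\<in>open_part Z. p (coords m) = 0) \<longrightarrow> p v = 0"
      using v unfolding image_closure_def by simp
    moreover have "p \<in> polynomial_funs N" using that(1) p by (rule subsetD)
    moreover have "\<forall>m\<in>open_part Z. p (coords m) = 0" using that(2)[OF p] by simp
    ultimately show "p v = 0" by simp
  qed
  show "image_closure = V1 \<or> image_closure = V2"
  proof (rule ccontr)
    assume neg: "\<not> ?thesis"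
    have "\<not> image_closure \<subseteq> V1" "\<not> image_closure \<subseteq> V2" using neg V(3) by blast+
    then have "\<exists>p\<in>P1. \<exists>m\<in>open_part Z. p (coords m) \<noteq> 0" "\<exists>p\<in>P2. \<exists>m\<in>open_part Z. p (coords m) \<noteq> 0"
      using all1[OF P1(1)] all1[OF P2(1)] unfolding P1(2)[symmetric] P2(2)[symmetric] by metis+
    then obtain p1 p2 m1 m2 where p: "p1 \<in> P1" "m1 \<in> open_part Z" "p1 (coords m1) \<noteq> 0"
      "p2 \<in> P2" "m2 \<in> open_part Z" "p2 (coords m2) \<noteq> 0"
      by (elim bexE) (rule that)
    obtain d1 F1 where F1: "multiform (quads Z) d1 F1" "\<And>x. x \<in> domain \<Longrightarrow> F1 (hcoords \<circ> x) = p1 (coords x)"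
      using vanishing_form P1(1) p(1) by blast
    obtain d2 F2 where F2: "multiform (quads Z) d2 F2" "\<And>x. x \<in> domain \<Longrightarrow> F2 (hcoords \<circ> x) = p2 (coords x)"
      using vanishing_form P2(1) p(4) by blast
    have dom: "m \<in> domain" if "m \<in> open_part Z" for m :: "_ \<Rightarrow> 'k pline"
      using that open_part_domain by blast
    have "F1 (hcoords \<circ> m) * F2 (hcoords \<circ> m) = 0" if "m \<in> open_part Z" for m
    proof -
      have "coords m \<in> V1 \<union> V2" using coords_in_closure[OF dom[OF that]] V(3) by simp
      then have "p1 (coords m) = 0 \<or> p2 (coords m) = 0" using P1(2) P2(2) p(1,4) by blast
      then show ?thesis using F1(2) F2(2) dom[OF that] by auto
    qed
    then have "(\<forall>m\<in>open_part Z. F1 (hcoords \<circ> m) = 0) \<or> (\<forall>m\<in>open_part Z. F2 (hcoords \<circ> m) = 0)"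
      by (rule open_part_irreducible[OF finite_Z F1(1) F2(1)])
    then show False using p F1(2) F2(2) dom by auto
  qed
qed

lemma regular_map_form:
  assumes "multiform I d F" "multiform I d G"
    and "\<And>x. x \<in> X \<Longrightarrow> F (hcoords \<circ> x) \<noteq> 0 \<or> G (hcoords \<circ> x) \<noteq> 0"
    and "\<And>x. x \<in> X \<Longrightarrow> f x = ratio (F (hcoords \<circ> x)) (G (hcoords \<circ> x))"
  shows "regular_map I X f"
  unfolding regular_map_def using assms by blast

lemma domain_affine: "affine_variety (quads Z) (domain :: ('z quad \<Rightarrow> 'k::alg_closed_field pline) set)"
proof -
  let ?X = "domain :: ('z quad \<Rightarrow> 'k pline) set" and ?V = "image_closure :: (nat \<Rightarrow> 'k) set"
  let ?\<phi> = "\<lambda>x :: 'z quad \<Rightarrow> 'k pline. affine_embed N (coords x)"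
  have "morphism_between (quads Z) ?X {..<N} (affine_embed N ` ?V) ?\<phi>"
    unfolding morphism_between_def
  proof (intro conjI ballI)
    show "?\<phi> \<in> ?X \<rightarrow> affine_embed N ` ?V" using coords_in_closure by blast
    fix j assume "j \<in> {..<N}"
    then have j: "j < N" by simp
    show "regular_map (quads Z) ?X (\<lambda>x. ?\<phi> x j)"
      by (rule regular_map_form[OF multiform.coord1[OF q_quads[OF j]] multiform.coord2[OF q_quads[OF j]]])
        (use affine_embed_coords j hcoords_nonzero in auto)
  qed
  moreover have "morphism_between {..<N} (affine_embed N ` ?V) (quads Z) ?X unchart"
    unfolding morphism_between_def
  proof (intro conjI ballI)
    show "unchart \<in> affine_embed N ` ?V \<rightarrow> ?X" using unchart_closure(1) by blast
    fix r assume r: "r \<in> quads Z"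
    have "\<exists>d. multiform {..<N} d (\<lambda>h :: nat \<Rightarrow> 'k \<times> 'k. fst (lift (h \<circ> idx) r)) \<and>
        multiform {..<N} d (\<lambda>h :: nat \<Rightarrow> 'k \<times> 'k. snd (lift (h \<circ> idx) r))"
    proof (rule lift_cases[OF r, where 'k = 'k])
      assume b: "r \<in> bounded_quads Z \<Gamma>" and l: "\<And>h :: _ \<Rightarrow> 'k \<times> 'k. lift h r = h r"
      have i: "idx r \<in> {..<N}" using idx(1)[OF b] by simp
      show ?thesis unfolding l o_def using multiform.coord1[OF i] multiform.coord2[OF i] by blast
    next
      fix s assume b: "s \<in> bounded_quads Z \<Gamma>" and l: "\<And>h :: _ \<Rightarrow> 'k \<times> 'k. lift h r = (snd (h s), fst (h s))"
      have i: "idx s \<in> {..<N}" using idx(1)[OF b] by simp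
      show ?thesis unfolding l o_def fst_conv snd_conv using multiform.coord1[OF i] multiform.coord2[OF i] by blast
    next
      fix s assume b: "s \<in> bounded_quads Z \<Gamma>"
        and l: "\<And>h :: _ \<Rightarrow> 'k \<times> 'k. lift h r = (fst (h s) - snd (h s), fst (h s))"
      have i: "idx s \<in> {..<N}" using idx(1)[OF b] by simp
      show ?thesis
        unfolding l o_def fst_conv snd_conv
        using multiform_diff[OF multiform.coord1[OF i] multiform.coord2[OF i]] multiform.coord1[OF i] by blast
    qed
    then obtain d where d: "multiform {..<N} d (\<lambda>h :: nat \<Rightarrow> 'k \<times> 'k. fst (lift (h \<circ> idx) r))"
      "multiform {..<N} d (\<lambda>h :: nat \<Rightarrow> 'k \<times> 'k. snd (lift (h \<circ> idx) r))" by blast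
    show "regular_map {..<N} (affine_embed N ` ?V) (\<lambda>w. unchart w r)"
    proof (rule regular_map_form[OF d])
      fix w :: "nat \<Rightarrow> 'k pline"
      show "fst (lift (hcoords \<circ> w \<circ> idx) r) \<noteq> 0 \<or> snd (lift (hcoords \<circ> w \<circ> idx) r) \<noteq> 0"
        using hcoords_nonzero by (intro lift_nonzero[OF r]) simp
      show "unchart w r = ratio (fst (lift (hcoords \<circ> w \<circ> idx) r)) (snd (lift (hcoords \<circ> w \<circ> idx) r))"
        using r by (simp add: unchart_def)
    qed
  qed
  moreover have "\<forall>x\<in>?X. unchart (?\<phi> x) = x"
    using unchart_coords by (rule ballI)
  moreover have "?\<phi> (unchart w) = w" if w: "w \<in> affine_embed N ` ?V" for w
  proof -
    obtain v where v: "v \<in> ?V" "w = affine_embed N v" using w by blast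
    show ?thesis unfolding v(2) unchart_closure(2)[OF v(1)] ..
  qed
  ultimately have "isomorphic_varieties (quads Z) ?X {..<N} (affine_embed N ` ?V)"
    unfolding isomorphic_varieties_def by blast
  then show ?thesis unfolding affine_variety_def using image_closure_irreducible by blast
qed

end

theorem proposition1p45:
  fixes Z :: "'z set"
    and \<gamma> :: "('z \<times> 'z \<times> 'z \<times> 'z \<Rightarrow> 'k::alg_closed_field pline) set set"
  assumes "finite Z"
    and "(\<exists>A. indexes_divisor Z A \<and> \<gamma> = {divisor Z A}) \<or>
      (\<exists>A B. indexes_divisor Z A \<and> indexes_divisor Z B \<and>
         \<gamma> = {divisor Z A, divisor Z B}) \<or>
      (\<exists>A B. indexes_divisor Z A \<and> indexes_divisor Z B \<and> indexes_divisor Z (A \<union> B) \<and>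
         \<gamma> = {divisor Z A, divisor Z B, divisor Z (A \<union> B)})"
  shows "affine_variety (quads Z) (partial_compactification Z \<gamma>)"
proof -
  obtain A B \<Gamma> where \<Gamma>: "\<Gamma> = {A, B} \<or> \<Gamma> = {A, B, A \<union> B}" "\<And>G. G \<in> \<Gamma> \<Longrightarrow> indexes_divisor Z G"
    "\<gamma> = divisor Z ` \<Gamma>"
  proof -
    consider A where "indexes_divisor Z A" "\<gamma> = {divisor Z A}"
      | A B where "indexes_divisor Z A" "indexes_divisor Z B" "\<gamma> = {divisor Z A, divisor Z B}"
      | A B where "indexes_divisor Z A" "indexes_divisor Z B" "indexes_divisor Z (A \<union> B)"
        "\<gamma> = {divisor Z A, divisor Z B, divisor Z (A \<union> B)}"
      using assms(2) by blast
    then show ?thesis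
    proof cases
      \<comment> \<open>A single divisor is the case where both sets are equal.\<close>
      case (1 A)
      then show ?thesis by (intro that[of "{A, A}" A A]) auto
    next
      case (2 A B)
      then show ?thesis by (intro that[of "{A, B}" A B]) auto
    next
      case (3 A B)
      then show ?thesis by (intro that[of "{A, B, A \<union> B}" A B]) auto
    qed
  qed
  have "\<Gamma> \<noteq> {}" using \<Gamma>(1) by auto
  then have card: "3 \<le> card Z" using \<Gamma>(2) by (force simp: indexes_divisor_def)
  have und: "undisplayed \<Gamma> E (Z - E)" if "indexes_divisor Z E" "E \<notin> \<Gamma>" "Z - E \<notin> \<Gamma>" for E
    by (rule undisplayed_quartet_exists[OF assms(1) that(1) \<Gamma>(1,2) that(2,3)])
  have "finite (bounded_quads Z \<Gamma>)"
    using finite_quads[OF assms(1)] by (rule finite_subset[rotated]) (auto simp: bounded_quads_def)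
  then obtain q where q: "bij_betw q {..<card (bounded_quads Z \<Gamma>)} (bounded_quads Z \<Gamma>)"
    using ex_bij_betw_nat_finite unfolding atLeast0LessThan by blast
  have sub: "\<Gamma> \<subseteq> {A, B, A \<union> B}" using \<Gamma>(1) by blast
  interpret affine_chart Z \<Gamma> "card (bounded_quads Z \<Gamma>)" q
    using assms(1) card not_all_quartets_displayed[OF sub] q by unfold_locales blast+
  have "partial_compactification Z \<gamma> = domain"
    unfolding \<Gamma>(3) domain_def by (rule partial_compactification_eq[OF assms(1) card \<Gamma>(2) und])
  then show ?thesis using domain_affine by simp
qed

end
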